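(* Let $H=(V,F)$ be a connected hypergraph with $n$ vertices, $m$ hyperedges and diameter $d$, and let $V_s, V_t$ be two vertex covers of $H$ of size $k$. Then one can compute, in $\mathcal{O}(n^{3.5}+n^2 m)$ time, a reconfiguration sequence from $V_s$ to $V_t$ under $(k,1)$-Token Jumping consisting of $\mathcal{O}(n\cdot d)$ moves, all of whose configurations are vertex covers of $H$ of size $k$.
   Context: A vertex cover of a hypergraph is a set of vertices intersecting every hyperedge. In a hypergraph $H$, a path is a sequence of vertices $v_1,\dots,v_\ell$ where $v_i$ and $v_{i+1}$ share a hyperedge; its length is $\ell-1$; $\mathrm{dist}_H$ is the minimum length of a path. A configuration is a set of $k$ vertices (tokens on distinct vertices). A move under $(k,1)$-Token Jumping from configuration $D$ to $D'$ is a bijection $f: D\to D'$ with $\mathrm{dist}_H(v,f(v))\leq 1$ for all $v\in D$ (all tokens may move simultaneously, each to a vertex at distance at most 1). A reconfiguration sequence is a sequence of configurations, each a vertex cover of size $k$, with a move between every two consecutive ones. *)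

theory Defs
  imports Complex_Main "HOL-Library.Extended_Nat"
begin

definition hypergraph :: "'a set \<Rightarrow> 'a set set \<Rightarrow> bool" where
  "hypergraph V F \<longleftrightarrow> finite V \<and> V \<noteq> {} \<and> F \<subseteq> Pow V"

definition vertex_cover :: "'a set \<Rightarrow> 'a set set \<Rightarrow> 'a set \<Rightarrow> bool" where
  "vertex_cover V F C \<longleftrightarrow> C \<subseteq> V \<and> (\<forall>e\<in>F. e \<inter> C \<noteq> {})"

definition hpath :: "'a set \<Rightarrow> 'a set set \<Rightarrow> 'a \<Rightarrow> 'a list \<Rightarrow> 'a \<Rightarrow> bool" where
  "hpath V F u p v \<longleftrightarrow> p \<noteq> [] \<and> hd p = u \<and> last p = v \<and> set p \<subseteq> V \<and>
     (\<forall>i. Suc i < length p \<longrightarrow> (\<exists>e\<in>F. p ! i \<in> e \<and> p ! Suc i \<in> e))"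

text \<open>The distance is \<open>\<infinity>\<close> when no path exists.\<close>

definition hdist :: "'a set \<Rightarrow> 'a set set \<Rightarrow> 'a \<Rightarrow> 'a \<Rightarrow> enat" where
  "hdist V F u v = (INF p\<in>{p. hpath V F u p v}. enat (length p - 1))"

definition hconnected :: "'a set \<Rightarrow> 'a set set \<Rightarrow> bool" where
  "hconnected V F \<longleftrightarrow> (\<forall>u\<in>V. \<forall>v\<in>V. \<exists>p. hpath V F u p v)"

definition hdiam :: "'a set \<Rightarrow> 'a set set \<Rightarrow> enat" where
  "hdiam V F = (SUP (u, v)\<in>V \<times> V. hdist V F u v)"

definition tj_move :: "'a set \<Rightarrow> 'a set set \<Rightarrow> 'a set \<Rightarrow> 'a set \<Rightarrow> bool" where
  "tj_move V F D D' \<longleftrightarrow> (\<exists>f. bij_betw f D D' \<and> (\<forall>v\<in>D. hdist V F v (f v) \<le> 1))"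

definition reconf_seq :: "'a set \<Rightarrow> 'a set set \<Rightarrow> nat \<Rightarrow> 'a set list \<Rightarrow> bool" where
  "reconf_seq V F k Ds \<longleftrightarrow> Ds \<noteq> [] \<and>
     (\<forall>D\<in>set Ds. vertex_cover V F D \<and> card D = k) \<and>
     (\<forall>i. Suc i < length Ds \<longrightarrow> tj_move V F (Ds ! i) (Ds ! Suc i))"

text \<open>
  Running time is measured on a word RAM programmed in a structured language. A state consists of
  registers and arrays of natural numbers; a program mentions only finitely many of them. Every
  syntactic node that is evaluated costs one time unit. The parameter \<open>B\<close> of the semantics is the
  word bound: every value and address produced during a run must be smaller than \<open>B\<close>, otherwise
  the run is stuck.
\<close>

datatype aexp =
    Const nat
  | Reg nat
  | Arr nat aexp
  | Add aexp aexp
  | Sub aexp aexp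
  | Mul aexp aexp

datatype bexp =
    Less aexp aexp
  | Equal aexp aexp
  | Neg bexp
  | Conj bexp bexp

datatype com =
    Skip
  | Assign nat aexp
  | Store nat aexp aexp
  | Seq com com
  | Cond bexp com com
  | While bexp com

record state =
  reg :: "nat \<Rightarrow> nat"
  arr :: "nat \<Rightarrow> nat \<Rightarrow> nat"

fun aval :: "aexp \<Rightarrow> state \<Rightarrow> nat" where
  "aval (Const c) s = c"
| "aval (Reg x) s = reg s x"
| "aval (Arr A i) s = arr s A (aval i s)"
| "aval (Add a b) s = aval a s + aval b s"
| "aval (Sub a b) s = aval a s - aval b s"
| "aval (Mul a b) s = aval a s * aval b s"

fun acost :: "aexp \<Rightarrow> nat" where
  "acost (Const c) = 1"
| "acost (Reg x) = 1"
| "acost (Arr A i) = 1 + acost i"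
| "acost (Add a b) = 1 + acost a + acost b"
| "acost (Sub a b) = 1 + acost a + acost b"
| "acost (Mul a b) = 1 + acost a + acost b"

fun afits :: "nat \<Rightarrow> aexp \<Rightarrow> state \<Rightarrow> bool" where
  "afits B (Const c) s \<longleftrightarrow> c < B"
| "afits B (Reg x) s \<longleftrightarrow> reg s x < B"
| "afits B (Arr A i) s \<longleftrightarrow> afits B i s \<and> arr s A (aval i s) < B"
| "afits B (Add a b) s \<longleftrightarrow> afits B a s \<and> afits B b s \<and> aval a s + aval b s < B"
| "afits B (Sub a b) s \<longleftrightarrow> afits B a s \<and> afits B b s"
| "afits B (Mul a b) s \<longleftrightarrow> afits B a s \<and> afits B b s \<and> aval a s * aval b s < B"

fun bval :: "bexp \<Rightarrow> state \<Rightarrow> bool" where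
  "bval (Less a b) s \<longleftrightarrow> aval a s < aval b s"
| "bval (Equal a b) s \<longleftrightarrow> aval a s = aval b s"
| "bval (Neg b) s \<longleftrightarrow> \<not> bval b s"
| "bval (Conj b c) s \<longleftrightarrow> bval b s \<and> bval c s"

fun bcost :: "bexp \<Rightarrow> nat" where
  "bcost (Less a b) = 1 + acost a + acost b"
| "bcost (Equal a b) = 1 + acost a + acost b"
| "bcost (Neg b) = 1 + bcost b"
| "bcost (Conj b c) = 1 + bcost b + bcost c"

fun bfits :: "nat \<Rightarrow> bexp \<Rightarrow> state \<Rightarrow> bool" where
  "bfits B (Less a b) s \<longleftrightarrow> afits B a s \<and> afits B b s"
| "bfits B (Equal a b) s \<longleftrightarrow> afits B a s \<and> afits B b s"
| "bfits B (Neg b) s \<longleftrightarrow> bfits B b s"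
| "bfits B (Conj b c) s \<longleftrightarrow> bfits B b s \<and> bfits B c s"

definition set_reg :: "nat \<Rightarrow> nat \<Rightarrow> state \<Rightarrow> state" where
  "set_reg x v s = s\<lparr>reg := (reg s)(x := v)\<rparr>"

definition set_arr :: "nat \<Rightarrow> nat \<Rightarrow> nat \<Rightarrow> state \<Rightarrow> state" where
  "set_arr A i v s = s\<lparr>arr := (arr s)(A := (arr s A)(i := v))\<rparr>"

text \<open>\<open>exec B c s t s'\<close>: started in \<open>s\<close>, program \<open>c\<close> halts in \<open>s'\<close> after exactly \<open>t\<close> time units,
  with all values below \<open>B\<close>.\<close>

inductive exec :: "nat \<Rightarrow> com \<Rightarrow> state \<Rightarrow> nat \<Rightarrow> state \<Rightarrow> bool" for B where
  Skip: "exec B Skip s 1 s"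
| Assign: "afits B a s \<Longrightarrow> exec B (Assign x a) s (1 + acost a) (set_reg x (aval a s) s)"
| Store: "afits B i s \<Longrightarrow> afits B a s \<Longrightarrow>
    exec B (Store A i a) s (1 + acost i + acost a) (set_arr A (aval i s) (aval a s) s)"
| Seq: "exec B c1 s t1 s' \<Longrightarrow> exec B c2 s' t2 s'' \<Longrightarrow> exec B (Seq c1 c2) s (t1 + t2) s''"
| CondTrue: "bfits B b s \<Longrightarrow> bval b s \<Longrightarrow> exec B c1 s t s' \<Longrightarrow>
    exec B (Cond b c1 c2) s (1 + bcost b + t) s'"
| CondFalse: "bfits B b s \<Longrightarrow> \<not> bval b s \<Longrightarrow> exec B c2 s t s' \<Longrightarrow>
    exec B (Cond b c1 c2) s (1 + bcost b + t) s'"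
| WhileFalse: "bfits B b s \<Longrightarrow> \<not> bval b s \<Longrightarrow> exec B (While b c) s (1 + bcost b) s"
| WhileTrue: "bfits B b s \<Longrightarrow> bval b s \<Longrightarrow> exec B c s t1 s' \<Longrightarrow> exec B (While b c) s' t2 s'' \<Longrightarrow>
    exec B (While b c) s (1 + bcost b + t1 + t2) s''"

inductive_cases exec_SkipE: "exec B Skip s t s'"
inductive_cases exec_AssignE: "exec B (Assign x a) s t s'"
inductive_cases exec_StoreE: "exec B (Store A i a) s t s'"
inductive_cases exec_SeqE: "exec B (Seq c1 c2) s t s'"
inductive_cases exec_CondE: "exec B (Cond b c1 c2) s t s'"
inductive_cases exec_WhileE: "exec B (While b c) s t s'"

lemma exec_deterministic:
  "exec B c s t s' \<Longrightarrow> exec B c s u s'' \<Longrightarrow> u = t \<and> s'' = s'"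
proof (induction arbitrary: u s'' rule: exec.induct)
  case (Skip s)
  from Skip.prems show ?case by (rule exec_SkipE) simp
next
  case (Assign a s x)
  from Assign.prems show ?case by (rule exec_AssignE) simp
next
  case (Store i s a A)
  from Store.prems show ?case by (rule exec_StoreE) simp
next
  case (Seq c1 s t1 s1 c2 t2 s2)
  from Seq.prems obtain u1 r u2 where r: "exec B c1 s u1 r" "exec B c2 r u2 s''" "u = u1 + u2"
    by (rule exec_SeqE)
  from Seq.IH(1)[OF r(1)] have "u1 = t1" "r = s1" by auto
  with Seq.IH(2) r show ?case by simp
next
  case (CondTrue b s c1 t s' c2)
  from CondTrue.prems show ?case
    by (rule exec_CondE) (simp_all add: CondTrue.hyps CondTrue.IH)
next
  case (CondFalse b s c2 t s' c1)
  from CondFalse.prems show ?case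
    by (rule exec_CondE) (simp_all add: CondFalse.hyps CondFalse.IH)
next
  case (WhileFalse b s c)
  from WhileFalse.prems show ?case
    by (rule exec_WhileE) (simp_all add: WhileFalse.hyps)
next
  case (WhileTrue b s c t1 s1 t2 s2)
  from WhileTrue.prems WhileTrue.hyps obtain u1 r u2
    where r: "u = 1 + bcost b + u1 + u2" "exec B c s u1 r" "exec B (While b c) r u2 s''"
    by (auto elim: exec_WhileE)
  from WhileTrue.IH(1)[OF r(2)] have "u1 = t1" "r = s1" by auto
  with WhileTrue.IH(2) r show ?case by simp
qed

text \<open>
  The vertices and the hyperedges are presented in arbitrary orders \<open>xs\<close> and \<open>es\<close>. Registers 0, 1, 2
  hold \<open>n\<close>, \<open>m\<close>, \<open>k\<close>; array 0 holds the incidence matrix (one row per hyperedge), arrays 1 and 2 the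
  characteristic vectors of the source and target covers. All other cells are 0.
\<close>

definition input_state :: "'a list \<Rightarrow> 'a set list \<Rightarrow> nat \<Rightarrow> 'a set \<Rightarrow> 'a set \<Rightarrow> state" where
  "input_state xs es k S T = \<lparr>
     reg = (\<lambda>_. 0)(0 := length xs, 1 := length es, 2 := k),
     arr = (\<lambda>_ _. 0)
       (0 := (\<lambda>a. if a < length es * length xs
                   then of_bool (xs ! (a mod length xs) \<in> es ! (a div length xs)) else 0),
        1 := (\<lambda>i. if i < length xs then of_bool (xs ! i \<in> S) else 0),
        2 := (\<lambda>i. if i < length xs then of_bool (xs ! i \<in> T) else 0))\<rparr>"

text \<open>
  The result is read off register 3 (number of moves) and array 3 (the characteristic vectors of the
  successive configurations, one row per configuration).
\<close>

definition outputs :: "'a list \<Rightarrow> 'a set list \<Rightarrow> state \<Rightarrow> bool" where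
  "outputs xs Ds s \<longleftrightarrow> reg s 3 = length Ds - 1 \<and>
     (\<forall>i<length Ds. \<forall>j<length xs. arr s 3 (i * length xs + j) = of_bool (xs ! j \<in> Ds ! i))"

end

theory Submission
  imports Defs
begin

text \<open>
  Let \<open>S\<close> be the current configuration and \<open>T\<close> the target. Keep a matching between \<open>S - T\<close> and
  \<open>T - S\<close> whose pairs share hyperedges, and treat the unmatched \<open>a \<in> S - T\<close> one by one. If an
  alternating path leads from \<open>a\<close> to an unmatched vertex of \<open>T - S\<close>, augment. Otherwise the vertices
  reached from \<open>a\<close> form a Hall violator: after moving all reached tokens except \<open>a\<close> along the
  matching (one move), the configuration covers every hyperedge even without \<open>a\<close>, since a hyperedge
  that was covered only by moved tokens meets \<open>T\<close> in a vertex that is now occupied. The token on \<open>a\<close>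
  is therefore free and walks along a shortest path to an unmatched vertex of \<open>T - S\<close>; where the path
  is occupied, the tokens on it all step forward simultaneously, so at most \<open>d\<close> moves suffice. When
  \<open>S - T\<close> is completely matched, the matching is a single move to \<open>T\<close>. There are at most \<open>n\<close> rounds,
  each dominated by breadth-first searches on adjacency matrices, so the total time is in fact
  \<open>O(n\<^sup>3 + n\<^sup>2 m)\<close>.
\<close>

section \<open>Timed execution of programs\<close>

text \<open>One sweep over the vertices suffices because progress is monotone: \<open>S - T\<close>
  only shrinks, and a vertex of \<open>S - T\<close>, once matched, stays matched until it leaves
  \<open>S - T\<close>. That the released token has a free target is plain counting, since
  \<open>S - T\<close> and \<open>T - S\<close> have equal size. Configurations are sets, so
  advancing a chain of tokens changes the configuration exactly as if the free token had jumped to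
  the first vacant vertex of the path. The program therefore stores no token identities; the
  bijections exist only in the proof. During a walk the configuration without the free token stays
  fixed and remains a cover. A bound of the form O(n d) leaves no room for additive terms: for n = 1
  the diameter is 0 and no move is allowed, so this case is split off; for n >= 2 the diameter is at
  least 1 and absorbs the final move. Memory shapes the invariants too: output addresses must stay
  below the word bound, so the number of configurations is also bounded in terms of n alone, using
  that search levels never exceed n.\<close>

fun written_regs :: "com \<Rightarrow> nat set" where
  "written_regs Skip = {}"
| "written_regs (Assign x a) = {x}"
| "written_regs (Store A i a) = {}"
| "written_regs (Seq c1 c2) = written_regs c1 \<union> written_regs c2"
| "written_regs (Cond b c1 c2) = written_regs c1 \<union> written_regs c2"
| "written_regs (While b c) = written_regs c"

fun written_arrs :: "com \<Rightarrow> nat set" where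
  "written_arrs Skip = {}"
| "written_arrs (Assign x a) = {}"
| "written_arrs (Store A i a) = {A}"
| "written_arrs (Seq c1 c2) = written_arrs c1 \<union> written_arrs c2"
| "written_arrs (Cond b c1 c2) = written_arrs c1 \<union> written_arrs c2"
| "written_arrs (While b c) = written_arrs c"

text \<open>The frame condition. It is obtained from the program text alone, so specifications and
  loop invariants mention only cells that change.\<close>

definition same_except :: "nat set \<Rightarrow> nat set \<Rightarrow> state \<Rightarrow> state \<Rightarrow> bool" where
  "same_except R A s s' \<longleftrightarrow>
     (\<forall>x. x \<notin> R \<longrightarrow> reg s' x = reg s x) \<and> (\<forall>a. a \<notin> A \<longrightarrow> arr s' a = arr s a)"

text \<open>Settles the side conditions of plain reads once and for all; only constants, sums and
  products then require an argument about the word bound.\<close>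

definition bounded_state :: "nat \<Rightarrow> state \<Rightarrow> bool" where
  "bounded_state B s \<longleftrightarrow> (\<forall>x. reg s x < B) \<and> (\<forall>a i. arr s a i < B)"

lemma reg_set_reg [simp]: "reg (set_reg x v s) y = (if y = x then v else reg s y)"
  and arr_set_reg [simp]: "arr (set_reg x v s) = arr s"
  and reg_set_arr [simp]: "reg (set_arr a i v s) = reg s"
  and arr_set_arr [simp]:
    "arr (set_arr a i v s) b = (if b = a then (arr s a)(i := v) else arr s b)"
  by (auto simp: set_reg_def set_arr_def)

lemma bounded_set_reg: "bounded_state B s \<Longrightarrow> v < B \<Longrightarrow> bounded_state B (set_reg x v s)"
  and bounded_set_arr: "bounded_state B s \<Longrightarrow> v < B \<Longrightarrow> bounded_state B (set_arr a i v s)"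
  by (simp_all add: bounded_state_def)

lemma bounded_reg [simp]: "bounded_state B s \<Longrightarrow> reg s x < B"
  and bounded_arr [simp]: "bounded_state B s \<Longrightarrow> arr s a i < B"
  by (auto simp: bounded_state_def)

lemma same_except_refl [simp]: "same_except R A s s"
  by (simp add: same_except_def)

lemma same_except_trans:
  "same_except R A s s' \<Longrightarrow> same_except R' A' s' s'' \<Longrightarrow> same_except (R \<union> R') (A \<union> A') s s''"
  by (simp add: same_except_def)

lemma same_except_mono:
  "same_except R A s s' \<Longrightarrow> R \<subseteq> R' \<Longrightarrow> A \<subseteq> A' \<Longrightarrow> same_except R' A' s s'"
  by (auto simp: same_except_def)

lemma aval_less: "afits B a s \<Longrightarrow> bounded_state B s \<Longrightarrow> aval a s < B"
  by (induction a) (auto simp: less_imp_diff_less)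

lemma exec_same_except: "exec B c s t s' \<Longrightarrow> same_except (written_regs c) (written_arrs c) s s'"
proof (induction rule: exec.induct)
  case (Seq c1 s t1 s' c2 t2 s'')
  then show ?case using same_except_trans by fastforce
next
  case (CondTrue b s c1 t s' c2)
  then show ?case by (auto elim: same_except_mono)
next
  case (CondFalse b s c2 t s' c1)
  then show ?case by (auto elim: same_except_mono)
next
  case (WhileTrue b s c t1 s' t2 s'')
  then show ?case using same_except_trans by fastforce
qed (simp_all add: same_except_def)

lemma exec_bounded: "exec B c s t s' \<Longrightarrow> bounded_state B s \<Longrightarrow> bounded_state B s'"
proof (induction rule: exec.induct)
  case (Assign a s x)
  then show ?case by (simp only: bounded_set_reg aval_less)
next
  case (Store i s a A)
  then show ?case by (simp only: bounded_set_arr aval_less)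
qed simp_all

definition run :: "nat \<Rightarrow> com \<Rightarrow> state \<Rightarrow> nat \<Rightarrow> (state \<Rightarrow> bool) \<Rightarrow> bool" where
  "run B c s T Q \<longleftrightarrow> (\<exists>t s'. exec B c s t s' \<and> t \<le> T \<and> Q s')"

lemma run_le: "run B c s T Q \<Longrightarrow> T \<le> T' \<Longrightarrow> run B c s T' Q"
  unfolding run_def by (meson le_trans)

lemma run_eqI: "run B c s T (\<lambda>s'. s' = r) \<Longrightarrow> Q r \<Longrightarrow> run B c s T Q"
  by (auto simp: run_def)

text \<open>Strengthens a postcondition by what holds of every execution, namely boundedness and the
  frame.\<close>

lemma run_frame:
  assumes "bounded_state B s" and "run B c s T P"
    and "\<And>s'. bounded_state B s' \<Longrightarrow> same_except (written_regs c) (written_arrs c) s s' \<Longrightarrow> P s' \<Longrightarrow> Q s'"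
  shows "run B c s T Q"
proof -
  obtain t s' where 1: "exec B c s t s'" "t \<le> T" "P s'"
    using assms(2) by (auto simp: run_def)
  have "Q s'"
    using assms(3)[OF exec_bounded[OF 1(1) assms(1)] exec_same_except[OF 1(1)] 1(3)] .
  with 1 show ?thesis
    unfolding run_def by blast
qed

lemma run_seq:
  assumes "bounded_state B s" and "run B c1 s T1 P"
    and "\<And>s'. bounded_state B s' \<Longrightarrow> same_except (written_regs c1) (written_arrs c1) s s' \<Longrightarrow> P s'
            \<Longrightarrow> run B c2 s' T2 Q"
  shows "run B (Seq c1 c2) s (T1 + T2) Q"
proof -
  obtain t s' where 1: "exec B c1 s t s'" "t \<le> T1" "P s'"
    using assms(2) by (auto simp: run_def)
  then have "run B c2 s' T2 Q"
    using assms(3)[of s'] exec_bounded[OF 1(1) assms(1)] exec_same_except[OF 1(1)] by simp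
  then obtain u s'' where "exec B c2 s' u s''" "u \<le> T2" "Q s''"
    by (auto simp: run_def)
  with 1 show ?thesis
    unfolding run_def using exec.Seq[of B c1 s t s' c2 u s''] by (intro exI conjI) auto
qed

lemma run_cond:
  assumes "bfits B b s" and "bval b s \<Longrightarrow> run B c1 s T Q" and "\<not> bval b s \<Longrightarrow> run B c2 s T Q"
  shows "run B (Cond b c1 c2) s (1 + bcost b + T) Q"
proof (cases "bval b s")
  case True
  then obtain t s' where "exec B c1 s t s'" "t \<le> T" "Q s'"
    using assms(2) by (auto simp: run_def)
  then show ?thesis
    unfolding run_def using exec.CondTrue[OF assms(1) True, of c1 t s'] by (intro exI conjI) auto
next
  case False
  then obtain t s' where "exec B c2 s t s'" "t \<le> T" "Q s'"
    using assms(3) by (auto simp: run_def)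
  then show ?thesis
    unfolding run_def using exec.CondFalse[OF assms(1) False, of c2 t s'] by (intro exI conjI) auto
qed

text \<open>The potential \<open>\<Phi>\<close> pays for the loop, so it yields termination and the time bound at once.\<close>

lemma run_while:
  assumes "bounded_state B s" and "I s"
    and fits: "\<And>s'. bounded_state B s' \<Longrightarrow> same_except (written_regs c) (written_arrs c) s s' \<Longrightarrow> I s'
            \<Longrightarrow> bfits B b s'"
    and step: "\<And>s'. bounded_state B s' \<Longrightarrow> same_except (written_regs c) (written_arrs c) s s' \<Longrightarrow> I s'
            \<Longrightarrow> bval b s'
            \<Longrightarrow> \<exists>T. run B c s' T (\<lambda>s''. I s'' \<and> T + bcost b + 1 + \<Phi> s'' \<le> \<Phi> s')"
    and final: "\<And>s'. bounded_state B s' \<Longrightarrow> same_except (written_regs c) (written_arrs c) s s' \<Longrightarrow> I s'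
            \<Longrightarrow> \<not> bval b s' \<Longrightarrow> Q s'"
  shows "run B (While b c) s (\<Phi> s + bcost b + 1) Q"
proof -
  have "run B (While b c) r (\<Phi> r + bcost b + 1) Q"
    if "bounded_state B r" "same_except (written_regs c) (written_arrs c) s r" "I r" for r
    using that
  proof (induction "\<Phi> r" arbitrary: r rule: less_induct)
    case less
    show ?case
    proof (cases "bval b r")
      case True
      obtain T where "run B c r T (\<lambda>s''. I s'' \<and> T + bcost b + 1 + \<Phi> s'' \<le> \<Phi> r)"
        using step[OF less.prems True] by blast
      then obtain t r' where r': "exec B c r t r'" "t \<le> T" "I r'" "T + bcost b + 1 + \<Phi> r' \<le> \<Phi> r"
        by (auto simp: run_def)
      have "same_except (written_regs c) (written_arrs c) s r'"
        using same_except_trans[OF less.prems(2) exec_same_except[OF r'(1)]] by simp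
      then have "run B (While b c) r' (\<Phi> r' + bcost b + 1) Q"
        using less.hyps[of r'] r' less.prems exec_bounded by auto
      then obtain u r'' where r'': "exec B (While b c) r' u r''" "u \<le> \<Phi> r' + bcost b + 1" "Q r''"
        by (auto simp: run_def)
      have "exec B (While b c) r (1 + bcost b + t + u) r''"
        using exec.WhileTrue[OF fits[OF less.prems] True r'(1) r''(1)] .
      moreover have "1 + bcost b + t + u \<le> \<Phi> r + bcost b + 1"
        using r' r'' by simp
      ultimately show ?thesis
        using r''(3) unfolding run_def by blast
    next
      case False
      then have "exec B (While b c) r (1 + bcost b) r"
        using exec.WhileFalse fits less.prems by blast
      then show ?thesis
        using final less.prems False unfolding run_def by (intro exI[of _ "1 + bcost b"]) auto
    qed
  qed
  with assms show ?thesis by simp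
qed

section \<open>Loop-free code and counting loops\<close>

fun wp :: "nat \<Rightarrow> com \<Rightarrow> state \<Rightarrow> (state \<Rightarrow> bool) \<Rightarrow> bool" where
  "wp B Skip s Q = Q s"
| "wp B (Assign x a) s Q = (afits B a s \<and> Q (set_reg x (aval a s) s))"
| "wp B (Store A i a) s Q = (afits B i s \<and> afits B a s \<and> Q (set_arr A (aval i s) (aval a s) s))"
| "wp B (Seq c1 c2) s Q = wp B c1 s (\<lambda>s'. wp B c2 s' Q)"
| "wp B (Cond b c1 c2) s Q =
     (bfits B b s \<and> (bval b s \<longrightarrow> wp B c1 s Q) \<and> (\<not> bval b s \<longrightarrow> wp B c2 s Q))"
| "wp B (While b c) s Q = False"

text \<open>The value 0 for loops is a dummy: \<open>wp\<close> is \<open>False\<close> on a loop,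
  so \<open>wp_run\<close> never appeals to it.\<close>

fun straight_cost :: "com \<Rightarrow> nat" where
  "straight_cost Skip = 1"
| "straight_cost (Assign x a) = 1 + acost a"
| "straight_cost (Store A i a) = 1 + acost i + acost a"
| "straight_cost (Seq c1 c2) = straight_cost c1 + straight_cost c2"
| "straight_cost (Cond b c1 c2) = 1 + bcost b + max (straight_cost c1) (straight_cost c2)"
| "straight_cost (While b c) = 0"

lemma wp_run: "wp B c s Q \<Longrightarrow> run B c s (straight_cost c) Q"
proof (induction c arbitrary: s Q)
  case (Assign x a)
  then have "exec B (Assign x a) s (1 + acost a) (set_reg x (aval a s) s)"
    by (intro exec.Assign) auto
  then show ?case
    unfolding run_def using Assign by (intro exI conjI) auto
next
  case (Store A i a)
  then have "exec B (Store A i a) s (1 + acost i + acost a) (set_arr A (aval i s) (aval a s) s)"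
    by (intro exec.Store) auto
  then show ?case
    unfolding run_def using Store by (intro exI conjI) auto
next
  case (Seq c1 c2)
  have "wp B c1 s (\<lambda>s'. wp B c2 s' Q)"
    using Seq.prems by simp
  then obtain t s' where 1: "exec B c1 s t s'" "t \<le> straight_cost c1" "wp B c2 s' Q"
    using Seq.IH(1)[of s "\<lambda>s'. wp B c2 s' Q"] unfolding run_def by auto
  then obtain u s'' where 2: "exec B c2 s' u s''" "u \<le> straight_cost c2" "Q s''"
    using Seq.IH(2)[of s' Q] unfolding run_def by auto
  have "exec B (Seq c1 c2) s (t + u) s''"
    using 1 2 exec.Seq by blast
  then show ?case
    unfolding run_def using 1 2 by (intro exI[of _ "t + u"]) auto
next
  case (Cond b c1 c2)
  have "run B (Cond b c1 c2) s (1 + bcost b + max (straight_cost c1) (straight_cost c2)) Q"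
    using Cond.prems by (intro run_cond) (auto intro: run_le[OF Cond.IH(1)] run_le[OF Cond.IH(2)])
  then show ?case by simp
next
  case Skip
  then show ?case unfolding run_def using exec.Skip[of B s] by (intro exI conjI) auto
qed simp

lemma run_straight: "straight_cost c \<le> T \<Longrightarrow> wp B c s Q \<Longrightarrow> run B c s T Q"
  using wp_run run_le by blast

definition For :: "nat \<Rightarrow> nat \<Rightarrow> com \<Rightarrow> com" where
  "For x N c = Seq (Assign x (Const 0))
     (While (Less (Reg x) (Reg N)) (Seq c (Assign x (Add (Reg x) (Const 1)))))"

lemma written_For [simp]:
  "written_regs (For x N c) = insert x (written_regs c)"
  "written_arrs (For x N c) = written_arrs c"
  by (auto simp: For_def)

text \<open>Unlike \<open>run_while\<close>, every pass is charged the same budget \<open>T\<close>.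
  The 8 consists of test and increment (4 each), the 6 of the initialisation (2) and the last,
  failing test (4). The step is stated for \<open>set_reg x (Suc i)\<close> because the counter
  advances only after the body.\<close>

lemma run_For:
  assumes bd: "bounded_state B s" and x: "x \<notin> written_regs c" and N: "N \<notin> written_regs c" "N \<noteq> x"
    and B: "1 < B"
    and init: "I 0 (set_reg x 0 s)"
    and step: "\<And>i s'. i < reg s N \<Longrightarrow> reg s' x = i \<Longrightarrow> bounded_state B s'
        \<Longrightarrow> same_except (insert x (written_regs c)) (written_arrs c) s s' \<Longrightarrow> I i s'
        \<Longrightarrow> run B c s' T (\<lambda>s''. I (Suc i) (set_reg x (Suc i) s''))"
    and final: "\<And>s'. bounded_state B s'
        \<Longrightarrow> same_except (insert x (written_regs c)) (written_arrs c) s s' \<Longrightarrow> I (reg s N) s' \<Longrightarrow> Q s'"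
  shows "run B (For x N c) s (reg s N * (T + 8) + 6) Q"
proof -
  let ?W = "While (Less (Reg x) (Reg N)) (Seq c (Assign x (Add (Reg x) (Const 1))))"
  let ?s = "set_reg x 0 s"
  define J where "J s' \<longleftrightarrow> reg s' x \<le> reg s N \<and> reg s' N = reg s N \<and> I (reg s' x) s'" for s'
  have first: "run B (Assign x (Const 0)) s 2 (\<lambda>s'. s' = ?s)"
    using B by (intro run_straight) auto
  have loop: "run B ?W ?s (reg s N * (T + 8) + 4) Q" if bd': "bounded_state B ?s"
  proof -
    have "run B ?W ?s ((reg s N - reg ?s x) * (T + 8) + bcost (Less (Reg x) (Reg N)) + 1) Q"
    proof (rule run_while[where I = J and \<Phi> = "\<lambda>s'. (reg s N - reg s' x) * (T + 8)"])
      show "bounded_state B ?s" by fact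
      show "J ?s" using init N by (simp add: J_def)
      fix s' assume s': "bounded_state B s'" "J s'"
        "same_except (written_regs (Seq c (Assign x (Add (Reg x) (Const 1)))))
           (written_arrs (Seq c (Assign x (Add (Reg x) (Const 1))))) ?s s'"
      have sm: "same_except (insert x (written_regs c)) (written_arrs c) s s'"
        using s'(3) by (auto simp: same_except_def)
      show "bfits B (Less (Reg x) (Reg N)) s'"
        using s' by simp
      show "Q s'" if "\<not> bval (Less (Reg x) (Reg N)) s'"
        using that s'(1,2) sm final by (auto simp: J_def)
      assume b: "bval (Less (Reg x) (Reg N)) s'"
      define i where "i = reg s' x"
      have i: "i < reg s N" using b s'(2) by (auto simp: J_def i_def)
      have "run B c s' T (\<lambda>s''. I (Suc i) (set_reg x (Suc i) s''))"
        using step i s' sm by (auto simp: J_def i_def)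
      then have "run B (Seq c (Assign x (Add (Reg x) (Const 1)))) s' (T + 4)
         (\<lambda>s''. J s'' \<and> T + 4 + bcost (Less (Reg x) (Reg N)) + 1 + (reg s N - reg s'' x) * (T + 8)
            \<le> (reg s N - reg s' x) * (T + 8))"
      proof (rule run_seq[OF s'(1)])
        fix r assume r: "bounded_state B r" "same_except (written_regs c) (written_arrs c) s' r"
          "I (Suc i) (set_reg x (Suc i) r)"
        have rx: "reg r x = i" "reg r N = reg s N"
          using r(2) x N s'(2) by (auto simp: same_except_def i_def J_def)
        have "reg r N < B" using r(1) by simp
        then have "Suc i < B" using i rx by simp
        moreover obtain q where "reg s N - i = Suc q" "reg s N - Suc i = q"
          using i by (metis Suc_diff_Suc)
        ultimately show "run B (Assign x (Add (Reg x) (Const 1))) r 4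
         (\<lambda>s''. J s'' \<and> T + 4 + bcost (Less (Reg x) (Reg N)) + 1 + (reg s N - reg s'' x) * (T + 8)
            \<le> (reg s N - reg s' x) * (T + 8))"
          using r rx i N B by (intro run_straight) (auto simp: J_def i_def[symmetric])
      qed
      then show "\<exists>T'. run B (Seq c (Assign x (Add (Reg x) (Const 1)))) s' T'
         (\<lambda>s''. J s'' \<and> T' + bcost (Less (Reg x) (Reg N)) + 1 + (reg s N - reg s'' x) * (T + 8)
            \<le> (reg s N - reg s' x) * (T + 8))" by blast
    qed
    then show ?thesis by (rule run_le) simp
  qed
  have "run B (Seq (Assign x (Const 0)) ?W) s (2 + (reg s N * (T + 8) + 4)) Q"
    by (rule run_seq[OF bd first]) (use loop in auto)
  then show ?thesis
    unfolding For_def by (rule run_le) simp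
qed

section \<open>Matchings, Hall violators and token walks\<close>

text \<open>\<open>f v - 1\<close> is the distance from \<open>a\<close> to \<open>v\<close>; \<open>f v = 0\<close> means that \<open>v\<close> is not reachable.\<close>

definition levels :: "nat \<Rightarrow> (nat \<Rightarrow> nat \<Rightarrow> bool) \<Rightarrow> nat \<Rightarrow> (nat \<Rightarrow> nat) \<Rightarrow> bool" where
  "levels n w a f \<longleftrightarrow> f a = 1 \<and> (\<forall>v<n. f v \<le> n) \<and> (\<forall>v<n. f v = 1 \<longrightarrow> v = a) \<and>
     (\<forall>u<n. \<forall>v<n. w u v \<longrightarrow> f u \<noteq> 0 \<longrightarrow> f v \<noteq> 0 \<and> f v \<le> Suc (f u)) \<and>
     (\<forall>v<n. \<forall>L. f v = Suc (Suc L) \<longrightarrow> (\<exists>u<n. w u v \<and> f u = Suc L))"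

lemma levels_source: "levels n w a f \<Longrightarrow> f a = 1"
  by (simp add: levels_def)

lemma levels_le: "levels n w a f \<Longrightarrow> v < n \<Longrightarrow> f v \<le> n"
  by (simp add: levels_def)

lemma levels_edge:
  "levels n w a f \<Longrightarrow> w u v \<Longrightarrow> u < n \<Longrightarrow> v < n \<Longrightarrow> f u \<noteq> 0 \<Longrightarrow> f v \<noteq> 0 \<and> f v \<le> Suc (f u)"
  by (simp add: levels_def)

text \<open>Ties levels to the diameter: along a walk from \<open>a\<close> labels grow by at most
  one per edge, so \<open>f v - 1\<close> is at most the length of any such walk.\<close>

lemma levels_relpow:
  assumes "levels n w a f" and "(a, v) \<in> {(u, v). u < n \<and> v < n \<and> w u v} ^^ L"
  shows "f v \<noteq> 0 \<and> f v \<le> Suc L"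
  using assms(2)
proof (induction L arbitrary: v)
  case 0
  then show ?case using assms(1) by (simp add: levels_def)
next
  case (Suc L)
  then obtain u where u: "(a, u) \<in> {(u, v). u < n \<and> v < n \<and> w u v} ^^ L" "u < n" "v < n" "w u v"
    by auto
  then have "f v \<noteq> 0 \<and> f v \<le> Suc (f u)"
    using Suc.IH[OF u(1)] assms(1) unfolding levels_def by blast
  then show ?case using Suc.IH[OF u(1)] by linarith
qed

lemma levels_pred:
  assumes "levels n w a f" "v < n" "f v \<noteq> 0" "v \<noteq> a"
  obtains u where "u < n" "w u v" "Suc (f u) = f v" "f u \<noteq> 0"
proof -
  have "f v \<noteq> 1" using assms unfolding levels_def by blast
  then obtain L where "f v = Suc (Suc L)"
    using assms(3) by (metis One_nat_def not0_implies_Suc)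
  then obtain u where "u < n" "w u v" "f u = Suc L"
    using assms unfolding levels_def by blast
  with \<open>f v = Suc (Suc L)\<close> show thesis using that by simp
qed

text \<open>Pigeonhole: descending through predecessors shows that every label from 1 up to
  \<open>f v\<close> is taken by some vertex, and \<open>n\<close> vertices carry at most
  \<open>n\<close> labels.\<close>

lemma level_le_of_pred:
  assumes pred: "\<And>v L. v < n \<Longrightarrow> f v = Suc (Suc L) \<Longrightarrow> \<exists>u<n. f u = Suc L" and "v < n"
  shows "f v \<le> (n::nat)"
proof -
  have down: "\<exists>u<n. f u = Suc i" if "u < n" "f u = Suc j" "i \<le> j" for u j i
    using that
  proof (induction j arbitrary: u)
    case (Suc j)
    then show ?case using pred[of u j] by (cases "i = Suc j") auto
  qed auto
  show ?thesis
  proof (cases "f v")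
    case (Suc j)
    have "Suc ` {..j} \<subseteq> f ` {..<n}"
      using down[OF \<open>v < n\<close> Suc] by (auto simp: image_iff) (metis lessThan_iff)
    then have "card (Suc ` {..j}) \<le> card (f ` {..<n})"
      by (simp add: card_mono)
    also have "\<dots> \<le> n"
      using card_image_le[of "{..<n}" f] by simp
    finally show ?thesis
      using Suc by (simp add: card_image)
  qed simp
qed

section \<open>Matchings and simultaneous moves on an indexed incidence matrix\<close>

locale incidence =
  fixes n m :: nat and inc :: "nat \<Rightarrow> nat \<Rightarrow> bool"
begin

definition adj :: "nat \<Rightarrow> nat \<Rightarrow> bool" where
  "adj u v \<longleftrightarrow> u < n \<and> v < n \<and> (\<exists>e<m. inc e u \<and> inc e v)"

definition covers :: "nat set \<Rightarrow> bool" where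
  "covers C \<longleftrightarrow> C \<subseteq> {..<n} \<and> (\<forall>e<m. \<exists>i\<in>C. inc e i)"

definition move :: "nat set \<Rightarrow> nat set \<Rightarrow> bool" where
  "move D D' \<longleftrightarrow> (\<exists>f. bij_betw f D D' \<and> (\<forall>v\<in>D. f v = v \<or> adj v (f v)))"

text \<open>\<open>mate u = Suc v\<close> encodes that \<open>u\<close> and \<open>v\<close> are matched, \<open>mate u = 0\<close> that \<open>u\<close> is free.\<close>

definition matching :: "(nat \<Rightarrow> nat) \<Rightarrow> nat set \<Rightarrow> nat set \<Rightarrow> bool" where
  "matching mate S T \<longleftrightarrow> (\<forall>u<n. \<forall>v. mate u = Suc v \<longrightarrow> v < n \<and> mate v = Suc u \<and> adj u v \<and>
     (u \<in> S - T \<and> v \<in> T - S \<or> u \<in> T - S \<and> v \<in> S - T))"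

text \<open>Arcs of the search digraph: any shared hyperedge from \<open>S - T\<close> to
  \<open>T - S\<close>, but only matching edges back. Hence a vertex of \<open>S - T\<close> other
  than the start can be entered only from its mate.\<close>

definition alternating :: "(nat \<Rightarrow> nat) \<Rightarrow> nat set \<Rightarrow> nat set \<Rightarrow> nat \<Rightarrow> nat \<Rightarrow> bool" where
  "alternating mate S T u v \<longleftrightarrow>
     u \<in> S - T \<and> v \<in> T - S \<and> adj u v \<or> u \<notin> S \<and> mate u = Suc v"

lemma adj_sym: "adj u v \<Longrightarrow> adj v u"
  by (auto simp: adj_def)

lemma covers_mono: "covers C \<Longrightarrow> C \<subseteq> D \<Longrightarrow> D \<subseteq> {..<n} \<Longrightarrow> covers D"
  unfolding covers_def by blast

lemma move_card: "move D D' \<Longrightarrow> card D = card D'"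
  by (auto simp: move_def bij_betw_same_card)

lemma covers_finite: "covers C \<Longrightarrow> finite C"
  unfolding covers_def using finite_subset by blast

lemma covers_subset: "covers C \<Longrightarrow> C \<subseteq> {..<n}"
  by (simp add: covers_def)

lemma matchingD:
  assumes "matching mate S T" "u < n" "mate u = Suc v"
  shows "v < n" "mate v = Suc u" "adj u v" "u \<in> S - T \<and> v \<in> T - S \<or> u \<in> T - S \<and> v \<in> S - T"
  using assms unfolding matching_def by blast+

lemma alternatingD:
  assumes "alternating mate S T u v" "matching mate S T" "u < n"
  shows "adj u v" "u \<in> S - T \<Longrightarrow> v \<in> T - S" "v \<in> S - T \<Longrightarrow> mate v = Suc u" "v \<in> T - S \<Longrightarrow> u \<in> S - T"
    "u \<in> T - S \<Longrightarrow> v \<in> S - T"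
  using assms matchingD[of mate S T u v] unfolding alternating_def by blast+

text \<open>If all of \<open>T - S\<close> were matched, taking mates would inject it into
  \<open>S - T\<close> without \<open>a\<close>, although both differences have the same
  size.\<close>

lemma exists_unmatched:
  assumes "covers S" "covers T" "card S = card T" "matching mate S T" "a \<in> S - T" "mate a = 0"
  shows "\<exists>b<n. b \<in> T - S \<and> mate b = 0"
proof (rule ccontr)
  assume none: "\<not> ?thesis"
  note sub = covers_subset[OF assms(1)] covers_subset[OF assms(2)]
    and fin = covers_finite[OF assms(1)] covers_finite[OF assms(2)]
  have nz: "mate b \<noteq> 0" if b: "b \<in> T - S" for b
  proof -
    have "b < n" using b sub(2) by auto
    then show ?thesis using b none by auto
  qed
  have eq: "card (S - T) = card (T - S)"
    using card_Int_Diff[OF fin(1), of T] card_Int_Diff[OF fin(2), of S] assms(3)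
    unfolding Int_commute[of T S] by linarith
  define g where "g b = mate b - 1" for b
  have g: "mate b = Suc (g b)" if "b \<in> T - S" for b
    using nz[OF that] by (simp add: g_def)
  have gm: "g b \<in> S - T" "mate (g b) = Suc b" if b: "b \<in> T - S" for b
  proof -
    have "b < n" using b sub by auto
    note M = matchingD[OF assms(4) this g[OF b]]
    show "g b \<in> S - T" "mate (g b) = Suc b" using M(2,4) b by auto
  qed
  have "inj_on g (T - S)"
  proof (rule inj_onI)
    fix x y assume xy: "x \<in> T - S" "y \<in> T - S" "g x = g y"
    have "Suc x = mate (g y)" using gm(2)[OF xy(1)] unfolding xy(3) ..
    then show "x = y" unfolding gm(2)[OF xy(2)] by (rule Suc_inject)
  qed
  moreover have "g ` (T - S) \<subseteq> (S - T) - {a}"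
  proof
    fix v assume "v \<in> g ` (T - S)"
    then obtain b where b: "b \<in> T - S" "v = g b" by blast
    then show "v \<in> (S - T) - {a}" using gm[OF b(1)] assms(6) by auto
  qed
  ultimately have "card (T - S) \<le> card ((S - T) - {a})"
    using fin by (intro card_inj_on_le) auto
  moreover have "card ((S - T) - {a}) < card (S - T)"
    using assms(5) fin by (intro card_Diff1_less) auto
  ultimately show False using eq by simp
qed

text \<open>The map follows the matching on \<open>S - T\<close> and fixes the common part.
  Injectivity and equal cardinalities give surjectivity, so it is enough to know that the side
  \<open>S - T\<close> is matched.\<close>

lemma move_of_matching:
  assumes "covers S" "covers T" "card S = card T" "matching mate S T" "\<forall>v\<in>S - T. mate v \<noteq> 0"
  shows "move S T"
proof -
  define f where "f v = (if v \<in> S - T then mate v - 1 else v)" for v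
  note sub = covers_subset[OF assms(1)] and fin = covers_finite[OF assms(2)]
  have g: "mate v = Suc (f v)" if "v \<in> S - T" for v
    using assms(5) that by (simp add: f_def)
  have gm: "f v \<in> T - S" "mate (f v) = Suc v" "adj v (f v)" if v: "v \<in> S - T" for v
  proof -
    have "v < n" using v sub by auto
    note M = matchingD[OF assms(4) this g[OF v]]
    show "f v \<in> T - S" "mate (f v) = Suc v" "adj v (f v)" using M(2,3,4) v by auto
  qed
  have id: "f v = v" if "v \<notin> S - T" for v
    using that by (auto simp: f_def)
  have "inj_on f S"
  proof (rule inj_onI)
    fix x y assume xy: "x \<in> S" "y \<in> S" "f x = f y"
    show "x = y"
    proof (cases "x \<in> S - T"; cases "y \<in> S - T")
      assume "x \<in> S - T" "y \<in> S - T"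
      then have "Suc x = mate (f y)" and "mate (f y) = Suc y"
        using gm(2)[of x] gm(2)[of y] unfolding xy(3) by auto
      then show ?thesis by simp
    next
      assume "x \<in> S - T" "y \<notin> S - T"
      then have "f x \<in> T - S" "f x = y"
        using gm(1)[of x] id[of y] unfolding xy(3)[symmetric] by auto
      then show ?thesis using xy(2) by simp
    next
      assume "x \<notin> S - T" "y \<in> S - T"
      then have "f y \<in> T - S" "f y = x"
        using gm(1)[of y] id[of x] unfolding xy(3) by auto
      then show ?thesis using xy(1) by simp
    next
      assume "x \<notin> S - T" "y \<notin> S - T"
      then show ?thesis using id[of x] id[of y] xy(3) by metis
    qed
  qed
  moreover have "f ` S \<subseteq> T"
  proof
    fix w assume "w \<in> f ` S"
    then obtain v where "v \<in> S" "w = f v" by blast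
    then show "w \<in> T" using gm(1)[of v] id[of v] by (cases "v \<in> T") auto
  qed
  moreover have "card (f ` S) = card T"
    using \<open>inj_on f S\<close> assms(3) by (simp add: card_image)
  ultimately have "bij_betw f S T"
    unfolding bij_betw_def using fin card_subset_eq by blast
  moreover have "\<forall>v\<in>S. f v = v \<or> adj v (f v)"
    using gm id by blast
  ultimately show ?thesis
    unfolding move_def by blast
qed

text \<open>The vertices reached from an unmatched \<open>a\<close> form a Hall violator: the matching pairs them up
  except for \<open>a\<close>, and every neighbour in \<open>T - S\<close> of a reached vertex of \<open>S - T\<close> is reached as well.
  Hence moving the reached tokens along the matching makes the token on \<open>a\<close> redundant.\<close>

lemma release_token:
  assumes S: "covers S" and T: "covers T" and M: "matching mate S T" and a: "a \<in> S - T" "mate a = 0"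
    and f: "levels n (alternating mate S T) a f"
    and full: "\<forall>b\<in>T - S. f b \<noteq> 0 \<longrightarrow> mate b \<noteq> 0"
    and X: "X = {v. v < n \<and> f v \<noteq> 0 \<and> v \<noteq> a}"
    and S': "S' = (S - X) \<union> (X - S)"
    and mate': "mate' = (\<lambda>v. if v \<in> X then 0 else mate v)"
  shows "move S S'" "covers (S' - {a})" "S' \<subseteq> {..<n}" "a \<in> S'" "matching mate' S' T"
    "S' - T \<subseteq> S - T - X" "mate' a = 0"
proof -
  have sub: "S \<subseteq> {..<n}" "T \<subseteq> {..<n}"
    using S T by (auto dest: covers_subset)
  have an: "a < n" using a sub by auto
  \<comment> \<open>\<open>X\<close> is closed under taking mates. If \<open>v\<close> is entered
    from \<open>S - T\<close>, it lies in \<open>T - S\<close>, is matched by \<open>full\<close>,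
    and its mate is reached by one more arc; otherwise \<open>v\<close> is entered through its
    matching edge and the predecessor is the mate. Neither mate is \<open>a\<close>, which is
    unmatched.\<close>
  have closed: "\<exists>u. mate v = Suc u \<and> u \<in> X" if v: "v \<in> X" for v
  proof -
    have v': "v < n" "f v \<noteq> 0" "v \<noteq> a" using v X by auto
    then obtain u where u: "u < n" "alternating mate S T u v" "f u \<noteq> 0"
      using levels_pred[OF f] by blast
    show ?thesis
    proof (cases "u \<in> S - T")
      case True
      then have vB: "v \<in> T - S" using alternatingD(2)[OF u(2) M u(1)] by blast
      then have "mate v \<noteq> 0" using full v'(2) by blast
      then obtain w where w: "mate v = Suc w"
        using not0_implies_Suc by blast
      then have "alternating mate S T v w" and wn: "w < n"
        using vB matchingD[OF M v'(1) w] by (auto simp: alternating_def)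
      then have "f w \<noteq> 0" using levels_edge[OF f _ v'(1) _ v'(2)] by simp
      moreover have "w \<noteq> a" using matchingD(2)[OF M v'(1) w] a by auto
      ultimately show ?thesis using w wn X by blast
    next
      case False
      then have "u \<notin> S" "mate u = Suc v" using u(2) by (auto simp: alternating_def)
      then show ?thesis using matchingD(2)[OF M u(1)] u a X by blast
    qed
  qed
  have XAB: "v \<in> S - T \<or> v \<in> T - S" if "v \<in> X" for v
  proof -
    obtain u where "mate v = Suc u" using closed[OF \<open>v \<in> X\<close>] by blast
    then show ?thesis using matchingD(4)[OF M, of v u] \<open>v \<in> X\<close> X by auto
  qed
  have aX: "a \<notin> X" using X by simp
  \<comment> \<open>The involution that swaps partners inside \<open>X\<close>. Each pair has
    exactly one end in \<open>S\<close>, so \<open>g\<close> maps \<open>S\<close> onto its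
    symmetric difference with \<open>X\<close>, which is \<open>S'\<close>, and is its own
    inverse.\<close>
  define g where "g v = (if v \<in> X then mate v - 1 else v)" for v
  have gX: "mate v = Suc (g v)" "g v \<in> X" if "v \<in> X" for v
    using closed[OF that] that by (auto simp: g_def)
  have Xn: "v < n" if "v \<in> X" for v using that X by simp
  have g_inv: "mate (g v) = Suc v" "adj v (g v)" "v \<in> S \<longleftrightarrow> g v \<notin> S" if "v \<in> X" for v
    using matchingD(2-4)[OF M Xn[OF that] gX(1)[OF that]] by auto
  have gg: "g (g v) = v" for v
  proof (cases "v \<in> X")
    case True
    have "g (g v) = mate (g v) - 1"
      unfolding g_def[of "g v"] using gX(2)[OF True] by (rule if_P)
    then show ?thesis unfolding g_inv(1)[OF True] by simp
  qed (simp add: g_def)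
  have "bij_betw g S S'"
  proof (rule bij_betw_byWitness[where f' = g])
    have *: "g v = v" if "v \<notin> X" for v using that by (simp add: g_def)
    have "g v \<in> S' \<longleftrightarrow> v \<in> S" for v
      using gX(2)[of v] g_inv(3)[of v] *[of v] unfolding S' by (cases "v \<in> X") auto
    moreover have "g v \<in> S \<longleftrightarrow> v \<in> S'" for v
      using gX(2)[of v] g_inv(3)[of v] *[of v] unfolding S' by (cases "v \<in> X") auto
    ultimately show "g ` S \<subseteq> S'" "g ` S' \<subseteq> S" by auto
  qed (simp_all add: gg)
  then show "move S S'"
    unfolding move_def using g_inv(2) by (intro exI[of _ g]) (meson g_def)
  show "S' \<subseteq> {..<n}" using sub Xn unfolding S' by auto
  show "a \<in> S'" using a aX S' by simp
  show "covers (S' - {a})"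
    unfolding covers_def
  proof (intro conjI allI impI)
    show "S' - {a} \<subseteq> {..<n}" using sub Xn unfolding S' by auto
    fix e assume e: "e < m"
    obtain i where i: "i \<in> S" "inc e i" using S e unfolding covers_def by blast
    obtain j where j: "j \<in> T" "inc e j" using T e unfolding covers_def by blast
    show "\<exists>i\<in>S' - {a}. inc e i"
    \<comment> \<open>Only a hyperedge whose token \<open>i\<close> moves or is \<open>a\<close> is
      at risk. Then \<open>i\<close> is a reached vertex of \<open>S - T\<close>. The vertex
      \<open>j\<close> of \<open>T\<close> in the same hyperedge either carries a token that stays,
      or is adjacent to \<open>i\<close> and therefore reached, hence occupied after the
      move.\<close>
    proof (cases "i \<in> insert a X")
      case True
      then have iA: "i \<in> S - T" using i XAB a by blast
      have fi: "f i \<noteq> 0" using True X levels_source[OF f] by auto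
      have ij: "adj i j" unfolding adj_def using i j e sub by auto
      show ?thesis
      proof (cases "j \<in> S")
        case True
        then have "j \<notin> X" using j XAB by blast
        moreover have "j \<noteq> a" using a j by auto
        ultimately show ?thesis using j True S' by blast
      next
        case False
        then have "alternating mate S T i j" using iA j ij by (simp add: alternating_def)
        moreover have "i < n" "j < n" using i j sub by auto
        ultimately have "f j \<noteq> 0" using levels_edge[OF f _ _ _ fi] by simp
        then have "j \<in> X" using j sub a X by auto
        then show ?thesis using j False S' aX by blast
      qed
    next
      case False
      then show ?thesis using i S' by blast
    qed
  qed
  show "S' - T \<subseteq> S - T - X" using XAB unfolding S' by blast
  show "mate' a = 0" using a mate' by simp
  show "matching mate' S' T"
    unfolding matching_def
  proof (intro allI impI)
    fix u v assume u: "u < n" and uv: "mate' u = Suc v"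
    have uX: "u \<notin> X" and m: "mate u = Suc v" using uv mate' by (auto split: if_splits)
    note M' = matchingD[OF M u m]
    have vX: "v \<notin> X"
    proof
      assume "v \<in> X"
      then have "g v = u" using gX(1)[of v] M'(2) by simp
      then show False using gX(2)[OF \<open>v \<in> X\<close>] uX by simp
    qed
    show "v < n \<and> mate' v = Suc u \<and> adj u v \<and>
     (u \<in> S' - T \<and> v \<in> T - S' \<or> u \<in> T - S' \<and> v \<in> S' - T)"
      using M' uX vX mate' S' by auto
  qed
qed

text \<open>Only \<open>a\<close> and \<open>b\<close> change their membership in the configuration,
  and no matched pair contains either of them.\<close>

lemma matching_after_walk:
  assumes "matching mate S T" "mate a = 0" "mate b = 0"
  shows "matching mate (insert b (S - {a})) T"
  unfolding matching_def
proof (intro allI impI)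
  fix u v assume u: "u < n" and m: "mate u = Suc v"
  note M' = matchingD[OF assms(1) u m]
  have "u \<noteq> a" "u \<noteq> b" "v \<noteq> a" "v \<noteq> b" using assms m M' by auto
  then show "v < n \<and> mate v = Suc u \<and> adj u v \<and>
     (u \<in> insert b (S - {a}) - T \<and> v \<in> T - insert b (S - {a}) \<or>
      u \<in> T - insert b (S - {a}) \<and> v \<in> insert b (S - {a}) - T)"
    using M' by auto
qed

text \<open>One exchange on an alternating path, seen from its free end \<open>x\<close> in
  \<open>T - S\<close>: \<open>y\<close> is given to \<open>x\<close>, and its former partner
  \<open>z\<close>, if any, becomes free and takes over the role of \<open>x\<close>. Thus a
  matching exists after every exchange, not only at the end of the path.\<close>

lemma matching_augment:
  assumes M: "matching mate S T" and x: "x \<in> T - S" "mate x = 0" "x < n"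
    and y: "y \<in> S - T" "adj y x"
    and free: "mate' = (case mate y of 0 \<Rightarrow> mate | Suc z \<Rightarrow> mate(z := 0))(y := Suc x, x := Suc y)"
  shows "matching mate' S T"
  unfolding matching_def
proof (intro allI impI)
  have yn: "y < n" using y by (auto simp: adj_def)
  have xy: "x \<noteq> y" using x y by blast
  fix u v assume u: "u < n" and m: "mate' u = Suc v"
  consider "u = x" | "u = y" | "u \<noteq> x" "u \<noteq> y" by blast
  then show "v < n \<and> mate' v = Suc u \<and> adj u v \<and>
     (u \<in> S - T \<and> v \<in> T - S \<or> u \<in> T - S \<and> v \<in> S - T)"
  proof cases
    case 1
    then have "v = y" using m free by simp
    then show ?thesis using 1 x y yn xy adj_sym free by simp
  next
    case 2
    then have "v = x" using m free xy by simp
    then show ?thesis using 2 x y yn xy free by simp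
  next
    case 3
    then have mu: "mate u = Suc v" and z: "mate y \<noteq> Suc u"
      using m free by (auto split: nat.splits if_splits)
    note M' = matchingD[OF M u mu]
    have "v \<noteq> x" using M'(2) x by auto
    moreover have "v \<noteq> y" using M'(2) z by auto
    moreover have "mate y \<noteq> Suc v"
      using matchingD(2)[OF M yn] M'(2) 3 by auto
    ultimately have "mate' v = mate v" using free by (auto split: nat.splits)
    then show ?thesis using M' by auto
  qed
qed

text \<open>A free token on \<open>f\<close> is passed along a path from \<open>f\<close> to \<open>x\<close> all of whose vertices are occupied:
  every token on the path steps forward, which vacates \<open>f\<close> and lets the token on \<open>x\<close> leave.\<close>

definition pushable :: "nat set \<Rightarrow> nat \<Rightarrow> nat \<Rightarrow> (nat \<Rightarrow> nat) \<Rightarrow> bool" where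
  "pushable S f x r \<longleftrightarrow> f \<in> S \<and> x \<in> S \<and> (\<exists>h. bij_betw h (S - {x}) (S - {f}) \<and>
     (\<forall>v\<in>S - {x}. h v = v \<or> adj v (h v)) \<and> (\<forall>v\<in>S. r v < r x \<longrightarrow> h v = v))"

lemma pushable_refl: "f \<in> S \<Longrightarrow> pushable S f f r"
  unfolding pushable_def by (intro conjI exI[of _ id]) auto

text \<open>Since \<open>y\<close> has a smaller rank than \<open>x\<close>, the map
  \<open>h\<close> has not touched it, so \<open>y\<close> is still its own image. Sending
  \<open>x\<close> to \<open>y\<close> instead leaves \<open>y\<close> as the one token without an
  image. The rank clause of \<open>pushable\<close> exists for this step.\<close>

lemma pushable_step:
  assumes "pushable S f x r" "adj x y" "y \<in> S" "(r y :: nat) < r x"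
  shows "pushable S f y r"
proof -
  obtain h where h: "bij_betw h (S - {x}) (S - {f})" "\<forall>v\<in>S - {x}. h v = v \<or> adj v (h v)"
      "\<forall>v\<in>S. r v < r x \<longrightarrow> h v = v" and fx: "f \<in> S" "x \<in> S"
    using assms(1) unfolding pushable_def by blast
  have hy: "h y = y" and yx: "y \<noteq> x" using h(3) assms by auto
  have "h y \<in> S - {f}"
    using bij_betw_apply[OF h(1), of y] yx assms(3) by simp
  then have ySf: "y \<in> S - {f}" using hy by simp
  have "bij_betw h (S - {x} - {y}) (S - {f} - {y})"
  proof (rule bij_betw_DiffI[OF h(1)])
    show "bij_betw h {y} {y}" using hy by (simp add: bij_betw_def)
    show "{y} \<subseteq> S - {x}" "{y} \<subseteq> S - {f}"
      using ySf yx assms(3) by auto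
  qed
  then have "bij_betw (h(x := y)) (S - {x} - {y}) (S - {f} - {y})"
    by (rule bij_betw_cong[THEN iffD1, rotated]) simp
  then have "bij_betw (h(x := y)) (insert x (S - {x} - {y})) (insert y (S - {f} - {y}))"
    using notIn_Un_bij_betw[of x "S - {x} - {y}" "h(x := y)" "S - {f} - {y}"] by simp
  moreover have "insert x (S - {x} - {y}) = S - {y}" using fx yx by auto
  moreover have "insert y (S - {f} - {y}) = S - {f}" using ySf by auto
  ultimately have "bij_betw (h(x := y)) (S - {y}) (S - {f})" by simp
  moreover have "\<forall>v\<in>S - {y}. (h(x := y)) v = v \<or> adj v ((h(x := y)) v)"
    using h(2) assms(2) by auto
  moreover have "\<forall>v\<in>S. r v < r y \<longrightarrow> (h(x := y)) v = v"
    using h(3) assms(4) by auto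
  ultimately show ?thesis
    unfolding pushable_def using fx assms(3) by blast
qed

text \<open>A vacant \<open>y\<close> supplies the missing image of \<open>x\<close> and completes
  the chain to a bijection on all of \<open>S\<close>.\<close>

lemma move_of_pushable:
  assumes "pushable S f x r" "adj x y" "y \<notin> S"
  shows "move S (insert y (S - {f}))"
proof -
  obtain h where h: "bij_betw h (S - {x}) (S - {f})" "\<forall>v\<in>S - {x}. h v = v \<or> adj v (h v)"
      and fx: "f \<in> S" "x \<in> S"
    using assms(1) unfolding pushable_def by blast
  have "bij_betw (h(x := y)) (S - {x}) (S - {f})"
    using h(1) by (rule bij_betw_cong[THEN iffD1, rotated]) simp
  then have "bij_betw (h(x := y)) (insert x (S - {x})) (insert y (S - {f}))"
    using assms(3) notIn_Un_bij_betw[of x "S - {x}" "h(x := y)" "S - {f}"] by simp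
  then have "bij_betw (h(x := y)) S (insert y (S - {f}))"
    using fx by (simp add: insert_absorb)
  moreover have "\<forall>v\<in>S. (h(x := y)) v = v \<or> adj v ((h(x := y)) v)"
    using h(2) assms(2) by auto
  ultimately show ?thesis unfolding move_def by blast
qed

end

section \<open>Search procedures\<close>

text \<open>
  Registers 4 and 5 hold the endpoints of the edge under inspection, 6 the current level, 7 and 8 the
  candidate and the result of a search (\<open>n\<close> if there is none), 9 the vertex \<open>a\<close> being treated, 10 the
  current vertex of a path, 11 the position of the free token, 14 the source of a search. Array 1 is
  reused for the current configuration; array 4 is the adjacency matrix, array 5 the matching, array 6
  the levels.
\<close>

definition Write_Row :: com where
  "Write_Row = For 12 0 (Store 3 (Add (Mul (Reg 3) (Reg 0)) (Reg 12)) (Arr 1 (Reg 12)))"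

definition Emit :: com where
  "Emit = Seq (Assign 3 (Add (Reg 3) (Const 1))) Write_Row"

definition Find :: "bexp \<Rightarrow> com" where
  "Find b = Seq (Assign 8 (Reg 0)) (For 7 0 (Cond b (Assign 8 (Reg 7)) Skip))"

text \<open>With level L in register 6 the vertex being expanded carries label L + 1, so newly
  reached vertices receive L + 2.\<close>

definition Relax :: "bexp \<Rightarrow> com" where
  "Relax b = For 5 0 (Cond (Conj b (Equal (Arr 6 (Reg 5)) (Const 0)))
     (Store 6 (Reg 5) (Add (Reg 6) (Const 2))) Skip)"

text \<open>Level by level without a queue. The counters for level and vertex run in a single
  \<open>While\<close> rather than in nested \<open>For\<close> loops: all but \<open>n\<close>
  passes are cheap, and only a potential can exploit this, whereas \<open>run_For\<close> would
  charge every pass for a call of \<open>Relax\<close>.\<close>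

definition Bfs :: "bexp \<Rightarrow> com" where
  "Bfs b = Seq (For 5 0 (Store 6 (Reg 5) (Const 0)))
     (Seq (Seq (Store 6 (Reg 14) (Const 1)) (Seq (Assign 6 (Const 0)) (Assign 4 (Const 0))))
       (While (Less (Reg 6) (Reg 0))
         (Cond (Less (Reg 4) (Reg 0))
           (Seq (Cond (Equal (Arr 6 (Reg 4)) (Add (Reg 6) (Const 1))) (Relax b) Skip)
             (Assign 4 (Add (Reg 4) (Const 1))))
           (Seq (Assign 4 (Const 0)) (Assign 6 (Add (Reg 6) (Const 1)))))))"

lemma written_Write_Row [simp]: "written_regs Write_Row = {12}" "written_arrs Write_Row = {3}"
  by (auto simp: Write_Row_def)

lemma written_Emit [simp]: "written_regs Emit = {3, 12}" "written_arrs Emit = {3}"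
  by (auto simp: Emit_def)

lemma written_Find [simp]: "written_regs (Find b) = {7, 8}" "written_arrs (Find b) = {}"
  by (auto simp: Find_def)

lemma written_Relax [simp]: "written_regs (Relax b) = {5}" "written_arrs (Relax b) = {6}"
  by (auto simp: Relax_def)

lemma written_Bfs [simp]: "written_regs (Bfs b) = {4, 5, 6}" "written_arrs (Bfs b) = {6}"
  by (auto simp: Bfs_def)

section \<open>Invariant and progress measure of breadth-first search\<close>

definition bfs_inv :: "nat \<Rightarrow> (nat \<Rightarrow> nat \<Rightarrow> bool) \<Rightarrow> nat \<Rightarrow> nat \<Rightarrow> nat \<Rightarrow> (nat \<Rightarrow> nat) \<Rightarrow> bool" where
  "bfs_inv n w a L i f \<longleftrightarrow> f a = 1 \<and> (\<forall>v<n. f v = 1 \<longrightarrow> v = a) \<and> (\<forall>v<n. f v \<le> L + 2) \<and>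
     (\<forall>u<n. \<forall>v<n. w u v \<longrightarrow> f u \<noteq> 0 \<longrightarrow> f u \<le> L \<or> f u = Suc L \<and> u < i
        \<longrightarrow> f v \<noteq> 0 \<and> f v \<le> Suc (f u)) \<and>
     (\<forall>v<n. \<forall>l. f v = Suc (Suc l) \<longrightarrow> (\<exists>u<n. w u v \<and> f u = Suc l))"

text \<open>The vertices that may still be expanded; their number pays for the expensive passes.
  Unreached vertices are included, so labelling a vertex does not enlarge the set, and expanding one
  removes it.\<close>

definition bfs_todo :: "nat \<Rightarrow> nat \<Rightarrow> nat \<Rightarrow> (nat \<Rightarrow> nat) \<Rightarrow> nat set" where
  "bfs_todo n L i f = {v. v < n \<and> (f v = 0 \<or> Suc L < f v \<or> f v = Suc L \<and> i \<le> v)}"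

lemma bfs_invI:
  assumes "f a = 1" "\<And>v. v < n \<Longrightarrow> f v = 1 \<Longrightarrow> v = a" "\<And>v. v < n \<Longrightarrow> f v \<le> L + 2"
    and "\<And>u v. u < n \<Longrightarrow> v < n \<Longrightarrow> w u v \<Longrightarrow> f u \<noteq> 0 \<Longrightarrow> f u \<le> L \<or> f u = Suc L \<and> u < i
          \<Longrightarrow> f v \<noteq> 0 \<and> f v \<le> Suc (f u)"
    and "\<And>v l. v < n \<Longrightarrow> f v = Suc (Suc l) \<Longrightarrow> \<exists>u<n. w u v \<and> f u = Suc l"
  shows "bfs_inv n w a L i f"
proof -
  have "\<forall>u<n. \<forall>v<n. w u v \<longrightarrow> f u \<noteq> 0 \<longrightarrow> f u \<le> L \<or> f u = Suc L \<and> u < i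
      \<longrightarrow> f v \<noteq> 0 \<and> f v \<le> Suc (f u)"
    by (intro allI impI assms(4))
  with assms show ?thesis unfolding bfs_inv_def by simp
qed

lemma bfs_invD:
  assumes "bfs_inv n w a L i f"
  shows "f a = 1" "\<And>v. v < n \<Longrightarrow> f v = 1 \<Longrightarrow> v = a" "\<And>v. v < n \<Longrightarrow> f v \<le> L + 2"
    and "\<And>u v. u < n \<Longrightarrow> v < n \<Longrightarrow> w u v \<Longrightarrow> f u \<noteq> 0 \<Longrightarrow> f u \<le> L \<or> f u = Suc L \<and> u < i
          \<Longrightarrow> f v \<noteq> 0 \<and> f v \<le> Suc (f u)"
    and "\<And>v l. v < n \<Longrightarrow> f v = Suc (Suc l) \<Longrightarrow> \<exists>u<n. w u v \<and> f u = Suc l"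
proof -
  have edge: "\<forall>u<n. \<forall>v<n. w u v \<longrightarrow> f u \<noteq> 0 \<longrightarrow> f u \<le> L \<or> f u = Suc L \<and> u < i
      \<longrightarrow> f v \<noteq> 0 \<and> f v \<le> Suc (f u)"
    using assms unfolding bfs_inv_def by (elim conjE)
  show "\<And>u v. u < n \<Longrightarrow> v < n \<Longrightarrow> w u v \<Longrightarrow> f u \<noteq> 0 \<Longrightarrow> f u \<le> L \<or> f u = Suc L \<and> u < i
      \<Longrightarrow> f v \<noteq> 0 \<and> f v \<le> Suc (f u)"
    by (rule edge[rule_format])
qed (use assms in \<open>simp_all add: bfs_inv_def\<close>)

lemma bfs_inv_skip:
  assumes "bfs_inv n w a L i f" "f i \<noteq> Suc L"
  shows "bfs_inv n w a L (Suc i) f"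
proof (rule bfs_invI)
  fix u v assume uv: "u < n" "v < n" "w u v" "f u \<noteq> 0" "f u \<le> L \<or> f u = Suc L \<and> u < Suc i"
  then have "f u \<le> L \<or> f u = Suc L \<and> u < i" using assms(2) less_Suc_eq by auto
  then show "f v \<noteq> 0 \<and> f v \<le> Suc (f u)" using bfs_invD(4)[OF assms(1)] uv by simp
qed (use bfs_invD[OF assms(1)] in auto)

lemma bfs_inv_level:
  assumes "bfs_inv n w a L n f"
  shows "bfs_inv n w a (Suc L) 0 f"
proof (rule bfs_invI)
  fix u v assume uv: "u < n" "v < n" "w u v" "f u \<noteq> 0"
    "f u \<le> Suc L \<or> f u = Suc (Suc L) \<and> u < 0"
  then have "f u \<le> L \<or> f u = Suc L \<and> u < n" by auto
  then show "f v \<noteq> 0 \<and> f v \<le> Suc (f u)" using bfs_invD(4)[OF assms] uv by simp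
next
  fix v assume "v < n"
  then show "f v \<le> Suc L + 2" using bfs_invD(3)[OF assms, of v] by simp
qed (use bfs_invD(1,2,5)[OF assms] in auto)

text \<open>A new label is one more than that of \<open>i\<close>, as the arc clause requires for
  arcs out of \<open>i\<close>. Nonzero labels are never overwritten, so earlier predecessors remain
  valid witnesses.\<close>

lemma bfs_inv_relax:
  assumes inv: "bfs_inv n w a L i f" and i: "f i = Suc L" "i < n" "a < n"
    and g: "\<forall>v<n. g v = (if w i v \<and> f v = 0 then L + 2 else f v)"
  shows "bfs_inv n w a L (Suc i) g"
proof -
  have gf: "g v = f v" if "v < n" "f v \<noteq> 0" for v
    using g that by simp
  have le: "g v \<le> L + 2" if "v < n" for v
    using g that bfs_invD(3)[OF inv, of v] by simp
  show ?thesis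
  proof (rule bfs_invI)
    show "g a = 1" using gf[of a] bfs_invD(1)[OF inv] i by simp
    show "g v \<le> L + 2" if "v < n" for v by (rule le[OF that])
    show "v = a" if v: "v < n" "g v = 1" for v
    proof -
      have "f v = 1" using g v by (auto split: if_splits)
      then show ?thesis using bfs_invD(2)[OF inv v(1)] by simp
    qed
  next
    fix u v assume uv: "u < n" "v < n" "w u v" "g u \<noteq> 0" and c: "g u \<le> L \<or> g u = Suc L \<and> u < Suc i"
    have gu: "g u = f u" using g uv(1) c by (auto split: if_splits)
    show "g v \<noteq> 0 \<and> g v \<le> Suc (g u)"
    proof (cases "u = i")
      case True
      then have "g v \<noteq> 0" using g uv by auto
      then show ?thesis using le[OF uv(2)] gu True i by simp
    next
      case False
      then have "f u \<le> L \<or> f u = Suc L \<and> u < i" using c gu by auto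
      then have "f v \<noteq> 0 \<and> f v \<le> Suc (f u)"
        using bfs_invD(4)[OF inv uv(1-3)] uv(4) gu by simp
      then show ?thesis using gf[OF uv(2)] gu by simp
    qed
  next
    fix v l assume v: "v < n" "g v = Suc (Suc l)"
    show "\<exists>u<n. w u v \<and> g u = Suc l"
    proof (cases "w i v \<and> f v = 0")
      case True
      then have "l = L" using g v by simp
      moreover have "g i = Suc L" using gf[of i] i by simp
      ultimately show ?thesis using True i by blast
    next
      case False
      then have "f v = Suc (Suc l)" using g v by auto
      then obtain u where u: "u < n" "w u v" "f u = Suc l"
        using bfs_invD(5)[OF inv v(1)] by blast
      then have "g u = Suc l" using gf[of u] by simp
      then show ?thesis using u by blast
    qed
  qed
qed

text \<open>By pigeonhole all labels are at most \<open>n\<close>; after \<open>n\<close> levels the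
  arc clause therefore applies to every reached vertex.\<close>

lemma bfs_inv_levels:
  assumes "bfs_inv n w a n 0 f"
  shows "levels n w a f"
proof -
  have "\<exists>u<n. f u = Suc l" if "v < n" "f v = Suc (Suc l)" for v l
    using bfs_invD(5)[OF assms that] by blast
  then have le: "f v \<le> n" if "v < n" for v
    using level_le_of_pred[of n f v] that by blast
  show ?thesis
    unfolding levels_def
    by (intro conjI allI impI) (use bfs_invD[OF assms] le in \<open>simp_all\<close>)
qed

lemma finite_bfs_todo: "finite (bfs_todo n L i f)"
  by (auto simp: bfs_todo_def)

lemma bfs_todo_relax:
  assumes "f i = Suc L" "i < n" "\<forall>v<n. g v = (if w i v \<and> f v = 0 then L + 2 else f v)"
  shows "Suc (card (bfs_todo n L (Suc i) g)) \<le> card (bfs_todo n L i f)"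
proof -
  have "bfs_todo n L (Suc i) g \<subseteq> bfs_todo n L i f - {i}"
    using assms by (auto simp: bfs_todo_def split: if_splits)
  moreover have "i \<in> bfs_todo n L i f"
    using assms by (simp add: bfs_todo_def)
  ultimately have "bfs_todo n L (Suc i) g \<subset> bfs_todo n L i f"
    by blast
  then show ?thesis
    using psubset_card_mono[OF finite_bfs_todo] by (simp add: Suc_le_eq)
qed

lemma bfs_todo_skip: "card (bfs_todo n L (Suc i) f) \<le> card (bfs_todo n L i f)"
  by (rule card_mono[OF finite_bfs_todo]) (auto simp: bfs_todo_def)

lemma bfs_todo_level: "card (bfs_todo n (Suc L) 0 f) \<le> card (bfs_todo n L n f)"
  by (rule card_mono[OF finite_bfs_todo]) (auto simp: bfs_todo_def)

lemma card_bfs_todo: "card (bfs_todo n L i f) \<le> n"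
  using card_mono[of "{..<n}" "bfs_todo n L i f"] by (auto simp: bfs_todo_def)

lemma run_Find:
  assumes bd: "bounded_state B s" and n: "reg s 0 = n" and B: "1 < B"
    and b: "\<And>s' y. y < n \<Longrightarrow> reg s' 7 = y \<Longrightarrow> bounded_state B s' \<Longrightarrow> same_except {7, 8} {} s s'
        \<Longrightarrow> bfits B b s' \<and> (bval b s' \<longleftrightarrow> P y)"
  shows "run B (Find b) s (n * (bcost b + 11) + 8)
    (\<lambda>s'. reg s' 8 < n \<and> P (reg s' 8) \<or> reg s' 8 = n \<and> (\<forall>y<n. \<not> P y))"
proof -
  define I where "I i s' \<longleftrightarrow> reg s' 8 < n \<and> P (reg s' 8) \<or> reg s' 8 = n \<and> (\<forall>y<i. \<not> P y)" for i and s' :: state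
  let ?c = "Cond b (Assign 8 (Reg 7)) Skip"
  have 1: "run B (Assign 8 (Reg 0)) s 2 (\<lambda>s'. reg s' 8 = n)"
    using bd n by (intro run_straight) auto
  have 2: "run B (For 7 0 ?c) s1 (reg s1 0 * ((bcost b + 3) + 8) + 6) (I n)"
    if s1: "bounded_state B s1" "same_except {8} {} s s1" "reg s1 8 = n" for s1
  proof (rule run_For[where I = I])
    show "I 0 (set_reg 7 0 s1)" using s1 by (simp add: I_def)
    have n1: "reg s1 0 = n" using s1(2) n by (simp add: same_except_def)
    fix i s' assume s': "i < reg s1 0" "reg s' 7 = i" "bounded_state B s'"
      "same_except (insert 7 (written_regs ?c)) (written_arrs ?c) s1 s'" "I i s'"
    have "same_except {7, 8} {} s s'"
      using s'(4) s1(2) by (simp add: same_except_def)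
    then have b': "bfits B b s' \<and> (bval b s' \<longleftrightarrow> P i)"
      using b[of i s'] s' n1 by simp
    then have "wp B ?c s' (\<lambda>s''. I (Suc i) (set_reg 7 (Suc i) s''))"
      using s' n1 by (auto simp: I_def less_Suc_eq)
    then show "run B ?c s' (bcost b + 3) (\<lambda>s''. I (Suc i) (set_reg 7 (Suc i) s''))"
      by (intro run_straight) auto
  next
    fix s' assume "same_except (insert 7 (written_regs ?c)) (written_arrs ?c) s1 s'" "I (reg s1 0) s'"
    then show "I n s'" using s1(2) n by (simp add: same_except_def)
  qed (use s1 B in auto)
  have "run B (Find b) s (2 + (n * ((bcost b + 3) + 8) + 6)) (I n)"
    unfolding Find_def
  proof (rule run_seq[OF bd 1])
    fix s1 assume s1: "bounded_state B s1" "reg s1 8 = n"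
      "same_except (written_regs (Assign 8 (Reg 0))) (written_arrs (Assign 8 (Reg 0))) s s1"
    then have "reg s1 0 = n" using n by (simp add: same_except_def)
    then show "run B (For 7 0 ?c) s1 (n * ((bcost b + 3) + 8) + 6) (I n)"
      using 2[of s1] s1 by simp
  qed
  then have "run B (Find b) s (n * (bcost b + 11) + 8) (I n)"
    by (rule run_le) (simp add: algebra_simps)
  then show ?thesis unfolding I_def .
qed

lemma run_Relax:
  assumes bd: "bounded_state B s" and n: "reg s 0 = n" and B: "2 < B" "reg s 6 + 2 < B"
    and b: "\<And>s' v. v < n \<Longrightarrow> reg s' 5 = v \<Longrightarrow> bounded_state B s' \<Longrightarrow> same_except {5} {6} s s'
        \<Longrightarrow> bfits B b s' \<and> (bval b s' \<longleftrightarrow> P v)"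
  shows "run B (Relax b) s (n * (bcost b + 20) + 6)
    (\<lambda>s'. \<forall>v<n. arr s' 6 v = (if P v \<and> arr s 6 v = 0 then reg s 6 + 2 else arr s 6 v))"
proof -
  let ?c = "Cond (Conj b (Equal (Arr 6 (Reg 5)) (Const 0)))
     (Store 6 (Reg 5) (Add (Reg 6) (Const 2))) Skip"
  define I where "I i s' \<longleftrightarrow>
     (\<forall>v<n. arr s' 6 v = (if v < i \<and> P v \<and> arr s 6 v = 0 then reg s 6 + 2 else arr s 6 v))"
    for i and s' :: state
  have "run B (For 5 0 ?c) s (reg s 0 * ((bcost b + 12) + 8) + 6) (I n)"
  proof (rule run_For[where I = I])
    show "I 0 (set_reg 5 0 s)" by (simp add: I_def)
    fix i s' assume s': "i < reg s 0" "reg s' 5 = i" "bounded_state B s'"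
      "same_except (insert 5 (written_regs ?c)) (written_arrs ?c) s s'" "I i s'"
    have b': "bfits B b s' \<and> (bval b s' \<longleftrightarrow> P i)"
      using b[of i s'] s' n by simp
    have "reg s' 6 = reg s 6" using s'(4) by (simp add: same_except_def)
    then have "wp B ?c s' (\<lambda>s''. I (Suc i) (set_reg 5 (Suc i) s''))"
      using s' n b' B bounded_arr[OF bd, of 6 i] by (auto simp: I_def less_Suc_eq)
    then show "run B ?c s' (bcost b + 12) (\<lambda>s''. I (Suc i) (set_reg 5 (Suc i) s''))"
      by (intro run_straight) auto
  qed (use bd B n in auto)
  then have "run B (Relax b) s (n * (bcost b + 20) + 6) (I n)"
    unfolding Relax_def n by (rule run_le) (simp add: algebra_simps)
  then show ?thesis
    by (rule run_frame[OF bd]) (simp add: I_def)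
qed

lemma run_Bfs:
  assumes bd: "bounded_state B s" and n: "reg s 0 = n" and a: "reg s 14 = a" "a < n" and B: "n + 2 < B"
    and b: "\<And>s' u v. u < n \<Longrightarrow> v < n \<Longrightarrow> reg s' 4 = u \<Longrightarrow> reg s' 5 = v \<Longrightarrow> bounded_state B s'
        \<Longrightarrow> same_except {4, 5, 6} {6} s s' \<Longrightarrow> bfits B b s' \<and> (bval b s' \<longleftrightarrow> w u v)"
  shows "run B (Bfs b) s (n * n * (bcost b + 200)) (\<lambda>s'. levels n w a (arr s' 6))"
proof -
  let ?clear = "For 5 0 (Store 6 (Reg 5) (Const 0))"
  let ?init = "Seq (Store 6 (Reg 14) (Const 1)) (Seq (Assign 6 (Const 0)) (Assign 4 (Const 0)))"
  let ?scan = "Cond (Equal (Arr 6 (Reg 4)) (Add (Reg 6) (Const 1))) (Relax b) Skip"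
  let ?next = "Assign 4 (Add (Reg 4) (Const 1))"
  let ?level = "Seq (Assign 4 (Const 0)) (Assign 6 (Add (Reg 6) (Const 1)))"
  let ?body = "Cond (Less (Reg 4) (Reg 0)) (Seq ?scan ?next) ?level"
  have clear: "run B ?clear s (n * 12 + 6) (\<lambda>s'. \<forall>v<n. arr s' 6 v = 0)"
  proof -
    have "run B ?clear s (reg s 0 * (4 + 8) + 6) (\<lambda>s'. \<forall>v<n. arr s' 6 v = 0)"
    proof (rule run_For[where I = "\<lambda>i s'. \<forall>v<i. arr s' 6 v = 0"])
      fix i s' assume s': "i < reg s 0" "reg s' 5 = i" "bounded_state B s'" "\<forall>v<i. arr s' 6 v = 0"
      then show "run B (Store 6 (Reg 5) (Const 0)) s' 4
          (\<lambda>s''. \<forall>v<Suc i. arr (set_reg 5 (Suc i) s'') 6 v = 0)"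
        using B by (intro run_straight) (auto simp: less_Suc_eq)
    qed (use bd n B in auto)
    then show ?thesis by (rule run_le) (simp add: n)
  qed
  \<comment> \<open>The clause for \<open>reg s' 6 = n\<close> fixes the exit state as level
    \<open>n\<close>, position 0, the form in which \<open>bfs_inv_levels\<close> takes the
    invariant.\<close>
  define J where "J s' \<longleftrightarrow> reg s' 6 \<le> n \<and> reg s' 4 \<le> n \<and> (reg s' 6 = n \<longrightarrow> reg s' 4 = 0) \<and>
     bfs_inv n w a (reg s' 6) (reg s' 4) (arr s' 6)" for s' :: state
  define todo where "todo s' = card (bfs_todo n (reg s' 6) (reg s' 4) (arr s' 6))" for s' :: state
  define left where "left s' = (n - reg s' 6) * (n + 1) - reg s' 4" for s' :: state
  define K where "K = n * (bcost b + 20)"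
  \<comment> \<open>\<open>left\<close> counts the remaining passes, \<open>n\<close> inspections
    and one change of level for each level. Each pass is paid by 40, and \<open>K\<close> covers the
    loop in one call of \<open>Relax\<close>, of which there are at most \<open>n\<close>.\<close>
  define \<Phi> where "\<Phi> s' = left s' * 40 + todo s' * K" for s' :: state
  have loop: "run B (While (Less (Reg 6) (Reg 0)) ?body) s1 (\<Phi> s1 + 4)
      (\<lambda>s'. levels n w a (arr s' 6))"
    if s1: "bounded_state B s1" "same_except {4, 5, 6} {6} s s1" "J s1" for s1
  proof -
    have "run B (While (Less (Reg 6) (Reg 0)) ?body) s1 (\<Phi> s1 + bcost (Less (Reg 6) (Reg 0)) + 1)
      (\<lambda>s'. levels n w a (arr s' 6))"
    proof (rule run_while[where I = J])
      fix s' assume s': "bounded_state B s'" "J s'"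
        and "same_except (written_regs ?body) (written_arrs ?body) s1 s'"
      then have sm: "same_except {4, 5, 6} {6} s s'"
        using s1(2) by (auto simp: same_except_def)
      have n': "reg s' 0 = n" using sm n by (simp add: same_except_def)
      show "bfits B (Less (Reg 6) (Reg 0)) s'" using s' by simp
      show "levels n w a (arr s' 6)" if "\<not> bval (Less (Reg 6) (Reg 0)) s'"
        using that s'(2) n' bfs_inv_levels by (auto simp: J_def)
      assume "bval (Less (Reg 6) (Reg 0)) s'"
      then have L: "reg s' 6 < n" using n' by simp
      have inv: "bfs_inv n w a (reg s' 6) (reg s' 4) (arr s' 6)" and un: "reg s' 4 \<le> n"
        using s'(2) by (auto simp: J_def)
      let ?Q = "\<lambda>T s''. J s'' \<and> T + bcost (Less (Reg 6) (Reg 0)) + 1 + \<Phi> s'' \<le> \<Phi> s'"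
      show "\<exists>T. run B ?body s' T (?Q T)"
      proof (cases "reg s' 4 < n")
        case u: True
        have "reg s' 4 < (n - reg s' 6) * (n + 1)"
        proof -
          have "1 * (n + 1) \<le> (n - reg s' 6) * (n + 1)"
            using L by (intro mult_right_mono) auto
          then show ?thesis using u by simp
        qed
        then have left: "left s' = Suc (left s'')"
          if "reg s'' 6 = reg s' 6" "reg s'' 4 = Suc (reg s' 4)" for s''
          using that by (simp add: left_def)
        have nxt: "run B ?next r 4 (\<lambda>s''. s'' = set_reg 4 (Suc (reg s' 4)) r)"
          if "reg r 4 = reg s' 4" "bounded_state B r" for r
          using that u B by (intro run_straight) auto
        show ?thesis
        proof (cases "arr s' 6 (reg s' 4) = Suc (reg s' 6)")
          case hit: True
          let ?P = "\<lambda>r. \<forall>v<n. arr r 6 v = (if w (reg s' 4) v \<and> arr s' 6 v = 0 then reg s' 6 + 2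
             else arr s' 6 v)"
          have relax: "run B (Relax b) s' (n * (bcost b + 20) + 6) ?P"
          proof (rule run_Relax)
            show "2 < B" "reg s' 6 + 2 < B" using B L by auto
            fix t v assume "v < n" "reg t 5 = v" "bounded_state B t" "same_except {5} {6} s' t"
            then show "bfits B b t \<and> (bval b t \<longleftrightarrow> w (reg s' 4) v)"
              using b[of "reg s' 4" v t] u sm by (auto simp: same_except_def)
          qed (use s' n' in auto)
          have scan: "run B ?scan s' (1 + 6 + (K + 6)) ?P"
          proof -
            have "run B ?scan s' (1 + bcost (Equal (Arr 6 (Reg 4)) (Add (Reg 6) (Const 1))) +
                (n * (bcost b + 20) + 6)) ?P"
              by (rule run_cond) (use s' L B hit relax in auto)
            then show ?thesis by (rule run_le) (simp add: K_def)
          qed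
          have "run B (Seq ?scan ?next) s' (1 + 6 + (K + 6) + 4) (?Q (K + 21))"
          proof (rule run_seq[OF s'(1) scan])
            fix r assume r: "bounded_state B r"
              "same_except (written_regs ?scan) (written_arrs ?scan) s' r" "?P r"
            have rr: "reg r 4 = reg s' 4" "reg r 6 = reg s' 6"
              using r(2) by (auto simp: same_except_def)
            let ?r = "set_reg 4 (Suc (reg s' 4)) r"
            have "bfs_inv n w a (reg s' 6) (Suc (reg s' 4)) (arr r 6)"
              using bfs_inv_relax[of n w a "reg s' 6" "reg s' 4" "arr s' 6" "arr r 6",
                OF inv hit u a(2) r(3)] .
            then have "J ?r" using L u rr by (simp add: J_def)
            moreover have "Suc (todo ?r) \<le> todo s'"
              using bfs_todo_relax[of "arr s' 6" "reg s' 4" "reg s' 6" n "arr r 6" w, OF hit u r(3)] rr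
              by (simp add: todo_def)
            then have "Suc (todo ?r) * K \<le> todo s' * K"
              by (rule mult_right_mono) simp
            ultimately have "?Q (K + 21) ?r"
              using left[of ?r] rr by (simp add: \<Phi>_def)
            then show "run B ?next r 4 (?Q (K + 21))"
              by (rule run_eqI[OF nxt[OF rr(1) r(1)]])
          qed
          then have "run B (Seq ?scan ?next) s' (K + 17) (?Q (K + 21))"
            by (rule run_le) simp
          then have "run B ?body s' (1 + bcost (Less (Reg 4) (Reg 0)) + (K + 17)) (?Q (K + 21))"
            using s' u n' by (intro run_cond) auto
          then have "run B ?body s' (K + 21) (?Q (K + 21))"
            by (rule run_le) simp
          then show ?thesis by blast
        next
          case miss: False
          let ?r = "set_reg 4 (Suc (reg s' 4)) s'"
          have scan: "run B ?scan s' 8 (\<lambda>r. r = s')"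
          proof -
            have "run B ?scan s' (1 + bcost (Equal (Arr 6 (Reg 4)) (Add (Reg 6) (Const 1))) + 1)
               (\<lambda>r. r = s')"
              by (rule run_cond) (use s' L B miss in \<open>auto intro: run_straight\<close>)
            then show ?thesis by (rule run_le) simp
          qed
          have "J ?r" using bfs_inv_skip[OF inv miss] L u by (simp add: J_def)
          moreover have "todo ?r \<le> todo s'"
            using bfs_todo_skip[of n "reg s' 6" "reg s' 4" "arr s' 6"] by (simp add: todo_def)
          then have "todo ?r * K \<le> 20 + todo s' * K"
            by (intro trans_le_add2 mult_right_mono) auto
          ultimately have Q: "?Q 16 ?r"
            using left[of ?r] by (simp add: \<Phi>_def)
          have "run B (Seq ?scan ?next) s' (8 + 4) (?Q 16)"
          proof (rule run_seq[OF s'(1) scan])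
            fix r assume r: "bounded_state B r" "r = s'"
            have "run B ?next r 4 (\<lambda>s''. s'' = ?r)"
              using nxt[of s'] r s'(1) by simp
            then show "run B ?next r 4 (?Q 16)"
              by (rule run_eqI) (rule Q)
          qed
          then have "run B ?body s' (1 + bcost (Less (Reg 4) (Reg 0)) + (8 + 4)) (?Q 16)"
            using s' u n' by (intro run_cond) auto
          then have "run B ?body s' 16 (?Q 16)"
            by (rule run_le) simp
          then show ?thesis by blast
        qed
      next
        case False
        then have u: "reg s' 4 = n" using un by simp
        let ?r = "set_reg 6 (Suc (reg s' 6)) (set_reg 4 0 s')"
        have "J ?r" using bfs_inv_level[of n w a "reg s' 6" "arr s' 6"] inv L u by (simp add: J_def)
        moreover have "todo ?r \<le> todo s'"
          using bfs_todo_level[of n "reg s' 6" "arr s' 6"] u by (simp add: todo_def)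
        then have "todo ?r * K \<le> 24 + todo s' * K"
          by (intro trans_le_add2 mult_right_mono) auto
        moreover have "left s' = Suc (left ?r)"
        proof -
          obtain q where "n - reg s' 6 = Suc q" "n - Suc (reg s' 6) = q"
            using L by (metis Suc_diff_Suc)
          then show ?thesis using u by (simp add: left_def)
        qed
        ultimately have Q: "?Q 12 ?r" by (simp add: \<Phi>_def)
        have "run B ?level s' 6 (?Q 12)"
          using Q s' B L by (intro run_straight) auto
        then have "run B ?body s' (1 + bcost (Less (Reg 4) (Reg 0)) + 6) (?Q 12)"
          using s' u n' by (intro run_cond) auto
        then have "run B ?body s' 12 (?Q 12)"
          by (rule run_le) simp
        then show ?thesis by blast
      qed
    qed (use s1 in auto)
    then show ?thesis by (rule run_le) simp
  qed
  have rest: "run B (Seq ?init (While (Less (Reg 6) (Reg 0)) ?body)) s0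
      (8 + (n * (n + 1) * 40 + n * K + 4)) (\<lambda>s'. levels n w a (arr s' 6))"
    if s0: "bounded_state B s0" "same_except {5} {6} s s0" "\<forall>v<n. arr s0 6 v = 0" for s0
  proof -
    let ?s1 = "set_reg 4 0 (set_reg 6 0 (set_arr 6 a 1 s0))"
    have a0: "reg s0 14 = a" using s0(2) a by (simp add: same_except_def)
    have "run B ?init s0 8 (\<lambda>s'. s' = ?s1)"
      using s0 B a0 a(2) by (intro run_straight) auto
    then show ?thesis
    proof (rule run_seq[OF s0(1)])
      fix s1 assume s1: "bounded_state B s1" "s1 = ?s1"
      have sm: "same_except {4, 5, 6} {6} s s1"
        using s0(2) s1(2) by (auto simp: same_except_def)
      have "bfs_inv n w a 0 0 (arr s1 6)"
        by (rule bfs_invI) (use s0(3) s1(2) a(2) in \<open>auto split: if_splits\<close>)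
      then have "J s1" using s1(2) by (simp add: J_def)
      moreover have "todo s1 \<le> n"
        unfolding todo_def by (rule card_bfs_todo)
      then have "todo s1 * K \<le> n * K" by simp
      then have "\<Phi> s1 + 4 \<le> n * (n + 1) * 40 + n * K + 4"
        using s1(2) by (simp add: \<Phi>_def left_def)
      ultimately show "run B (While (Less (Reg 6) (Reg 0)) ?body) s1 (n * (n + 1) * 40 + n * K + 4)
         (\<lambda>s'. levels n w a (arr s' 6))"
        using run_le[OF loop[OF s1(1) sm]] by simp
    qed
  qed
  have total: "run B (Bfs b) s ((n * 12 + 6) + (8 + (n * (n + 1) * 40 + n * K + 4)))
      (\<lambda>s'. levels n w a (arr s' 6))"
    unfolding Bfs_def by (rule run_seq[OF bd clear]) (use rest in auto)
  have "1 \<le> n" using a by simp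
  then have "n \<le> n * n" "1 \<le> n * n" by auto
  then have "18 + n * 52 \<le> 140 * (n * n)" by linarith
  moreover have "(n * 12 + 6) + (8 + (n * (n + 1) * 40 + n * K + 4)) =
      (18 + n * 52) + n * n * (bcost b + 60)"
    by (simp add: K_def algebra_simps)
  moreover have "n * n * (bcost b + 200) = 140 * (n * n) + n * n * (bcost b + 60)"
    by (simp add: algebra_simps)
  ultimately have "(n * 12 + 6) + (8 + (n * (n + 1) * 40 + n * K + 4)) \<le> n * n * (bcost b + 200)"
    by (metis add_le_mono1)
  with total show ?thesis by (rule run_le)
qed

section \<open>The reconfiguration program\<close>

text \<open>Comparing the two characteristic values tests both memberships at once.\<close>

definition is_source :: "nat \<Rightarrow> bexp" where
  "is_source y = Less (Arr 2 (Reg y)) (Arr 1 (Reg y))"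

definition is_target :: "nat \<Rightarrow> bexp" where
  "is_target y = Less (Arr 1 (Reg y)) (Arr 2 (Reg y))"

definition is_adjacent :: "nat \<Rightarrow> nat \<Rightarrow> bexp" where
  "is_adjacent x y = Equal (Arr 4 (Add (Mul (Reg x) (Reg 0)) (Reg y))) (Const 1)"

definition precedes :: "nat \<Rightarrow> nat \<Rightarrow> bexp" where
  "precedes y x = Equal (Add (Arr 6 (Reg y)) (Const 1)) (Arr 6 (Reg x))"

text \<open>Register 8 holds \<open>y\<close>, register 10 holds \<open>x\<close> in the sense of
  \<open>matching_augment\<close>. The old mate of \<open>y\<close> is saved before it is
  overwritten; if there is none, register 10 becomes \<open>n\<close>, which ends
  \<open>Augment\<close>.\<close>

definition Rematch :: com where
  "Rematch = Seq (Assign 13 (Arr 5 (Reg 8)))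
     (Seq (Store 5 (Reg 8) (Add (Reg 10) (Const 1)))
     (Seq (Store 5 (Reg 10) (Add (Reg 8) (Const 1)))
       (Cond (Equal (Reg 13) (Const 0)) (Assign 10 (Reg 0))
         (Seq (Assign 10 (Sub (Reg 13) (Const 1))) (Store 5 (Reg 10) (Const 0))))))"

definition Augment :: com where
  "Augment = Seq (Assign 10 (Reg 8))
     (While (Less (Reg 10) (Reg 0))
       (Seq (Find (Conj (is_source 7) (Conj (is_adjacent 7 10) (precedes 7 10)))) Rematch))"

lemma written_Rematch [simp]: "written_regs Rematch = {10, 13}" "written_arrs Rematch = {5}"
  by (auto simp: Rematch_def)

lemma written_Augment [simp]: "written_regs Augment = {7, 8, 10, 13}" "written_arrs Augment = {5}"
  by (auto simp: Augment_def)

section \<open>The word bound and the meaning of the memory\<close>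

locale instance_ram = incidence +
  fixes B :: nat and S0 T :: "nat set" and k d :: nat
  assumes n_pos: "0 < n" and word: "(n + m + 2) ^ 6 \<le> B"
    and S0: "covers S0" "card S0 = k" and T: "covers T" "card T = k"
    and dist: "\<And>u v. u < n \<Longrightarrow> v < n \<Longrightarrow> \<exists>L\<le>d. (u, v) \<in> {(u, v). u < n \<and> v < n \<and> adj u v} ^^ L"
begin

lemma fits: assumes "x \<le> (n + m + 2) ^ 5" shows "x < B"
proof -
  have "(n + m + 2) ^ 5 < (n + m + 2) ^ 6" by (rule power_strict_increasing) auto
  then show ?thesis using assms word by linarith
qed

text \<open>Output addresses are cubic: quadratically many rows of \<open>n\<close> cells. Because
  \<open>n > 0\<close>, the base is at least 3 and its square absorbs the factor 8.\<close>

lemma fits_cube: assumes "x \<le> 8 * (n + m + 2) ^ 3" shows "x < B"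
proof (rule fits)
  have "8 * (n + m + 2) ^ 3 \<le> (n + m + 2) ^ 2 * (n + m + 2) ^ 3 \<or> n + m + 2 < 3"
  proof -
    have "3 * 3 \<le> (n + m + 2) * (n + m + 2)" if "3 \<le> n + m + 2"
      using that by (intro mult_le_mono)
    then show ?thesis by (cases "n + m + 2 < 3") (auto simp: power2_eq_square)
  qed
  then have "8 * (n + m + 2) ^ 3 \<le> (n + m + 2) ^ 2 * (n + m + 2) ^ 3" using n_pos by simp
  also have "\<dots> = (n + m + 2) ^ 5" by (simp flip: power_add)
  finally show "x \<le> (n + m + 2) ^ 5" using assms by simp
qed

lemma fits_square: assumes "x \<le> (n + m + 2) * (n + m + 2)" shows "x < B"
proof (rule fits)
  have "(n + m + 2) ^ 2 \<le> (n + m + 2) ^ 5" by (rule power_increasing) auto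
  then show "x \<le> (n + m + 2) ^ 5" using assms by (simp add: power2_eq_square)
qed

lemma fits_const: "x \<le> 4 \<Longrightarrow> x < B"
  by (rule fits_square) (simp add: algebra_simps)

lemma fits_const_simps [simp]: "0 < B" "Suc 0 < B" "1 < B" "2 < B" "Suc (Suc 0) < B"
  using fits_const[of 0] fits_const[of 1] fits_const[of 2] by auto

lemma fits_linear: "x \<le> n + 3 \<Longrightarrow> x < B"
  by (rule fits_square) (simp add: algebra_simps)

lemma fits_index:
  assumes "u < n + m" "v < n" shows "u * n + v < B" "u * n < B"
proof -
  have "Suc u * n \<le> (n + m) * n" using assms by (intro mult_right_mono) auto
  also have "\<dots> \<le> (n + m + 2) * (n + m + 2)" by (intro mult_le_mono) auto
  finally show "u * n + v < B" "u * n < B"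
    using assms by (auto intro!: fits_square)
qed

text \<open>Only what all searches share. The matching and the levels change independently of the
  configuration and are specified separately.\<close>

definition env :: "state \<Rightarrow> nat set \<Rightarrow> bool" where
  "env s S \<longleftrightarrow> reg s 0 = n \<and> (\<forall>j<n. arr s 1 j = of_bool (j \<in> S)) \<and>
     (\<forall>j<n. arr s 2 j = of_bool (j \<in> T)) \<and>
     (\<forall>u<n. \<forall>v<n. arr s 4 (u * n + v) = of_bool (adj u v))"

lemma envD:
  assumes "env s S"
  shows "reg s 0 = n" "\<And>j. j < n \<Longrightarrow> arr s 1 j = of_bool (j \<in> S)"
    "\<And>j. j < n \<Longrightarrow> arr s 2 j = of_bool (j \<in> T)"
    "\<And>u v. u < n \<Longrightarrow> v < n \<Longrightarrow> arr s 4 (u * n + v) = of_bool (adj u v)"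
  using assms by (simp_all add: env_def)

lemma env_same:
  assumes "env s S" "same_except R A s s'" "0 \<notin> R" "1 \<notin> A" "2 \<notin> A" "4 \<notin> A"
  shows "env s' S"
  using assms by (simp add: env_def same_except_def)

lemma is_source_eval:
  assumes "env s S" "bounded_state B s" "reg s y < n"
  shows "bfits B (is_source y) s" "bval (is_source y) s \<longleftrightarrow> reg s y \<in> S - T"
  using assms envD(2,3)[OF assms(1,3)] by (auto simp: is_source_def)

lemma is_target_eval:
  assumes "env s S" "bounded_state B s" "reg s y < n"
  shows "bfits B (is_target y) s" "bval (is_target y) s \<longleftrightarrow> reg s y \<in> T - S"
  using assms envD(2,3)[OF assms(1,3)] by (auto simp: is_target_def)

lemma is_adjacent_eval:
  assumes "env s S" "bounded_state B s" "reg s x < n" "reg s y < n"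
  shows "bfits B (is_adjacent x y) s" "bval (is_adjacent x y) s \<longleftrightarrow> adj (reg s x) (reg s y)"
  using assms envD(1)[OF assms(1)] envD(4)[OF assms(1,3,4)] fits_index[of "reg s x" "reg s y"]
  by (auto simp: is_adjacent_def)

lemma precedes_eval:
  assumes "bounded_state B s" "reg s x < n" "reg s y < n" "\<And>v. v < n \<Longrightarrow> arr s 6 v \<le> n"
  shows "bfits B (precedes y x) s" "bval (precedes y x) s \<longleftrightarrow> Suc (arr s 6 (reg s y)) = arr s 6 (reg s x)"
  using assms(1) assms(4)[OF assms(3)] fits_linear[of "Suc (arr s 6 (reg s y))"]
  by (auto simp: precedes_def)

lemma bcost_simps [simp]:
  "bcost (is_source y) = 5" "bcost (is_target y) = 5" "bcost (is_adjacent x y) = 8"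
  "bcost (precedes y x) = 7"
  by (simp_all add: is_source_def is_target_def is_adjacent_def precedes_def)

lemma n_le_square: "n \<le> n * n" "1 \<le> n * n"
  using n_pos by auto

definition out :: "state \<Rightarrow> nat set list \<Rightarrow> bool" where
  "out s Ds \<longleftrightarrow> Suc (reg s 3) = length Ds \<and>
     (\<forall>i<length Ds. \<forall>j<n. arr s 3 (i * n + j) = of_bool (j \<in> Ds ! i))"

lemma out_same: "out s Ds \<Longrightarrow> same_except R A s s' \<Longrightarrow> 3 \<notin> R \<Longrightarrow> 3 \<notin> A \<Longrightarrow> out s' Ds"
  by (simp add: out_def same_except_def)

lemma run_Write_Row:
  assumes bd: "bounded_state B s" and n: "reg s 0 = n" and r: "reg s 3 \<le> (n + 2) * (n + 2)"
    and S: "\<forall>j<n. arr s 1 j = of_bool (j \<in> S)"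
  shows "run B Write_Row s (n * 16 + 6) (\<lambda>s'. (\<forall>j<n. arr s' 3 (reg s 3 * n + j) = of_bool (j \<in> S)) \<and>
     (\<forall>p<reg s 3 * n. arr s' 3 p = arr s 3 p))"
proof -
  let ?c = "Store 3 (Add (Mul (Reg 3) (Reg 0)) (Reg 12)) (Arr 1 (Reg 12))"
  define I where "I i s' \<longleftrightarrow> (\<forall>j<i. arr s' 3 (reg s 3 * n + j) = of_bool (j \<in> S)) \<and>
     (\<forall>p<reg s 3 * n. arr s' 3 p = arr s 3 p)" for i and s' :: state
  have cube: "(2 * (N * N)) * N \<le> 8 * N ^ 3" for N :: nat by (simp add: power3_eq_cube)
  have lim: "reg s 3 * n + i < B" "reg s 3 * n < B" if "i < n" for i
  proof -
    have "(reg s 3 + 1) * n \<le> ((n + 2) * (n + 2) + 1) * n" using r by (intro mult_right_mono) auto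
    also have "\<dots> \<le> (2 * ((n + 2) * (n + 2))) * (n + 2)" by (intro mult_mono) auto
    also have "\<dots> \<le> (2 * ((n + m + 2) * (n + m + 2))) * (n + m + 2)" by (intro mult_mono) auto
    also have "\<dots> \<le> 8 * (n + m + 2) ^ 3" by (rule cube)
    finally have "reg s 3 * n + n \<le> 8 * (n + m + 2) ^ 3" by (simp add: algebra_simps)
    then show "reg s 3 * n + i < B" "reg s 3 * n < B" using that by (auto intro!: fits_cube)
  qed
  have "run B (For 12 0 ?c) s (reg s 0 * (8 + 8) + 6) (I n)"
  proof (rule run_For[where I = I])
    fix i s' assume s': "i < reg s 0" "reg s' 12 = i" "bounded_state B s'"
      "same_except (insert 12 (written_regs ?c)) (written_arrs ?c) s s'" "I i s'"
    have "reg s' 3 = reg s 3" "reg s' 0 = n" "arr s' 1 = arr s 1"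
      using s'(4) n by (auto simp: same_except_def)
    then have "wp B ?c s' (\<lambda>s''. I (Suc i) (set_reg 12 (Suc i) s''))"
      using s' n S lim[of i] bounded_reg[OF bd, of 3] by (auto simp: I_def less_Suc_eq)
    then show "run B ?c s' 8 (\<lambda>s''. I (Suc i) (set_reg 12 (Suc i) s''))"
      by (intro run_straight) auto
  qed (use bd n in \<open>auto simp: I_def\<close>)
  then have "run B Write_Row s (n * 16 + 6) (I n)"
    unfolding Write_Row_def n by (rule run_le) simp
  then show ?thesis unfolding I_def .
qed

lemma run_Emit:
  assumes bd: "bounded_state B s" and n: "reg s 0 = n" and S: "\<forall>j<n. arr s 1 j = of_bool (j \<in> S)"
    and out: "out s Ds" and len: "length Ds \<le> (n + 2) * (n + 2)"
  shows "run B Emit s (n * 26) (\<lambda>s'. out s' (Ds @ [S]))"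
proof -
  let ?Q = "\<lambda>s'. out s' (Ds @ [S])"
  have r: "Suc (reg s 3) = length Ds" using out by (simp add: out_def)
  have "(n + 2) * (n + 2) < B" by (rule fits_square) (intro mult_le_mono; simp)
  then have 1: "run B (Assign 3 (Add (Reg 3) (Const 1))) s 4 (\<lambda>s'. s' = set_reg 3 (length Ds) s)"
    using bd r len by (intro run_straight) auto
  have "run B Emit s (4 + (n * 16 + 6)) ?Q"
    unfolding Emit_def
  proof (rule run_seq[OF bd 1])
    fix s1 assume s1: "bounded_state B s1" "s1 = set_reg 3 (length Ds) s"
    have e: "reg s1 3 = length Ds" "arr s1 = arr s" using s1(2) by auto
    have 2: "run B Write_Row s1 (n * 16 + 6)
       (\<lambda>s'. (\<forall>j<n. arr s' 3 (reg s1 3 * n + j) = of_bool (j \<in> S)) \<and>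
       (\<forall>p<reg s1 3 * n. arr s' 3 p = arr s1 3 p))"
      by (rule run_Write_Row) (use s1 n S len in auto)
    then show "run B Write_Row s1 (n * 16 + 6) ?Q"
    proof (rule run_frame[OF s1(1)])
      fix s' assume s': "same_except (written_regs Write_Row) (written_arrs Write_Row) s1 s'"
        "(\<forall>j<n. arr s' 3 (reg s1 3 * n + j) = of_bool (j \<in> S)) \<and>
         (\<forall>p<reg s1 3 * n. arr s' 3 p = arr s1 3 p)"
      have old: "arr s' 3 (i * n + j) = arr s 3 (i * n + j)" if "i < length Ds" "j < n" for i j
      proof -
        have "i * n + j < Suc i * n" using that by simp
        also have "\<dots> \<le> length Ds * n" using that by (intro mult_right_mono) auto
        finally show ?thesis using s'(2) e by simp
      qed
      have "reg s' 3 = length Ds" using s'(1) e by (simp add: same_except_def)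
      then show "?Q s'"
        using s'(2) old out e by (auto simp: out_def nth_append less_Suc_eq)
    qed
  qed
  moreover have "4 + (n * 16 + 6) \<le> n * 26" using n_pos by simp
  ultimately show ?thesis by (rule run_le)
qed

text \<open>The levels belong to the matching before the augmentation and are not recomputed. The
  descent is still correct because vertices of \<open>S - T\<close> at levels below the current one
  keep their original mates, which is part of \<open>J\<close>. The current level, times the cost of
  one pass, is the potential.\<close>

lemma run_Augment:
  assumes bd: "bounded_state B s" and env: "env s S" and S: "S \<subseteq> {..<n}"
    and M: "matching (arr s 5) S T" and a: "a \<in> S - T" "arr s 5 a = 0"
    and f: "levels n (alternating (arr s 5) S T) a (arr s 6)"
    and x: "reg s 8 < n" "reg s 8 \<in> T - S" "arr s 5 (reg s 8) = 0" "arr s 6 (reg s 8) \<noteq> 0"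
  shows "run B Augment s (n * n * 80) (\<lambda>s'. matching (arr s' 5) S T \<and> arr s' 5 a \<noteq> 0 \<and>
     (\<forall>v\<in>S - T. arr s 5 v \<noteq> 0 \<longrightarrow> arr s' 5 v \<noteq> 0))"
proof -
  let ?b = "Conj (is_source 7) (Conj (is_adjacent 7 10) (precedes 7 10))"
  let ?body = "Seq (Find ?b) Rematch"
  define J where "J s' \<longleftrightarrow> reg s' 10 \<le> n \<and> matching (arr s' 5) S T \<and>
     (\<forall>v\<in>S - T. arr s 5 v \<noteq> 0 \<longrightarrow> arr s' 5 v \<noteq> 0) \<and> (reg s' 10 = n \<longrightarrow> arr s' 5 a \<noteq> 0) \<and>
     (reg s' 10 < n \<longrightarrow> reg s' 10 \<in> T - S \<and> arr s' 5 (reg s' 10) = 0 \<and> arr s 6 (reg s' 10) \<noteq> 0 \<and>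
        (\<forall>v\<in>S - T. arr s 6 v < arr s 6 (reg s' 10) \<longrightarrow> arr s' 5 v = arr s 5 v))" for s' :: state
  define \<Phi> where "\<Phi> s' = (if reg s' 10 < n then arr s 6 (reg s' 10) else 0) * (n * 70)" for s' :: state
  let ?Q = "\<lambda>s'. matching (arr s' 5) S T \<and> arr s' 5 a \<noteq> 0 \<and>
     (\<forall>v\<in>S - T. arr s 5 v \<noteq> 0 \<longrightarrow> arr s' 5 v \<noteq> 0)"
  have an: "a < n" using a S by auto
  have loop: "run B (While (Less (Reg 10) (Reg 0)) ?body) s1
      (\<Phi> s1 + bcost (Less (Reg 10) (Reg 0)) + 1) ?Q"
    if s1: "bounded_state B s1" "same_except {10} {} s s1" "J s1" for s1
  proof (rule run_while[where I = J])
    fix s' assume s': "bounded_state B s'" "J s'"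
      and "same_except (written_regs ?body) (written_arrs ?body) s1 s'"
    then have sm: "same_except {7, 8, 10, 13} {5} s s'"
      using s1(2) by (auto simp: same_except_def)
    have e': "env s' S" by (rule env_same[OF env sm]) auto
    note n' = envD(1)[OF e']
    show "bfits B (Less (Reg 10) (Reg 0)) s'" using s' by simp
    show "?Q s'" if "\<not> bval (Less (Reg 10) (Reg 0)) s'"
      using that s'(2) n' by (auto simp: J_def)
    assume "bval (Less (Reg 10) (Reg 0)) s'"
    then have xn: "reg s' 10 < n" using n' by simp
    define x where "x = reg s' 10"
    define mt where "mt = arr s' 5"
    have J: "x \<in> T - S" "mt x = 0" "arr s 6 x \<noteq> 0" "matching mt S T"
      "\<And>v. v \<in> S - T \<Longrightarrow> arr s 5 v \<noteq> 0 \<Longrightarrow> mt v \<noteq> 0"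
      "\<And>v. v \<in> S - T \<Longrightarrow> arr s 6 v < arr s 6 x \<Longrightarrow> mt v = arr s 5 v"
      using s'(2) xn by (auto simp: J_def x_def mt_def)
    let ?P = "\<lambda>y. y \<in> S - T \<and> adj y x \<and> Suc (arr s 6 y) = arr s 6 x"
    have find: "run B (Find ?b) s' (n * (bcost ?b + 11) + 8)
       (\<lambda>r. reg r 8 < n \<and> ?P (reg r 8) \<or> reg r 8 = n \<and> (\<forall>y<n. \<not> ?P y))"
    proof (rule run_Find[OF s'(1) n'])
      fix r y assume r: "y < n" "reg r 7 = y" "bounded_state B r" "same_except {7, 8} {} s' r"
      have er: "env r S" by (rule env_same[OF e' r(4)]) auto
      have x10: "reg r 10 = x" and ar: "arr r 6 = arr s 6"
        using r(4) sm by (auto simp: same_except_def x_def)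
      have le: "\<And>v. v < n \<Longrightarrow> arr r 6 v \<le> n" using levels_le[OF f] ar by simp
      show "bfits B ?b r \<and> (bval ?b r \<longleftrightarrow> ?P y)"
        using is_source_eval[OF er r(3), of 7] is_adjacent_eval[OF er r(3), of 7 10]
          precedes_eval[OF r(3) _ _ le, of 10 7] r(1,2) x10 ar xn by (simp add: x_def)
    qed simp
    \<comment> \<open>The predecessor of \<open>x\<close> in the search qualifies: arcs into
      \<open>T - S\<close> start in \<open>S - T\<close> and stand for shared hyperedges.\<close>
    have "\<exists>y<n. ?P y"
    proof -
      have "x \<noteq> a" using J(1) a by auto
      then obtain u where u: "u < n" "alternating (arr s 5) S T u x" "Suc (arr s 6 u) = arr s 6 x"
        using levels_pred[OF f, of x] xn J(3) x_def by blast
      then show ?thesis using alternatingD(1,4)[OF u(2) M u(1)] J(1) by auto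
    qed
    define TT where "TT = (n * (bcost ?b + 11) + 8) + 24"
    have "run B ?body s' TT (\<lambda>s''. J s'' \<and> TT + bcost (Less (Reg 10) (Reg 0)) + 1 + \<Phi> s'' \<le> \<Phi> s')"
      unfolding TT_def
    proof (rule run_seq[OF s'(1) find], fold TT_def)
      fix r assume r: "bounded_state B r" "same_except (written_regs (Find ?b)) (written_arrs (Find ?b)) s' r"
        "reg r 8 < n \<and> ?P (reg r 8) \<or> reg r 8 = n \<and> (\<forall>y<n. \<not> ?P y)"
      define y where "y = reg r 8"
      have y: "y < n" "y \<in> S - T" "adj y x" "Suc (arr s 6 y) = arr s 6 x"
        using r(3) \<open>\<exists>y<n. ?P y\<close> by (auto simp: y_def)
      have rs: "reg r 10 = x" "arr r 5 = mt" "reg r 0 = n"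
        using r(2) n' by (auto simp: same_except_def x_def mt_def)
      have mty: "mt y = arr s 5 y" using J(6) y by simp
      have xy: "x \<noteq> y" using J(1) y(2) by auto
      have fy: "arr s 6 y \<noteq> 0"
      proof
        assume "arr s 6 y = 0"
        then have "arr s 6 x = 1" using y(4) by simp
        then have "x = a" using f xn x_def unfolding levels_def by blast
        then show False using J(1) a by auto
      qed
      \<comment> \<open>Arcs into \<open>S - T\<close> are matching edges, so the predecessor of
        \<open>y\<close> is its old mate. Following the old mate, as \<open>Rematch\<close> does,
        thus goes down exactly one level.\<close>
      have pred_y: "\<exists>z<n. mt y = Suc z \<and> Suc (arr s 6 z) = arr s 6 y \<and> z \<in> T - S" if ya: "y \<noteq> a"
      proof -
        obtain z where z: "z < n" "alternating (arr s 5) S T z y" "Suc (arr s 6 z) = arr s 6 y"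
          using levels_pred[OF f y(1) fy ya] by blast
        then have m: "arr s 5 y = Suc z" using alternatingD(3)[OF z(2) M z(1)] y(2) by simp
        then have "z \<in> T - S" using matchingD(4)[OF M y(1) m] y(2) by auto
        then show ?thesis using z m mty by auto
      qed
      define mt' where "mt' = (case mt y of 0 \<Rightarrow> mt | Suc z \<Rightarrow> mt(z := 0))(y := Suc x, x := Suc y)"
      have M': "matching mt' S T"
        by (rule matching_augment[OF J(4) J(1,2) _ y(2,3) mt'_def]) (use xn in \<open>simp add: x_def\<close>)
      have keep: "mt' v \<noteq> 0" if "v \<in> S - T" "mt v \<noteq> 0" for v
      proof (cases "v = y")
        case False
        have "mt y \<noteq> Suc v" using matchingD(4)[OF J(4) y(1), of v] that(1) y(2) by auto
        then show ?thesis using that False J(1) by (auto simp: mt'_def split: nat.split)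
      qed (use xy in \<open>simp add: mt'_def\<close>)
      have mx: "arr s 6 x * (n * 70) = arr s 6 y * (n * 70) + n * 70"
        using y(4) by (metis add.commute mult_Suc)
      have TT: "TT + 4 \<le> n * 70" using n_pos by (simp add: TT_def)
      have \<Phi>s: "\<Phi> s' = arr s 6 y * (n * 70) + n * 70" using xn mx by (simp add: \<Phi>_def x_def)
      let ?R = "\<lambda>s''. J s'' \<and> TT + bcost (Less (Reg 10) (Reg 0)) + 1 + \<Phi> s'' \<le> \<Phi> s'"
      have fx: "Suc x < B" "Suc y < B" using fits_linear xn y(1) by (auto simp: x_def)
      show "run B Rematch r 24 ?R"
      proof (cases "mt y = 0")
        case True
        \<comment> \<open>Every other reached vertex of \<open>S - T\<close> has a mate, so the
          exchange stops at \<open>a\<close> and matches it.\<close>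
        then have "y = a" using pred_y by auto
        have mt'': "mt' = mt(y := Suc x, x := Suc y)" using True by (simp add: mt'_def)
        have R: "?R q" if q: "reg q 10 = n" "arr q 5 = mt'" for q
        proof -
          have "mt' a \<noteq> 0" using \<open>y = a\<close> xy by (simp add: mt'_def)
          then have "J q" using q M' keep J(5) by (simp add: J_def)
          moreover have "\<Phi> q = 0" using q by (simp add: \<Phi>_def)
          ultimately show ?thesis using TT \<Phi>s by simp
        qed
        have "run B Rematch r 24 (\<lambda>q. reg q 10 = n \<and> arr q 5 = mt')"
        proof (rule run_straight)
          show "straight_cost Rematch \<le> 24" by (simp add: Rematch_def)
          show "wp B Rematch r (\<lambda>q. reg q 10 = n \<and> arr q 5 = mt')"
            unfolding Rematch_def
            using r(1) rs fx True y_def mt'' xy fits_linear[of n] by simp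
        qed
        then show ?thesis by (rule run_frame[OF r(1)]) (use R in simp)
      next
        case False
        then obtain z where mz: "mt y = Suc z" by (metis not0_implies_Suc)
        have "y \<noteq> a" using False mty a(2) by auto
        then have z: "z < n" "Suc (arr s 6 z) = arr s 6 y" "z \<in> T - S"
          using pred_y mz by auto
        have zx: "z \<noteq> x" using matchingD(2)[OF J(4) y(1) mz] J(2) by auto
        have zy: "z \<noteq> y" using z(3) y(2) by auto
        have mt'': "mt' = mt(y := Suc x, x := Suc y, z := 0)"
          unfolding mt'_def mz using zx zy xy by (auto simp: fun_eq_iff)
        have R: "?R q" if q: "reg q 10 = z" "arr q 5 = mt'" for q
        proof -
          have nz: "arr s 6 z \<noteq> 0"
          proof
            assume "arr s 6 z = 0"
            then have "arr s 6 y = 1" using z by simp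
            then have "y = a" using f y(1) unfolding levels_def by blast
            then show False using \<open>y \<noteq> a\<close> by simp
          qed
          have same: "mt' v = arr s 5 v" if v: "v \<in> S - T" "arr s 6 v < arr s 6 z" for v
          proof -
            have "v \<noteq> y" "v \<noteq> x" "v \<noteq> z" using v z y(4) J(1) by auto
            then have "mt' v = mt v" using mt'' by simp
            then show ?thesis using J(6)[OF v(1)] v(2) z(2) y(4) by simp
          qed
          have "mt' z = 0" using mt'' by simp
          then have "J q" using q M' keep J(5) z nz same by (simp add: J_def)
          moreover have "\<Phi> q \<le> arr s 6 y * (n * 70)"
            using q z(1,2) by (simp add: \<Phi>_def)
          ultimately show ?thesis using TT \<Phi>s by simp
        qed
        have zB: "Suc z < B" using fits_linear z(1) by auto
        have "run B Rematch r 24 (\<lambda>q. reg q 10 = z \<and> arr q 5 = mt')"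
        proof (rule run_straight)
          show "straight_cost Rematch \<le> 24" by (simp add: Rematch_def)
          show "wp B Rematch r (\<lambda>q. reg q 10 = z \<and> arr q 5 = mt')"
            unfolding Rematch_def
            using r(1) rs fx mz zB y_def mt'' xy zx zy by simp
        qed
        then show ?thesis by (rule run_frame[OF r(1)]) (use R in simp)
      qed
    qed
    then show "\<exists>T'. run B ?body s' T' (\<lambda>s''. J s'' \<and> T' + bcost (Less (Reg 10) (Reg 0)) + 1 + \<Phi> s'' \<le> \<Phi> s')"
      by blast
  qed (use s1 in auto)
  have "run B (Assign 10 (Reg 8)) s 2 (\<lambda>s'. s' = set_reg 10 (reg s 8) s)"
    using bd by (intro run_straight) auto
  then have "run B Augment s (2 + (n * (n * 70) + 4)) ?Q"
    unfolding Augment_def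
  proof (rule run_seq[OF bd])
    fix s1 assume s1: "bounded_state B s1" "s1 = set_reg 10 (reg s 8) s"
    have sm: "same_except {10} {} s s1" using s1(2) by (simp add: same_except_def)
    have "J s1" using s1(2) x M by (simp add: J_def)
    note L = loop[OF s1(1) sm this]
    have "\<Phi> s1 \<le> n * (n * 70)"
      unfolding \<Phi>_def using levels_le[OF f] by (intro mult_right_mono) auto
    with L show "run B (While (Less (Reg 10) (Reg 0)) ?body) s1 (n * (n * 70) + 4) ?Q"
      by (intro run_le[OF L]) simp
  qed
  moreover have "2 + (n * (n * 70) + 4) \<le> n * n * 80"
    using n_le_square(2) unfolding mult.assoc[symmetric] by linarith
  ultimately show ?thesis by (rule run_le)
qed

end

section \<open>Releasing a token and walking it to its target\<close>

definition Release :: com where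
  "Release = For 15 0 (Cond (Conj (Less (Const 0) (Arr 6 (Reg 15))) (Neg (Equal (Reg 15) (Reg 9))))
     (Seq (Store 1 (Reg 15) (Sub (Const 1) (Arr 1 (Reg 15)))) (Store 5 (Reg 15) (Const 0))) Skip)"

definition Place :: com where
  "Place = Seq (Store 1 (Reg 11) (Const 0)) (Seq (Store 1 (Reg 10) (Const 1)) (Assign 11 (Reg 10)))"

text \<open>An occupied vertex only extends the chain and produces no configuration. At a vacant one
  the whole chain moves; on the characteristic vector this merely clears the position of the free
  token (register 11) and fills the vacant vertex, which becomes its new position.\<close>

definition Step :: com where
  "Step = Seq (Assign 10 (Reg 8)) (Cond (Equal (Arr 1 (Reg 10)) (Const 0)) (Seq Place Emit) Skip)"

text \<open>The levels stem from a search started at the target, so going down from \<open>a\<close>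
  approaches it, and label 1 marks the target itself.\<close>

definition Walk :: com where
  "Walk = Seq (Seq (Assign 10 (Reg 9)) (Assign 11 (Reg 9)))
     (While (Less (Const 1) (Arr 6 (Reg 10)))
       (Seq (Find (Conj (is_adjacent 10 7) (precedes 7 10))) Step))"

lemma written_Release [simp]: "written_regs Release = {15}" "written_arrs Release = {1, 5}"
  by (auto simp: Release_def)

lemma written_Place [simp]: "written_regs Place = {11}" "written_arrs Place = {1}"
  by (auto simp: Place_def)

lemma written_Step [simp]: "written_regs Step = {3, 10, 11, 12}" "written_arrs Step = {1, 3}"
  by (auto simp: Step_def)

lemma written_Walk [simp]: "written_regs Walk = {3, 7, 8, 10, 11, 12}" "written_arrs Walk = {1, 3}"
  by (auto simp: Walk_def)

context instance_ram
begin

definition trace :: "nat set list \<Rightarrow> nat set \<Rightarrow> bool" where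
  "trace Ds S \<longleftrightarrow> Ds \<noteq> [] \<and> hd Ds = S0 \<and> last Ds = S \<and> (\<forall>D\<in>set Ds. covers D \<and> card D = k) \<and>
     (\<forall>i. Suc i < length Ds \<longrightarrow> move (Ds ! i) (Ds ! Suc i))"

lemma trace_init: "trace [S0] S0"
  using S0 by (simp add: trace_def)

lemma trace_last: "trace Ds S \<Longrightarrow> covers S" "trace Ds S \<Longrightarrow> card S = k"
  by (auto simp: trace_def)

lemma trace_snoc:
  assumes "trace Ds S" "move S S'" "covers S'"
  shows "trace (Ds @ [S']) S'"
proof -
  have "card S' = k" using trace_last(2)[OF assms(1)] move_card[OF assms(2)] by simp
  moreover have "move ((Ds @ [S']) ! i) ((Ds @ [S']) ! Suc i)" if "Suc i < length (Ds @ [S'])" for i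
  proof (cases "Suc i < length Ds")
    case True
    then show ?thesis using assms(1) by (simp add: trace_def nth_append)
  next
    case False
    then have "i = length Ds - 1" "Suc i = length Ds" using that by auto
    moreover have "Ds ! (length Ds - 1) = S"
      using assms(1) by (metis trace_def last_conv_nth)
    ultimately show ?thesis using assms(2) by (simp add: nth_append)
  qed
  ultimately show ?thesis
    using assms(1,3) by (auto simp: trace_def)
qed

lemma run_Release:
  assumes bd: "bounded_state B s" and env: "env s S" and X: "X = {v. v < n \<and> arr s 6 v \<noteq> 0 \<and> v \<noteq> reg s 9}"
  shows "run B Release s (n * 40) (\<lambda>s'. env s' ((S - X) \<union> (X - S)) \<and>
     arr s' 5 = (\<lambda>v. if v \<in> X then 0 else arr s 5 v))"
proof -
  let ?c = "Cond (Conj (Less (Const 0) (Arr 6 (Reg 15))) (Neg (Equal (Reg 15) (Reg 9))))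
     (Seq (Store 1 (Reg 15) (Sub (Const 1) (Arr 1 (Reg 15)))) (Store 5 (Reg 15) (Const 0))) Skip"
  note n = envD(1)[OF env] and S = envD(2)[OF env]
  define I where "I i s' \<longleftrightarrow>
     (\<forall>j<n. arr s' 1 j = (if j < i \<and> j \<in> X then 1 - arr s 1 j else arr s 1 j)) \<and>
     (\<forall>j. arr s' 5 j = (if j < i \<and> j \<in> X then 0 else arr s 5 j))" for i and s' :: state
  have "run B (For 15 0 ?c) s (reg s 0 * (20 + 8) + 6) (I n)"
  proof (rule run_For[where I = I])
    fix i s' assume s': "i < reg s 0" "reg s' 15 = i" "bounded_state B s'"
      "same_except (insert 15 (written_regs ?c)) (written_arrs ?c) s s'" "I i s'"
    have e: "arr s' 6 = arr s 6" "reg s' 9 = reg s 9" using s'(4) by (auto simp: same_except_def)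
    have iX: "i \<in> X \<longleftrightarrow> arr s 6 i \<noteq> 0 \<and> i \<noteq> reg s 9" using X s'(1) n by auto
    have fit: "i < B" "arr s 6 i < B" "arr s 1 i < B" "reg s 9 < B"
      using bd s'(1) n fits_linear[of i] by auto
    have a1: "arr s' 1 i = arr s 1 i" using s'(1,5) n by (simp add: I_def)
    have "wp B ?c s' (\<lambda>s''. I (Suc i) (set_reg 15 (Suc i) s''))"
    proof (cases "i \<in> X")
      case True
      then show ?thesis using s'(2,5) e iX fit a1 by (auto simp: I_def less_Suc_eq)
    next
      case False
      then show ?thesis using s'(2,5) e iX fit by (auto simp: I_def less_Suc_eq)
    qed
    then show "run B ?c s' 20 (\<lambda>s''. I (Suc i) (set_reg 15 (Suc i) s''))"
      by (intro run_straight) auto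
  qed (use bd n in \<open>auto simp: I_def\<close>)
  then have "run B Release s (n * 40) (I n)"
    unfolding Release_def n by (rule run_le) (use n_pos in simp)
  then show ?thesis
  proof (rule run_frame[OF bd])
    fix s' assume s': "same_except (written_regs Release) (written_arrs Release) s s'" "I n s'"
    have "arr s' 1 j = of_bool (j \<in> (S - X) \<union> (X - S))" if "j < n" for j
      using s'(2) that S[OF that] by (auto simp: I_def)
    then have "env s' ((S - X) \<union> (X - S))"
      using s'(1) env by (simp add: env_def same_except_def)
    moreover have "arr s' 5 j = (if j \<in> X then 0 else arr s 5 j)" for j
      using s'(2) X by (auto simp: I_def)
    ultimately show "env s' ((S - X) \<union> (X - S)) \<and> arr s' 5 = (\<lambda>v. if v \<in> X then 0 else arr s 5 v)"
      by auto
  qed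
qed

text \<open>The configuration without its free token is the same before and after. It is a cover by
  \<open>C\<close>, so wherever the free token lands the configuration remains one.\<close>

lemma run_Step:
  assumes bd: "bounded_state B s" and env: "env s S" and out: "out s Ds" and tr: "trace Ds S"
    and len: "length Ds \<le> (n + 2) * (n + 2)"
    and y: "reg s 8 = y" "y < n" "adj x y" "r y < r x" and x: "pushable S fr x r" and fr: "reg s 11 = fr"
    and C: "covers (S - {fr})"
  shows "run B Step s (n * 41) (\<lambda>s'. reg s' 10 = y \<and> (\<exists>S' Ds' fr'. S' - {fr'} = S - {fr} \<and> reg s' 11 = fr' \<and>
     env s' S' \<and> out s' Ds' \<and> trace Ds' S' \<and> length Ds' \<le> Suc (length Ds) \<and> pushable S' fr' y r))"
    (is "run B Step s _ ?Q")
proof -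
  have sub: "S \<subseteq> {..<n}" using covers_subset[OF trace_last(1)[OF tr]] .
  have frS: "fr \<in> S" using x by (simp add: pushable_def)
  have "run B (Assign 10 (Reg 8)) s 2 (\<lambda>s1. s1 = set_reg 10 y s)"
    using bd y by (intro run_straight) auto
  then have "run B Step s (2 + (1 + bcost (Equal (Arr 1 (Reg 10)) (Const 0)) + (8 + n * 26))) ?Q"
    unfolding Step_def
  proof (rule run_seq[OF bd])
    fix s1 assume s1: "bounded_state B s1" "s1 = set_reg 10 y s"
    have e1: "env s1 S" "out s1 Ds" "reg s1 10 = y" "reg s1 11 = fr"
      using env out s1(2) fr by (auto simp: env_def out_def)
    note Sy = envD(2)[OF e1(1) y(2)]
    show "run B (Cond (Equal (Arr 1 (Reg 10)) (Const 0)) (Seq Place Emit) Skip) s1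
       (1 + bcost (Equal (Arr 1 (Reg 10)) (Const 0)) + (8 + n * 26)) ?Q"
    proof (rule run_cond)
      show "bfits B (Equal (Arr 1 (Reg 10)) (Const 0)) s1" using s1(1) by simp
    next
      assume "\<not> bval (Equal (Arr 1 (Reg 10)) (Const 0)) s1"
      then have "y \<in> S" using Sy e1(3) by (auto split: if_splits)
      then have "pushable S fr y r" using pushable_step[OF x y(3) _ y(4)] by simp
      then have "?Q s1" using e1 tr by (intro conjI exI[of _ S] exI[of _ Ds] exI[of _ fr]) auto
      then have "run B Skip s1 1 ?Q" by (intro run_straight) auto
      then show "run B Skip s1 (8 + n * 26) ?Q" by (rule run_le) simp
    next
      assume "bval (Equal (Arr 1 (Reg 10)) (Const 0)) s1"
      then have yS: "y \<notin> S" using Sy e1(3) by auto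
      let ?S' = "insert y (S - {fr})"
      have mv: "move S ?S'" by (rule move_of_pushable[OF x y(3) yS])
      have cv: "covers ?S'" by (rule covers_mono[OF C]) (use sub y(2) in auto)
      let ?s2 = "set_reg 11 y (set_arr 1 y 1 (set_arr 1 fr 0 s1))"
      have frn: "fr < n" using frS sub by auto
      have "run B Place s1 8 (\<lambda>s2. s2 = ?s2)"
        using s1(1) e1(3,4) fits_linear[of y] fits_linear[of fr] y(2) frn
        by (intro run_straight) (auto simp: Place_def)
      then show "run B (Seq Place Emit) s1 (8 + n * 26) ?Q"
      proof (rule run_seq[OF s1(1)])
        fix s2 assume s2: "bounded_state B s2" "s2 = ?s2"
        have e2: "env s2 ?S'" "out s2 Ds" "reg s2 11 = y" "reg s2 10 = y"
          using e1 s2(2) yS frS by (auto simp: env_def out_def)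
        have "run B Emit s2 (n * 26) (\<lambda>s'. out s' (Ds @ [?S']))"
          by (rule run_Emit[OF s2(1) envD(1)[OF e2(1)] _ e2(2) len]) (use envD(2)[OF e2(1)] in blast)
        then show "run B Emit s2 (n * 26) ?Q"
        proof (rule run_frame[OF s2(1)])
          fix s' assume s': "same_except (written_regs Emit) (written_arrs Emit) s2 s'" "out s' (Ds @ [?S'])"
          have "env s' ?S'" by (rule env_same[OF e2(1) s'(1)]) auto
          moreover have "reg s' 11 = y" "reg s' 10 = y" using s'(1) e2 by (auto simp: same_except_def)
          moreover have "trace (Ds @ [?S']) ?S'" by (rule trace_snoc[OF tr mv cv])
          moreover have "pushable ?S' y y r" by (rule pushable_refl) simp
          moreover have "?S' - {y} = S - {fr}" using yS by auto
          ultimately show "?Q s'"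
            using s'(2) by (intro conjI exI[of _ ?S'] exI[of _ "Ds @ [?S']"] exI[of _ y]) auto
        qed
      qed
    qed
  qed
  then show ?thesis by (rule run_le) (use n_pos in simp)
qed

text \<open>Each step lowers the level by one and emits at most one row, so the sum of rows and
  current level never grows. At the target the level is 1, and labels are distances plus one; hence
  there are at most as many moves as the distance from \<open>a\<close> to \<open>b\<close>.\<close>

lemma run_Walk:
  assumes bd: "bounded_state B s" and env: "env s S" and out: "out s Ds" and tr: "trace Ds S"
    and a: "reg s 9 = a" "a \<in> S" and f: "levels n adj b (arr s 6)" and b: "b < n" "b \<notin> S"
    and C: "covers (S - {a})" and fa: "arr s 6 a \<noteq> 0"
    and len: "length Ds + arr s 6 a \<le> (n + 2) * (n + 2)"
  shows "run B Walk s (n * n * 100) (\<lambda>s'. env s' (insert b (S - {a})) \<and>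
     (\<exists>Ds'. out s' Ds' \<and> trace Ds' (insert b (S - {a})) \<and> length Ds' + 1 \<le> length Ds + arr s 6 a))"
    (is "run B Walk s _ ?Q")
proof -
  let ?b = "Conj (is_adjacent 10 7) (precedes 7 10)"
  let ?body = "Seq (Find ?b) Step"
  define f where "f = arr s 6"
  note lv = f[folded f_def]
  have an: "a < n" using a(2) covers_subset[OF trace_last(1)[OF tr]] by auto
  define J where "J s' \<longleftrightarrow> reg s' 10 < n \<and> f (reg s' 10) \<noteq> 0 \<and> (\<exists>S' Ds' fr. S' - {fr} = S - {a} \<and>
     reg s' 11 = fr \<and> env s' S' \<and> out s' Ds' \<and> trace Ds' S' \<and>
     length Ds' + f (reg s' 10) \<le> length Ds + f a \<and> pushable S' fr (reg s' 10) f)" for s' :: state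
  define \<Phi> where "\<Phi> s' = f (reg s' 10) * (n * 90)" for s' :: state
  have loop: "run B (While (Less (Const 1) (Arr 6 (Reg 10))) ?body) s1
      (\<Phi> s1 + bcost (Less (Const 1) (Arr 6 (Reg 10))) + 1) ?Q"
    if s1: "bounded_state B s1" "same_except {10, 11} {} s s1" "J s1" for s1
  proof (rule run_while[where I = J])
    fix s' assume s': "bounded_state B s'" "J s'"
      and "same_except (written_regs ?body) (written_arrs ?body) s1 s'"
    then have sm: "same_except {3, 7, 8, 10, 11, 12} {1, 3} s s'"
      using s1(2) by (auto simp: same_except_def)
    have f': "arr s' 6 = f" using sm by (simp add: same_except_def f_def)
    define x where "x = reg s' 10"
    obtain S' Ds' fr where J: "S' - {fr} = S - {a}" "reg s' 11 = fr" "env s' S'" "out s' Ds'"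
        "trace Ds' S'" "length Ds' + f x \<le> length Ds + f a" "pushable S' fr x f"
      and x: "x < n" "f x \<noteq> 0"
      using s'(2) unfolding J_def x_def by blast
    show "bfits B (Less (Const 1) (Arr 6 (Reg 10))) s'" using s' by simp
    show "?Q s'" if "\<not> bval (Less (Const 1) (Arr 6 (Reg 10))) s'"
    proof -
      have "f x = 1" using that x(2) f' by (simp add: x_def)
      then have "x = b" using lv x(1) unfolding levels_def by blast
      \<comment> \<open>At the end \<open>b\<close> is occupied, but it was not in \<open>S\<close>;
        since apart from the free token nothing has changed, the free token must be on
        \<open>b\<close>.\<close>
      have "b \<in> S'" "fr \<in> S'" using J(7) \<open>x = b\<close> by (auto simp: pushable_def)
      then have "fr = b" using J(1) b(2) by blast
      then have "S' = insert b (S - {a})" using J(1) \<open>b \<in> S'\<close> by blast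
      then show ?thesis using J(3-6) \<open>f x = 1\<close> by (auto simp: f_def)
    qed
    assume "bval (Less (Const 1) (Arr 6 (Reg 10))) s'"
    then have fx: "1 < f x" using f' by (simp add: x_def)
    let ?P = "\<lambda>y. adj x y \<and> Suc (f y) = f x"
    note n' = envD(1)[OF J(3)]
    have find: "run B (Find ?b) s' (n * (bcost ?b + 11) + 8)
       (\<lambda>r. reg r 8 < n \<and> ?P (reg r 8) \<or> reg r 8 = n \<and> (\<forall>y<n. \<not> ?P y))"
    proof (rule run_Find[OF s'(1) n'])
      fix r y assume r: "y < n" "reg r 7 = y" "bounded_state B r" "same_except {7, 8} {} s' r"
      have er: "env r S'" by (rule env_same[OF J(3) r(4)]) auto
      have x10: "reg r 10 = x" and ar: "arr r 6 = f"
        using r(4) f' by (auto simp: same_except_def x_def)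
      have le: "\<And>v. v < n \<Longrightarrow> arr r 6 v \<le> n" using levels_le[OF lv] ar by simp
      show "bfits B ?b r \<and> (bval ?b r \<longleftrightarrow> ?P y)"
        using is_adjacent_eval[OF er r(3), of 10 7]
          precedes_eval[OF r(3) _ _ le, of 10 7] r(1,2) x10 ar x(1) by simp
    qed simp
    have ex: "\<exists>y<n. ?P y"
    proof -
      have "x \<noteq> b" using fx levels_source[OF lv] by auto
      then obtain u where "u < n" "adj u x" "Suc (f u) = f x"
        using levels_pred[OF lv x(1,2)] by blast
      then show ?thesis using adj_sym by blast
    qed
    define TT where "TT = (n * (bcost ?b + 11) + 8) + n * 41"
    have "run B ?body s' TT (\<lambda>s''. J s'' \<and> TT + bcost (Less (Const 1) (Arr 6 (Reg 10))) + 1 + \<Phi> s'' \<le> \<Phi> s')"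
      unfolding TT_def
    proof (rule run_seq[OF s'(1) find], fold TT_def)
      fix r assume r: "bounded_state B r" "same_except (written_regs (Find ?b)) (written_arrs (Find ?b)) s' r"
        "reg r 8 < n \<and> ?P (reg r 8) \<or> reg r 8 = n \<and> (\<forall>y<n. \<not> ?P y)"
      define y where "y = reg r 8"
      have y: "y < n" "adj x y" "Suc (f y) = f x" using r(3) ex by (auto simp: y_def)
      have er: "env r S'" by (rule env_same[OF J(3) r(2)]) auto
      have outr: "out r Ds'" by (rule out_same[OF J(4) r(2)]) auto
      have r11: "reg r 11 = fr" using r(2) J(2) by (simp add: same_except_def)
      have C': "covers (S' - {fr})" using C J(1) by simp
      have len': "length Ds' \<le> (n + 2) * (n + 2)" using J(6) len by (simp add: f_def)
      have fyx: "f y < f x" using y(3) by simp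
      have step: "run B Step r (n * 41) (\<lambda>s'. reg s' 10 = y \<and> (\<exists>S'' Ds'' fr'. S'' - {fr'} = S' - {fr} \<and>
         reg s' 11 = fr' \<and> env s' S'' \<and> out s' Ds'' \<and> trace Ds'' S'' \<and>
         length Ds'' \<le> Suc (length Ds') \<and> pushable S'' fr' y f))"
        by (rule run_Step[OF r(1) er outr J(5) len' y_def[symmetric] y(1,2) fyx J(7) r11 C'])
      show "run B Step r (n * 41)
        (\<lambda>s''. J s'' \<and> TT + bcost (Less (Const 1) (Arr 6 (Reg 10))) + 1 + \<Phi> s'' \<le> \<Phi> s')"
      proof (rule run_frame[OF r(1) step])
        fix q assume q: "reg q 10 = y \<and> (\<exists>S'' Ds'' fr'. S'' - {fr'} = S' - {fr} \<and>
         reg q 11 = fr' \<and> env q S'' \<and> out q Ds'' \<and> trace Ds'' S'' \<and>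
         length Ds'' \<le> Suc (length Ds') \<and> pushable S'' fr' y f)"
        then obtain S'' Ds'' where q': "reg q 10 = y" "S'' - {reg q 11} = S' - {fr}"
          "env q S''" "out q Ds''" "trace Ds'' S''" "length Ds'' \<le> Suc (length Ds')"
          "pushable S'' (reg q 11) y f" by blast
        have "f y \<noteq> 0" using fx y(3) by auto
        moreover have "length Ds'' + f y \<le> length Ds + f a" using q'(6) J(6) y(3) by linarith
        ultimately have "J q"
          unfolding J_def using q' y(1) J(1) by auto
        moreover have "\<Phi> s' = \<Phi> q + n * 90"
          unfolding \<Phi>_def x_def[symmetric] q'(1) y(3)[symmetric] by simp
        moreover have "TT + 5 \<le> n * 90" using n_pos by (simp add: TT_def)
        ultimately show "J q \<and> TT + bcost (Less (Const 1) (Arr 6 (Reg 10))) + 1 + \<Phi> q \<le> \<Phi> s'"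
          by simp
      qed
    qed
    then show "\<exists>T'. run B ?body s' T'
        (\<lambda>s''. J s'' \<and> T' + bcost (Less (Const 1) (Arr 6 (Reg 10))) + 1 + \<Phi> s'' \<le> \<Phi> s')"
      by blast
  qed (use s1 in auto)
  have "run B (Seq (Assign 10 (Reg 9)) (Assign 11 (Reg 9))) s 4
      (\<lambda>s'. s' = set_reg 11 a (set_reg 10 a s))"
    using bd a(1) by (intro run_straight) auto
  then have "run B Walk s (4 + (n * (n * 90) + 5)) ?Q"
    unfolding Walk_def
  proof (rule run_seq[OF bd])
    fix s1 assume s1: "bounded_state B s1" "s1 = set_reg 11 a (set_reg 10 a s)"
    have sm: "same_except {10, 11} {} s s1" using s1(2) by (simp add: same_except_def)
    have e1: "env s1 S" "out s1 Ds" by (rule env_same[OF env sm], auto) (rule out_same[OF out sm], auto)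
    have "pushable S a a f" by (rule pushable_refl[OF a(2)])
    then have "J s1" using s1(2) e1 tr an fa unfolding J_def f_def[symmetric] by auto
    note L = loop[OF s1(1) sm this]
    have "f a \<le> n" by (rule levels_le[OF lv an])
    then have "\<Phi> s1 \<le> n * (n * 90)"
      unfolding \<Phi>_def using s1(2) by (intro mult_right_mono) auto
    then show "run B (While (Less (Const 1) (Arr 6 (Reg 10))) ?body) s1 (n * (n * 90) + 5) ?Q"
      by (intro run_le[OF L]) simp
  qed
  moreover have "4 + (n * (n * 90) + 5) \<le> n * n * 100"
    using n_le_square(2) unfolding mult.assoc[symmetric] by linarith
  ultimately show ?thesis by (rule run_le)
qed

end

text \<open>\<open>bexp\<close> has only negation and conjunction, so the disjunction is expressed
  by De Morgan. The added 1 reflects that mates are stored shifted by one.\<close>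

definition is_alternating :: bexp where
  "is_alternating = Neg (Conj
     (Neg (Conj (is_source 4) (Conj (is_target 5) (is_adjacent 4 5))))
     (Neg (Conj (Equal (Arr 1 (Reg 4)) (Const 0)) (Equal (Arr 5 (Reg 4)) (Add (Reg 5) (Const 1))))))"

definition is_free_target :: bexp where
  "is_free_target = Conj (is_target 7) (Equal (Arr 5 (Reg 7)) (Const 0))"

definition Redirect :: com where
  "Redirect = Seq Release (Seq Emit (Seq (Find is_free_target)
     (Seq (Assign 14 (Reg 8)) (Seq (Bfs (is_adjacent 4 5)) Walk))))"

definition Phase :: com where
  "Phase = Seq (Assign 14 (Reg 9)) (Seq (Bfs is_alternating)
     (Seq (Find (Conj is_free_target (Less (Const 0) (Arr 6 (Reg 7)))))
       (Cond (Less (Reg 8) (Reg 0)) Augment Redirect)))"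

definition Adjacency :: com where
  "Adjacency = For 15 1 (For 4 0 (For 5 0
     (Cond (Conj (Equal (Arr 0 (Add (Mul (Reg 15) (Reg 0)) (Reg 4))) (Const 1))
                 (Equal (Arr 0 (Add (Mul (Reg 15) (Reg 0)) (Reg 5))) (Const 1)))
       (Store 4 (Add (Mul (Reg 4) (Reg 0)) (Reg 5)) (Const 1)) Skip)))"

definition Sweep :: com where
  "Sweep = For 9 0 (Cond (Conj (is_source 9) (Equal (Arr 5 (Reg 9)) (Const 0))) Phase Skip)"

definition Finish :: com where
  "Finish = Seq (For 15 0 (Store 1 (Reg 15) (Arr 2 (Reg 15)))) Emit"

definition Reconfigure :: com where
  "Reconfigure = Seq Adjacency (Seq Write_Row
     (Cond (Less (Const 1) (Reg 0)) (Seq Sweep Finish) Skip))"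

lemma written_Redirect [simp]:
  "written_regs Redirect = {3, 4, 5, 6, 7, 8, 10, 11, 12, 14, 15}" "written_arrs Redirect = {1, 3, 5, 6}"
  by (auto simp: Redirect_def)

lemma written_Phase [simp]:
  "written_regs Phase = {3, 4, 5, 6, 7, 8, 10, 11, 12, 13, 14, 15}" "written_arrs Phase = {1, 3, 5, 6}"
  by (auto simp: Phase_def)

lemma written_Adjacency [simp]: "written_regs Adjacency = {4, 5, 15}" "written_arrs Adjacency = {4}"
  by (auto simp: Adjacency_def)

lemma row_major_inj:
  assumes "u * n + v = u' * n + v'" "v < n" "v' < (n :: nat)"
  shows "u = u' \<and> v = v'"
proof -
  have "u = (u * n + v) div n" using assms(2) by simp
  also have "\<dots> = u'" unfolding assms(1) using assms(3) by simp
  finally have "u = u'" .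
  then show ?thesis using assms(1) by simp
qed

context instance_ram
begin

lemma bcost_search [simp]: "bcost is_alternating = 35" "bcost is_free_target = 10"
  by (simp_all add: is_alternating_def is_free_target_def)

lemma is_free_target_eval:
  assumes "env s S" "bounded_state B s" "reg s 7 < n"
  shows "bfits B is_free_target s"
    "bval is_free_target s \<longleftrightarrow> reg s 7 \<in> T - S \<and> arr s 5 (reg s 7) = 0"
  using is_target_eval[OF assms] assms(2) by (auto simp: is_free_target_def)

lemma is_alternating_eval:
  assumes "env s S" "bounded_state B s" "reg s 4 < n" "reg s 5 < n"
  shows "bfits B is_alternating s"
    "bval is_alternating s \<longleftrightarrow> alternating (arr s 5) S T (reg s 4) (reg s 5)"
  using is_source_eval[OF assms(1-3)] is_target_eval[OF assms(1,2,4)] is_adjacent_eval[OF assms]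
    assms(2) envD(2)[OF assms(1,3)] fits_linear[of "Suc (reg s 5)"] assms(4)
  by (auto simp: is_alternating_def alternating_def)

text \<open>\<open>a\<close> leaves \<open>S - T\<close> because its token ends on a vertex of
  \<open>T\<close>. Mates are erased only inside \<open>X\<close>, and no vertex of \<open>X\<close>
  remains in the new \<open>S - T\<close>. The level of \<open>a\<close> is bounded both by
  \<open>d + 1\<close>, for the number of moves, and by \<open>n\<close>, for the output addresses;
  hence \<open>min d n\<close>.\<close>

lemma run_Redirect:
  assumes bd: "bounded_state B s" and env: "env s S" and out: "out s Ds" and tr: "trace Ds S"
    and M: "matching (arr s 5) S T" and a: "reg s 9 = a" "a \<in> S - T" "arr s 5 a = 0"
    and f: "levels n (alternating (arr s 5) S T) a (arr s 6)"
    and full: "\<forall>b\<in>T - S. arr s 6 b \<noteq> 0 \<longrightarrow> arr s 5 b \<noteq> 0"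
    and len: "length Ds \<le> n * n + 1"
  shows "run B Redirect s (n * n * 410) (\<lambda>s'. \<exists>S' Ds'. env s' S' \<and> out s' Ds' \<and> trace Ds' S' \<and>
     matching (arr s' 5) S' T \<and> S' - T \<subseteq> S - T - {a} \<and>
     (\<forall>v\<in>S' - T. arr s 5 v \<noteq> 0 \<longrightarrow> arr s' 5 v \<noteq> 0) \<and> length Ds' \<le> length Ds + min d n + 1)"
    (is "run B Redirect s _ ?Q")
proof -
  define X where "X = {v. v < n \<and> arr s 6 v \<noteq> 0 \<and> v \<noteq> reg s 9}"
  define S1 where "S1 = (S - X) \<union> (X - S)"
  define mt where "mt = (\<lambda>v. if v \<in> X then 0 else arr s 5 v)"
  have Xa: "X = {v. v < n \<and> arr s 6 v \<noteq> 0 \<and> v \<noteq> a}" using X_def a(1) by simp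
  note rel = release_token[OF trace_last(1)[OF tr] T(1) M a(2,3) f full Xa S1_def mt_def]
  have an: "a < n" using a(2) covers_subset[OF trace_last(1)[OF tr]] by auto
  have cv1: "covers S1" by (rule covers_mono[OF rel(2)]) (use rel(3) in auto)
  define Ds1 where "Ds1 = Ds @ [S1]"
  have tr1: "trace Ds1 S1" unfolding Ds1_def by (rule trace_snoc[OF tr rel(1) cv1])
  \<comment> \<open>The surplus over \<open>n * n + 1\<close> has room for the row of the release
    and up to \<open>n\<close> rows of the walk.\<close>
  have "(n + 2) * (n + 2) = n * n + 4 * n + 4" by (simp add: algebra_simps)
  then have len0: "length Ds \<le> (n + 2) * (n + 2)" and len1: "length Ds1 + n \<le> (n + 2) * (n + 2)"
    using len by (auto simp: Ds1_def)
  have p1: "run B Release s (n * 40) (\<lambda>s'. env s' S1 \<and> arr s' 5 = mt)"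
    unfolding S1_def mt_def by (rule run_Release[OF bd env X_def])
  have "run B Redirect s (n * 40 + (n * 26 + ((n * 21 + 8) + (2 + (n * n * 208 + n * n * 100))))) ?Q"
    unfolding Redirect_def
  proof (rule run_seq[OF bd p1])
    fix s1 assume s1: "bounded_state B s1" "same_except (written_regs Release) (written_arrs Release) s s1"
      "env s1 S1 \<and> arr s1 5 = mt"
    have o1: "out s1 Ds" by (rule out_same[OF out s1(2)]) auto
    have r1: "reg s1 9 = a" using s1(2) a(1) by (simp add: same_except_def)
    have e1: "env s1 S1" using s1(3) by simp
    have p2: "run B Emit s1 (n * 26) (\<lambda>s'. out s' Ds1)"
      unfolding Ds1_def
      by (rule run_Emit[OF s1(1) envD(1)[OF e1] _ o1 len0]) (use envD(2)[OF e1] in blast)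
    show "run B (Seq Emit (Seq (Find is_free_target)
     (Seq (Assign 14 (Reg 8)) (Seq (Bfs (is_adjacent 4 5)) Walk)))) s1
     (n * 26 + ((n * 21 + 8) + (2 + (n * n * 208 + n * n * 100)))) ?Q"
    proof (rule run_seq[OF s1(1) p2])
      fix s2 assume s2: "bounded_state B s2" "same_except (written_regs Emit) (written_arrs Emit) s1 s2"
        "out s2 Ds1"
      have e2: "env s2 S1" by (rule env_same[OF e1 s2(2)]) auto
      have r2: "reg s2 9 = a" "arr s2 5 = mt" using s2(2) s1(3) r1 by (auto simp: same_except_def)
      let ?P = "\<lambda>y. y \<in> T - S1 \<and> mt y = 0"
      \<comment> \<open>After the release \<open>a\<close> is still occupied and unmatched outside
        \<open>T\<close>, so the counting argument applies to \<open>S1\<close>.\<close>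
      have ex: "\<exists>y<n. ?P y"
      proof (rule exists_unmatched[OF cv1 T(1) _ rel(5)])
        show "card S1 = card T" using trace_last(2)[OF tr1] T(2) by simp
        show "a \<in> S1 - T" using rel(4) a(2) by simp
      qed (rule rel(7))
      have p3: "run B (Find is_free_target) s2 (n * (bcost is_free_target + 11) + 8)
         (\<lambda>r. reg r 8 < n \<and> ?P (reg r 8) \<or> reg r 8 = n \<and> (\<forall>y<n. \<not> ?P y))"
      proof (rule run_Find[OF s2(1) envD(1)[OF e2]])
        fix r y assume r: "y < n" "reg r 7 = y" "bounded_state B r" "same_except {7, 8} {} s2 r"
        have er: "env r S1" by (rule env_same[OF e2 r(4)]) auto
        have "arr r 5 = mt" using r(4) r2 by (simp add: same_except_def)
        then show "bfits B is_free_target r \<and> (bval is_free_target r \<longleftrightarrow> ?P y)"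
          using is_free_target_eval[OF er r(3)] r(1,2) by simp
      qed simp
      then have p3': "run B (Find is_free_target) s2 (n * 21 + 8)
         (\<lambda>r. reg r 8 < n \<and> ?P (reg r 8) \<or> reg r 8 = n \<and> (\<forall>y<n. \<not> ?P y))" by simp
      show "run B (Seq (Find is_free_target) (Seq (Assign 14 (Reg 8)) (Seq (Bfs (is_adjacent 4 5)) Walk))) s2
         ((n * 21 + 8) + (2 + (n * n * 208 + n * n * 100))) ?Q"
      proof (rule run_seq[OF s2(1) p3'])
        fix s3 assume s3: "bounded_state B s3"
          "same_except (written_regs (Find is_free_target)) (written_arrs (Find is_free_target)) s2 s3"
          "reg s3 8 < n \<and> ?P (reg s3 8) \<or> reg s3 8 = n \<and> (\<forall>y<n. \<not> ?P y)"
        define b where "b = reg s3 8"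
        have b: "b < n" "b \<in> T - S1" "mt b = 0" using s3(3) ex by (auto simp: b_def)
        have p4: "run B (Assign 14 (Reg 8)) s3 2 (\<lambda>s'. s' = set_reg 14 b s3)"
          using s3(1) b_def by (intro run_straight) auto
        show "run B (Seq (Assign 14 (Reg 8)) (Seq (Bfs (is_adjacent 4 5)) Walk)) s3
           (2 + (n * n * 208 + n * n * 100)) ?Q"
        proof (rule run_seq[OF s3(1) p4])
          fix s4 assume s4: "bounded_state B s4" "s4 = set_reg 14 b s3"
          have sm4: "same_except {7, 8, 14} {} s2 s4" using s3(2) s4(2) by (auto simp: same_except_def)
          have e4: "env s4 S1" by (rule env_same[OF e2 sm4]) auto
          have p5: "run B (Bfs (is_adjacent 4 5)) s4 (n * n * (bcost (is_adjacent 4 5) + 200))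
             (\<lambda>s'. levels n adj b (arr s' 6))"
          proof (rule run_Bfs[OF s4(1) envD(1)[OF e4]])
            show "reg s4 14 = b" "b < n" using s4(2) b by auto
            show "n + 2 < B" by (rule fits_linear) simp
            fix r u v assume r: "u < n" "v < n" "reg r 4 = u" "reg r 5 = v" "bounded_state B r"
              "same_except {4, 5, 6} {6} s4 r"
            have "env r S1" by (rule env_same[OF e4 r(6)]) auto
            from is_adjacent_eval[OF this r(5), of 4 5] r(1-4)
            show "bfits B (is_adjacent 4 5) r \<and> (bval (is_adjacent 4 5) r \<longleftrightarrow> adj u v)" by simp
          qed
          then have p5': "run B (Bfs (is_adjacent 4 5)) s4 (n * n * 208)
             (\<lambda>s'. levels n adj b (arr s' 6))" by simp
          show "run B (Seq (Bfs (is_adjacent 4 5)) Walk) s4 (n * n * 208 + n * n * 100) ?Q"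
          proof (rule run_seq[OF s4(1) p5'])
            fix s5 assume s5: "bounded_state B s5" "levels n adj b (arr s5 6)"
              "same_except (written_regs (Bfs (is_adjacent 4 5))) (written_arrs (Bfs (is_adjacent 4 5))) s4 s5"
            have e5: "env s5 S1" by (rule env_same[OF e4 s5(3)]) auto
            have o5: "out s5 Ds1"
              by (rule out_same[OF out_same[OF s2(3) sm4] s5(3)]) auto
            have r5: "reg s5 9 = a" "arr s5 5 = mt"
              using s5(3) sm4 r2 by (auto simp: same_except_def)
            obtain L where "L \<le> d" "(b, a) \<in> {(u, v). u < n \<and> v < n \<and> adj u v} ^^ L"
              using dist[OF b(1) an] by blast
            then have fa: "arr s5 6 a \<noteq> 0" "arr s5 6 a \<le> Suc d"
              using levels_relpow[OF s5(2), of a L] by auto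
            have fan: "arr s5 6 a \<le> n" by (rule levels_le[OF s5(2) an])
            then have len5: "length Ds1 + arr s5 6 a \<le> (n + 2) * (n + 2)" using len1 by simp
            let ?S2 = "insert b (S1 - {a})"
            have "run B Walk s5 (n * n * 100) (\<lambda>s'. env s' ?S2 \<and>
                (\<exists>Ds'. out s' Ds' \<and> trace Ds' ?S2 \<and> length Ds' + 1 \<le> length Ds1 + arr s5 6 a))"
              by (rule run_Walk[OF s5(1) e5 o5 tr1 r5(1) rel(4) s5(2) b(1) _ rel(2) fa(1) len5])
                (use b(2) in simp)
            then show "run B Walk s5 (n * n * 100) ?Q"
            proof (rule run_frame[OF s5(1)])
              fix s' assume s': "same_except (written_regs Walk) (written_arrs Walk) s5 s'"
                "env s' ?S2 \<and> (\<exists>Ds'. out s' Ds' \<and> trace Ds' ?S2 \<and> length Ds' + 1 \<le> length Ds1 + arr s5 6 a)"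
              then obtain Ds' where Ds': "out s' Ds'" "trace Ds' ?S2"
                "length Ds' + 1 \<le> length Ds1 + arr s5 6 a" by blast
              have m': "arr s' 5 = mt" using s'(1) r5 by (simp add: same_except_def)
              have "matching mt ?S2 T" by (rule matching_after_walk[OF rel(5,7) b(3)])
              moreover have sub: "?S2 - T \<subseteq> S1 - T - {a}" using b(2) by blast
              then have "?S2 - T \<subseteq> S - T - {a}" using rel(6) by blast
              moreover have "mt v \<noteq> 0" if v: "v \<in> ?S2 - T" "arr s 5 v \<noteq> 0" for v
              proof -
                have "v \<notin> X" using v(1) sub rel(6) by blast
                then show ?thesis using v(2) by (simp add: mt_def)
              qed
              moreover have "length Ds' \<le> length Ds + min d n + 1" using Ds'(3) fa(2) fan by (simp add: Ds1_def)
              ultimately show "?Q s'"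
                using s'(2) Ds'(1,2) m' by (intro exI[of _ ?S2] exI[of _ Ds']) auto
            qed
          qed
        qed
      qed
    qed
  qed
  moreover have "n * 40 + (n * 26 + ((n * 21 + 8) + (2 + (n * n * 208 + n * n * 100))))
      \<le> n * n * 410"
    using n_le_square by linarith
  ultimately show ?thesis by (rule run_le)
qed

text \<open>Both branches settle \<open>a\<close>: an augmentation matches it, a redirection removes
  it from \<open>S - T\<close>, where the clause for \<open>v = a\<close> becomes vacuous.\<close>

lemma run_Phase:
  assumes bd: "bounded_state B s" and env: "env s S" and out: "out s Ds" and tr: "trace Ds S"
    and M: "matching (arr s 5) S T" and a: "reg s 9 = a" "a \<in> S - T" "arr s 5 a = 0"
    and len: "length Ds \<le> n * n + 1"
  shows "run B Phase s (n * n * 700) (\<lambda>s'. \<exists>S' Ds'. env s' S' \<and> out s' Ds' \<and> trace Ds' S' \<and>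
     matching (arr s' 5) S' T \<and> S' - T \<subseteq> S - T \<and>
     (\<forall>v\<in>S' - T. v = a \<or> arr s 5 v \<noteq> 0 \<longrightarrow> arr s' 5 v \<noteq> 0) \<and> length Ds' \<le> length Ds + min d n + 1)"
    (is "run B Phase s _ ?Q")
proof -
  let ?b = "Conj is_free_target (Less (Const 0) (Arr 6 (Reg 7)))"
  have sub: "S \<subseteq> {..<n}" using covers_subset[OF trace_last(1)[OF tr]] .
  have an: "a < n" using a(2) sub by auto
  have p1: "run B (Assign 14 (Reg 9)) s 2 (\<lambda>s'. s' = set_reg 14 a s)"
    using bd a(1) by (intro run_straight) auto
  have "run B Phase s (2 + (n * n * 235 + ((n * 26 + 8) +
      (1 + bcost (Less (Reg 8) (Reg 0)) + n * n * 410)))) ?Q"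
    unfolding Phase_def
  proof (rule run_seq[OF bd p1])
    fix s1 assume s1: "bounded_state B s1" "s1 = set_reg 14 a s"
    have sm1: "same_except {14} {} s s1" using s1(2) by (simp add: same_except_def)
    have e1: "env s1 S" by (rule env_same[OF env sm1]) auto
    have p2: "run B (Bfs is_alternating) s1 (n * n * (bcost is_alternating + 200))
       (\<lambda>s'. levels n (alternating (arr s 5) S T) a (arr s' 6))"
    proof (rule run_Bfs[OF s1(1) envD(1)[OF e1]])
      show "reg s1 14 = a" "a < n" using s1(2) an by auto
      show "n + 2 < B" by (rule fits_linear) simp
      fix r u v assume r: "u < n" "v < n" "reg r 4 = u" "reg r 5 = v" "bounded_state B r"
        "same_except {4, 5, 6} {6} s1 r"
      have "env r S" by (rule env_same[OF e1 r(6)]) auto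
      moreover have "arr r 5 = arr s 5" using r(6) s1(2) by (simp add: same_except_def)
      ultimately show "bfits B is_alternating r \<and>
          (bval is_alternating r \<longleftrightarrow> alternating (arr s 5) S T u v)"
        using is_alternating_eval[of r S] r by simp
    qed
    then have p2': "run B (Bfs is_alternating) s1 (n * n * 235)
       (\<lambda>s'. levels n (alternating (arr s 5) S T) a (arr s' 6))" by simp
    show "run B (Seq (Bfs is_alternating) (Seq (Find ?b) (Cond (Less (Reg 8) (Reg 0)) Augment Redirect))) s1
       (n * n * 235 + ((n * 26 + 8) + (1 + bcost (Less (Reg 8) (Reg 0)) + n * n * 410))) ?Q"
    proof (rule run_seq[OF s1(1) p2'])
      fix s2 assume s2: "bounded_state B s2" "levels n (alternating (arr s 5) S T) a (arr s2 6)"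
        "same_except (written_regs (Bfs is_alternating)) (written_arrs (Bfs is_alternating)) s1 s2"
      have sm2: "same_except {4, 5, 6, 14} {6} s s2" using s2(3) sm1 by (simp add: same_except_def)
      have e2: "env s2 S" by (rule env_same[OF env sm2]) auto
      have m2: "arr s2 5 = arr s 5" using sm2 by (simp add: same_except_def)
      let ?P = "\<lambda>y. y \<in> T - S \<and> arr s 5 y = 0 \<and> arr s2 6 y \<noteq> 0"
      have p3: "run B (Find ?b) s2 (n * (bcost ?b + 11) + 8)
         (\<lambda>r. reg r 8 < n \<and> ?P (reg r 8) \<or> reg r 8 = n \<and> (\<forall>y<n. \<not> ?P y))"
      proof (rule run_Find[OF s2(1) envD(1)[OF e2]])
        fix r y assume r: "y < n" "reg r 7 = y" "bounded_state B r" "same_except {7, 8} {} s2 r"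
        have er: "env r S" by (rule env_same[OF e2 r(4)]) auto
        have "arr r 5 = arr s 5" "arr r 6 = arr s2 6" using r(4) m2 by (auto simp: same_except_def)
        then show "bfits B ?b r \<and> (bval ?b r \<longleftrightarrow> ?P y)"
          using is_free_target_eval[OF er r(3)] r(1-3) bounded_arr[OF r(3), of 6 y] by auto
      qed simp
      then have p3': "run B (Find ?b) s2 (n * 26 + 8)
         (\<lambda>r. reg r 8 < n \<and> ?P (reg r 8) \<or> reg r 8 = n \<and> (\<forall>y<n. \<not> ?P y))" by simp
      show "run B (Seq (Find ?b) (Cond (Less (Reg 8) (Reg 0)) Augment Redirect)) s2
         ((n * 26 + 8) + (1 + bcost (Less (Reg 8) (Reg 0)) + n * n * 410)) ?Q"
      proof (rule run_seq[OF s2(1) p3'])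
        fix s3 assume s3: "bounded_state B s3"
          "same_except (written_regs (Find ?b)) (written_arrs (Find ?b)) s2 s3"
          "reg s3 8 < n \<and> ?P (reg s3 8) \<or> reg s3 8 = n \<and> (\<forall>y<n. \<not> ?P y)"
        have e3: "env s3 S" by (rule env_same[OF e2 s3(2)]) auto
        have r3: "reg s3 9 = a" "arr s3 5 = arr s 5" "arr s3 6 = arr s2 6"
          using s3(2) sm2 a(1) by (auto simp: same_except_def)
        have o3: "out s3 Ds" by (rule out_same[OF out_same[OF out sm2] s3(2)]) auto
        show "run B (Cond (Less (Reg 8) (Reg 0)) Augment Redirect) s3
           (1 + bcost (Less (Reg 8) (Reg 0)) + n * n * 410) ?Q"
        proof (rule run_cond)
          show "bfits B (Less (Reg 8) (Reg 0)) s3" using s3(1) by simp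
        next
          assume "bval (Less (Reg 8) (Reg 0)) s3"
          then have c: "reg s3 8 < n" "?P (reg s3 8)" using s3(3) envD(1)[OF e3] by auto
          have "run B Augment s3 (n * n * 80) (\<lambda>s'. matching (arr s' 5) S T \<and> arr s' 5 a \<noteq> 0 \<and>
             (\<forall>v\<in>S - T. arr s3 5 v \<noteq> 0 \<longrightarrow> arr s' 5 v \<noteq> 0))"
            by (rule run_Augment[OF s3(1) e3 sub]) (use M a s2(2) c r3 in auto)
          then have "run B Augment s3 (n * n * 80) ?Q"
          proof (rule run_frame[OF s3(1)])
            fix s' assume s': "same_except (written_regs Augment) (written_arrs Augment) s3 s'"
              "matching (arr s' 5) S T \<and> arr s' 5 a \<noteq> 0 \<and>
               (\<forall>v\<in>S - T. arr s3 5 v \<noteq> 0 \<longrightarrow> arr s' 5 v \<noteq> 0)"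
            have "env s' S" by (rule env_same[OF e3 s'(1)]) auto
            moreover have "out s' Ds" by (rule out_same[OF o3 s'(1)]) auto
            ultimately show "?Q s'"
              using s'(2) tr r3(2) by (intro exI[of _ S] exI[of _ Ds]) auto
          qed
          then show "run B Augment s3 (n * n * 410) ?Q" by (rule run_le) simp
        next
          assume "\<not> bval (Less (Reg 8) (Reg 0)) s3"
          then have "\<forall>y<n. \<not> ?P y" using s3(3) envD(1)[OF e3] by auto
          then have c: "\<forall>y\<in>T - S. arr s2 6 y \<noteq> 0 \<longrightarrow> arr s 5 y \<noteq> 0"
            using covers_subset[OF T(1)] by auto
          have "run B Redirect s3 (n * n * 410) (\<lambda>s'. \<exists>S' Ds'. env s' S' \<and> out s' Ds' \<and> trace Ds' S' \<and>
             matching (arr s' 5) S' T \<and> S' - T \<subseteq> S - T - {a} \<and>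
             (\<forall>v\<in>S' - T. arr s3 5 v \<noteq> 0 \<longrightarrow> arr s' 5 v \<noteq> 0) \<and> length Ds' \<le> length Ds + min d n + 1)"
            by (rule run_Redirect[OF s3(1) e3 o3 tr]) (use M a s2(2) c r3 len in auto)
          then show "run B Redirect s3 (n * n * 410) ?Q"
          proof (rule run_frame[OF s3(1)])
            fix s' assume "\<exists>S' Ds'. env s' S' \<and> out s' Ds' \<and> trace Ds' S' \<and>
             matching (arr s' 5) S' T \<and> S' - T \<subseteq> S - T - {a} \<and>
             (\<forall>v\<in>S' - T. arr s3 5 v \<noteq> 0 \<longrightarrow> arr s' 5 v \<noteq> 0) \<and> length Ds' \<le> length Ds + min d n + 1"
            then obtain S' Ds' where "env s' S'" "out s' Ds'" "trace Ds' S'"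
              "matching (arr s' 5) S' T" "S' - T \<subseteq> S - T - {a}"
              "\<forall>v\<in>S' - T. arr s3 5 v \<noteq> 0 \<longrightarrow> arr s' 5 v \<noteq> 0" "length Ds' \<le> length Ds + min d n + 1"
              by blast
            then show "?Q s'"
              using r3(2) by (intro exI[of _ S'] exI[of _ Ds']) auto
          qed
        qed
      qed
    qed
  qed
  moreover have "2 + (n * n * 235 + ((n * 26 + 8) +
      (1 + bcost (Less (Reg 8) (Reg 0)) + n * n * 410))) \<le> n * n * 700"
    unfolding bcost.simps acost.simps using n_le_square by linarith
  ultimately show ?thesis by (rule run_le)
qed

end

section \<open>Adjacency matrix, sweep over all vertices and total cost\<close>

context instance_ram
begin

lemma run_Adjacency:
  assumes bd: "bounded_state B s" and n: "reg s 0 = n" and m: "reg s 1 = m"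
    and inc: "\<And>e u. e < m \<Longrightarrow> u < n \<Longrightarrow> arr s 0 (e * n + u) = of_bool (inc e u)"
    and zero: "arr s 4 = (\<lambda>_. 0)"
  shows "run B Adjacency s (m * (n * (n * 33 + 14) + 14) + 6)
    (\<lambda>s'. \<forall>u<n. \<forall>v<n. arr s' 4 (u * n + v) = of_bool (adj u v))"
proof -
  let ?b = "Conj (Equal (Arr 0 (Add (Mul (Reg 15) (Reg 0)) (Reg 4))) (Const 1))
                 (Equal (Arr 0 (Add (Mul (Reg 15) (Reg 0)) (Reg 5))) (Const 1))"
  let ?c = "Cond ?b (Store 4 (Add (Mul (Reg 4) (Reg 0)) (Reg 5)) (Const 1)) Skip"
  \<comment> \<open>The pairs recorded when the triple loop stands at hyperedge \<open>e\<close>,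
    row \<open>i\<close>, column \<open>j\<close>: earlier hyperedges count completely, the current
    one up to the lexicographic position.\<close>
  define P where "P e i j u v \<longleftrightarrow> (\<exists>e'<e. inc e' u \<and> inc e' v) \<or>
     (u < i \<or> u = i \<and> v < j) \<and> inc e u \<and> inc e v" for e i j u v
  define I where "I e i j s' \<longleftrightarrow> (\<forall>u<n. \<forall>v<n. arr s' 4 (u * n + v) = of_bool (P e i j u v))"
    for e i j and s' :: state
  have I_set: "I e i j (set_reg x y s') \<longleftrightarrow> I e i j s'" for e i j x y s'
    by (simp add: I_def)
  have inner: "run B (For 5 0 ?c) s' (n * 33 + 6) (I e (Suc i) 0)"
    if s': "bounded_state B s'" "same_except {4, 5, 15} {4} s s'" "reg s' 15 = e" "e < m"
      "reg s' 4 = i" "i < n" "I e i 0 s'" for s' e i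
  proof -
    have n': "reg s' 0 = n" using s'(2) n by (simp add: same_except_def)
    have "run B (For 5 0 ?c) s' (reg s' 0 * (25 + 8) + 6) (I e (Suc i) 0)"
    proof (rule run_For[where I = "I e i"])
      show "I e i 0 (set_reg 5 0 s')" using s'(7) by (simp add: I_def)
      fix j r assume r: "j < reg s' 0" "reg r 5 = j" "bounded_state B r"
        "same_except (insert 5 (written_regs ?c)) (written_arrs ?c) s' r" "I e i j r"
      have j: "j < n" using r(1) n' by simp
      have er: "reg r 0 = n" "reg r 15 = e" "reg r 4 = i" "arr r 0 = arr s 0"
        using r(4) s'(2,3,5) n' by (auto simp: same_except_def)
      have fit: "e * n + i < B" "e * n + j < B" "e * n < B" "i * n + j < B" "i * n < B"
        "e < B" "i < B" "j < B" "n < B"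
        using fits_index[of e i] fits_index[of e j] fits_index[of i j] s'(4,6) j
          fits_linear[of n] fits_linear[of i] fits_linear[of j] bounded_reg[OF s'(1), of 15] s'(3)
        by auto
      note ie = inc[OF s'(4,6)] and je = inc[OF s'(4) j]
      \<comment> \<open>Row-major positions determine row and column, so the store affects the
        single pair \<open>i\<close>, \<open>j\<close>.\<close>
      have idx: "u * n + v = i * n + j \<longleftrightarrow> u = i \<and> v = j" if "v < n" for u v
        using row_major_inj[of u n v i j] that j by auto
      have Pj: "P e i (Suc j) u v \<longleftrightarrow> P e i j u v \<or> u = i \<and> v = j \<and> inc e i \<and> inc e j" for u v
        by (auto simp: P_def less_Suc_eq)
      have old: "\<And>u v. u < n \<Longrightarrow> v < n \<Longrightarrow> arr r 4 (u * n + v) = of_bool (P e i j u v)"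
        using r(5) by (simp add: I_def)
      have fits: "bfits B ?b r"
        using er fit ie je r(2) by simp
      have val: "bval ?b r \<longleftrightarrow> inc e i \<and> inc e j"
        using er ie je r(2) by simp
      have yes: "I e i (Suc j) (set_reg 5 (Suc j) (set_arr 4 (i * n + j) 1 r))" if "inc e i" "inc e j"
        unfolding I_def using that old idx Pj by simp
      have no: "I e i (Suc j) (set_reg 5 (Suc j) r)" if "\<not> (inc e i \<and> inc e j)"
        unfolding I_def using that old Pj by auto
      have "wp B ?c r (\<lambda>s''. I e i (Suc j) (set_reg 5 (Suc j) s''))"
        unfolding wp.simps val using fits yes no er fit r(2) by simp
      then show "run B ?c r 25 (\<lambda>s''. I e i (Suc j) (set_reg 5 (Suc j) s''))"
        by (intro run_straight) auto
    next
      fix r assume "I e i (reg s' 0) r"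
      then show "I e (Suc i) 0 r" unfolding n' by (auto simp: I_def P_def less_Suc_eq)
    qed (use s'(1) in auto)
    then show ?thesis unfolding n' by (rule run_le) simp
  qed
  have middle: "run B (For 4 0 (For 5 0 ?c)) s' (n * (n * 33 + 14) + 6) (I (Suc e) 0 0)"
    if s': "bounded_state B s'" "same_except {4, 5, 15} {4} s s'" "reg s' 15 = e" "e < m"
      "I e 0 0 s'" for s' e
  proof -
    have n': "reg s' 0 = n" using s'(2) n by (simp add: same_except_def)
    have "run B (For 4 0 (For 5 0 ?c)) s' (reg s' 0 * ((n * 33 + 6) + 8) + 6) (I (Suc e) 0 0)"
    proof (rule run_For[where I = "\<lambda>i. I e i 0"])
      show "I e 0 0 (set_reg 4 0 s')" using s'(5) by (simp add: I_def)
      fix i r assume r: "i < reg s' 0" "reg r 4 = i" "bounded_state B r"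
        "same_except (insert 4 (written_regs (For 5 0 ?c))) (written_arrs (For 5 0 ?c)) s' r" "I e i 0 r"
      have "run B (For 5 0 ?c) r (n * 33 + 6) (I e (Suc i) 0)"
        by (rule inner) (use r s' n' in \<open>auto simp: same_except_def\<close>)
      then show "run B (For 5 0 ?c) r (n * 33 + 6) (\<lambda>s''. I e (Suc i) 0 (set_reg 4 (Suc i) s''))"
        unfolding I_set .
    next
      fix r assume "I e (reg s' 0) 0 r"
      then show "I (Suc e) 0 0 r" unfolding n' by (auto simp: I_def P_def less_Suc_eq)
    qed (use s'(1) in auto)
    then show ?thesis unfolding n' by (rule run_le) simp
  qed
  have "run B Adjacency s (reg s 1 * ((n * (n * 33 + 14) + 6) + 8) + 6) (I m 0 0)"
    unfolding Adjacency_def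
  proof (rule run_For[where I = "\<lambda>e. I e 0 0"])
    show "I 0 0 0 (set_reg 15 0 s)" using zero by (simp add: I_def P_def)
    fix e r assume r: "e < reg s 1" "reg r 15 = e" "bounded_state B r"
      "same_except (insert 15 (written_regs (For 4 0 (For 5 0 ?c)))) (written_arrs (For 4 0 (For 5 0 ?c))) s r"
      "I e 0 0 r"
    have "run B (For 4 0 (For 5 0 ?c)) r (n * (n * 33 + 14) + 6) (I (Suc e) 0 0)"
      by (rule middle) (use r m in \<open>auto simp: same_except_def\<close>)
    then show "run B (For 4 0 (For 5 0 ?c)) r (n * (n * 33 + 14) + 6)
       (\<lambda>s''. I (Suc e) 0 0 (set_reg 15 (Suc e) s''))"
      unfolding I_set .
  qed (use bd m in auto)
  then have "run B Adjacency s (m * (n * (n * 33 + 14) + 14) + 6) (I m 0 0)"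
    unfolding m by (rule run_le) simp
  then show ?thesis
  proof (rule run_frame[OF bd])
    fix r assume "I m 0 0 r"
    then show "\<forall>u<n. \<forall>v<n. arr r 4 (u * n + v) = of_bool (adj u v)"
      by (auto simp: I_def P_def adj_def)
  qed
qed

text \<open>A vertex settled in an earlier round needs no second visit: \<open>S - T\<close> gains
  no vertices, and those that remain keep a mate. Hence after round \<open>a\<close> all vertices of
  \<open>S - T\<close> up to \<open>a\<close> are matched.\<close>

lemma run_Sweep:
  assumes bd: "bounded_state B s" and env: "env s S0" and out: "out s [S0]" and zero: "arr s 5 = (\<lambda>_. 0)"
  shows "run B Sweep s (n * (n * n * 700 + 19) + 6) (\<lambda>s'. \<exists>S Ds. env s' S \<and> out s' Ds \<and> trace Ds S \<and>
     matching (arr s' 5) S T \<and> (\<forall>v\<in>S - T. arr s' 5 v \<noteq> 0) \<and> length Ds \<le> 1 + n * (min d n + 1))"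
    (is "run B Sweep s _ ?Q")
proof -
  let ?b = "Conj (is_source 9) (Equal (Arr 5 (Reg 9)) (Const 0))"
  let ?c = "Cond ?b Phase Skip"
  define I where "I i s' \<longleftrightarrow> (\<exists>S Ds. env s' S \<and> out s' Ds \<and> trace Ds S \<and>
     matching (arr s' 5) S T \<and> (\<forall>v\<in>S - T. v < i \<longrightarrow> arr s' 5 v \<noteq> 0) \<and>
     length Ds \<le> 1 + i * (min d n + 1))" for i s'
  have I_set: "I i (set_reg 9 j s') \<longleftrightarrow> I i s'" for i j s'
    by (simp add: I_def env_def out_def)
  note n = envD(1)[OF env]
  have "run B Sweep s (reg s 0 * ((n * n * 700 + 11) + 8) + 6) ?Q"
    unfolding Sweep_def
  proof (rule run_For[where I = I])
    have "matching (arr s 5) S0 T" using zero by (simp add: matching_def)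
    then show "I 0 (set_reg 9 0 s)"
      unfolding I_set unfolding I_def using env out trace_init
      by (intro exI[of _ S0] exI[of _ "[S0]"]) auto
    fix a s' assume s': "a < reg s 0" "reg s' 9 = a" "bounded_state B s'" "I a s'"
    have an: "a < n" using s'(1) n by simp
    obtain S Ds where I: "env s' S" "out s' Ds" "trace Ds S" "matching (arr s' 5) S T"
        "\<forall>v\<in>S - T. v < a \<longrightarrow> arr s' 5 v \<noteq> 0" "length Ds \<le> 1 + a * (min d n + 1)"
      using s'(4) unfolding I_def by blast
    have "run B ?c s' (1 + bcost ?b + n * n * 700) (I (Suc a))"
    proof (rule run_cond)
      show "bfits B ?b s'" using is_source_eval[OF I(1) s'(3), of 9] s'(2,3) an by auto
    next
      assume "bval ?b s'"
      then have a: "a \<in> S - T" "arr s' 5 a = 0"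
        using is_source_eval[OF I(1) s'(3), of 9] s'(2) an by auto
      \<comment> \<open>Each earlier round adds at most \<open>n + 1\<close> rows, and
        \<open>a < n\<close> puts \<open>a * n + a\<close> below \<open>Suc a * n\<close>.\<close>
      have "a * (min d n + 1) \<le> a * (n + 1)" by (intro mult_left_mono) auto
      also have "\<dots> \<le> n * n"
      proof -
        have "Suc a * n \<le> n * n" using an by (intro mult_right_mono) auto
        then show ?thesis using an by simp
      qed
      finally have "length Ds \<le> n * n + 1" using I(6) by simp
      then have "run B Phase s' (n * n * 700) (\<lambda>s''. \<exists>S' Ds'. env s'' S' \<and> out s'' Ds' \<and> trace Ds' S' \<and>
         matching (arr s'' 5) S' T \<and> S' - T \<subseteq> S - T \<and>
         (\<forall>v\<in>S' - T. v = a \<or> arr s' 5 v \<noteq> 0 \<longrightarrow> arr s'' 5 v \<noteq> 0) \<and>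
         length Ds' \<le> length Ds + min d n + 1)"
        by (rule run_Phase[OF s'(3) I(1-4) s'(2) a])
      then show "run B Phase s' (n * n * 700) (I (Suc a))"
      proof (rule run_frame[OF s'(3)])
        fix r assume "\<exists>S' Ds'. env r S' \<and> out r Ds' \<and> trace Ds' S' \<and>
         matching (arr r 5) S' T \<and> S' - T \<subseteq> S - T \<and>
         (\<forall>v\<in>S' - T. v = a \<or> arr s' 5 v \<noteq> 0 \<longrightarrow> arr r 5 v \<noteq> 0) \<and>
         length Ds' \<le> length Ds + min d n + 1"
        then obtain S' Ds' where r: "env r S'" "out r Ds'" "trace Ds' S'"
          "matching (arr r 5) S' T" "S' - T \<subseteq> S - T"
          "\<forall>v\<in>S' - T. v = a \<or> arr s' 5 v \<noteq> 0 \<longrightarrow> arr r 5 v \<noteq> 0"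
          "length Ds' \<le> length Ds + min d n + 1" by blast
        have "arr r 5 v \<noteq> 0" if v: "v \<in> S' - T" "v < Suc a" for v
        proof -
          have "v \<in> S - T" using r(5) v(1) by blast
          then have "v = a \<or> arr s' 5 v \<noteq> 0" using I(5) v(2) by (auto simp: less_Suc_eq)
          then show ?thesis using r(6) v(1) by blast
        qed
        moreover have "length Ds' \<le> 1 + Suc a * (min d n + 1)" using r(7) I(6) by simp
        ultimately show "I (Suc a) r" unfolding I_def using r(1-4) by blast
      qed
    next
      assume "\<not> bval ?b s'"
      then have "a \<in> S - T \<longrightarrow> arr s' 5 a \<noteq> 0"
        using is_source_eval[OF I(1) s'(3), of 9] s'(2) an by auto
      then have "\<forall>v\<in>S - T. v < Suc a \<longrightarrow> arr s' 5 v \<noteq> 0" using I(5) by (auto simp: less_Suc_eq)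
      moreover have "length Ds \<le> 1 + Suc a * (min d n + 1)" using I(6) by simp
      ultimately have "I (Suc a) s'" unfolding I_def using I(1-4) by blast
      then have "run B Skip s' 1 (I (Suc a))" by (intro run_straight) auto
      then show "run B Skip s' (n * n * 700) (I (Suc a))" by (rule run_le) (use n_pos in simp)
    qed
    then have "run B ?c s' (n * n * 700 + 11) (I (Suc a))" by (rule run_le) simp
    then show "run B ?c s' (n * n * 700 + 11) (\<lambda>s''. I (Suc a) (set_reg 9 (Suc a) s''))"
      unfolding I_set .
  next
    fix r assume "I (reg s 0) r"
    then obtain S Ds where I: "env r S" "out r Ds" "trace Ds S" "matching (arr r 5) S T"
        "\<forall>v\<in>S - T. v < n \<longrightarrow> arr r 5 v \<noteq> 0" "length Ds \<le> 1 + n * (min d n + 1)"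
      unfolding I_def n by blast
    have "\<forall>v\<in>S - T. arr r 5 v \<noteq> 0" using I(5) covers_subset[OF trace_last(1)[OF I(3)]] by auto
    with I show "?Q r" by blast
  qed (use bd n in auto)
  then show ?thesis unfolding n by (rule run_le) simp
qed

lemma run_Finish:
  assumes bd: "bounded_state B s" and env: "env s S" and out: "out s Ds" and len: "length Ds \<le> (n + 2) * (n + 2)"
  shows "run B Finish s (n * 44) (\<lambda>s'. out s' (Ds @ [T]))"
proof -
  let ?c = "Store 1 (Reg 15) (Arr 2 (Reg 15))"
  note n = envD(1)[OF env]
  have "run B (For 15 0 ?c) s (reg s 0 * (4 + 8) + 6) (\<lambda>s'. \<forall>j<n. arr s' 1 j = of_bool (j \<in> T))"
  proof (rule run_For[where I = "\<lambda>i s'. \<forall>j<i. arr s' 1 j = of_bool (j \<in> T)"])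
    fix i s' assume s': "i < reg s 0" "reg s' 15 = i" "bounded_state B s'"
      "same_except (insert 15 (written_regs ?c)) (written_arrs ?c) s s'"
      "\<forall>j<i. arr s' 1 j = of_bool (j \<in> T)"
    have "arr s' 2 i = of_bool (i \<in> T)"
      using s'(1,4) n envD(3)[OF env, of i] by (simp add: same_except_def)
    then have "wp B ?c s' (\<lambda>s''. \<forall>j<Suc i. arr (set_reg 15 (Suc i) s'') 1 j = of_bool (j \<in> T))"
      using s' bounded_reg[OF s'(3), of 15] by (auto simp: less_Suc_eq)
    then show "run B ?c s' 4 (\<lambda>s''. \<forall>j<Suc i. arr (set_reg 15 (Suc i) s'') 1 j = of_bool (j \<in> T))"
      by (intro run_straight) auto
  qed (use bd n in auto)
  then have "run B (For 15 0 ?c) s (n * 12 + 6) (\<lambda>s'. \<forall>j<n. arr s' 1 j = of_bool (j \<in> T))"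
    unfolding n by (rule run_le) simp
  then have "run B Finish s (n * 12 + 6 + n * 26) (\<lambda>s'. out s' (Ds @ [T]))"
    unfolding Finish_def
  proof (rule run_seq[OF bd])
    fix s1 assume s1: "bounded_state B s1" "\<forall>j<n. arr s1 1 j = of_bool (j \<in> T)"
      and sm: "same_except (written_regs (For 15 0 ?c)) (written_arrs (For 15 0 ?c)) s s1"
    have "reg s1 0 = n" using sm n by (simp add: same_except_def)
    moreover have "out s1 Ds" by (rule out_same[OF out sm]) auto
    ultimately show "run B Emit s1 (n * 26) (\<lambda>s'. out s' (Ds @ [T]))"
      using run_Emit[OF s1(1) _ s1(2) _ len] by simp
  qed
  then show ?thesis by (rule run_le) (use n_pos in simp)
qed

lemma run_Reconfigure:
  assumes bd: "bounded_state B s" and n: "reg s 0 = n" and m: "reg s 1 = m" and r: "reg s 3 = 0"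
    and inc: "\<And>e u. e < m \<Longrightarrow> u < n \<Longrightarrow> arr s 0 (e * n + u) = of_bool (inc e u)"
    and S: "\<And>j. j < n \<Longrightarrow> arr s 1 j = of_bool (j \<in> S0)"
    and T': "\<And>j. j < n \<Longrightarrow> arr s 2 j = of_bool (j \<in> T)"
    and zero: "arr s 4 = (\<lambda>_. 0)" "arr s 5 = (\<lambda>_. 0)"
  shows "run B Reconfigure s (1000 * (n * n * n + n * n * m))
    (\<lambda>s'. \<exists>Ds. out s' Ds \<and> trace Ds T \<and> length Ds - 1 \<le> 3 * (n * d))" (is "run B _ s _ ?Q")
proof -
  let ?K = "n * n * n * 790"
  have cube: "1 \<le> n * n * n" "n \<le> n * n * n" using n_pos by auto
  have "run B Reconfigure s ((m * (n * (n * 33 + 14) + 14) + 6) + ((n * 16 + 6) +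
      (1 + bcost (Less (Const 1) (Reg 0)) + ?K))) ?Q"
    unfolding Reconfigure_def
  proof (rule run_seq[OF bd run_Adjacency[OF bd n m inc zero(1)]])
    fix s1 assume s1: "bounded_state B s1" "\<forall>u<n. \<forall>v<n. arr s1 4 (u * n + v) = of_bool (adj u v)"
      and sm1: "same_except (written_regs Adjacency) (written_arrs Adjacency) s s1"
    have e1: "env s1 S0" using s1(2) sm1 n S T' by (simp add: env_def same_except_def)
    have r1: "reg s1 3 = 0" "arr s1 5 = (\<lambda>_. 0)" using sm1 r zero by (auto simp: same_except_def)
    have p: "run B Write_Row s1 (n * 16 + 6)
       (\<lambda>s'. (\<forall>j<n. arr s' 3 (reg s1 3 * n + j) = of_bool (j \<in> S0)) \<and>
       (\<forall>p<reg s1 3 * n. arr s' 3 p = arr s1 3 p))"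
      by (rule run_Write_Row[OF s1(1) envD(1)[OF e1]]) (use r1 envD(2)[OF e1] in auto)
    show "run B (Seq Write_Row (Cond (Less (Const 1) (Reg 0)) (Seq Sweep Finish) Skip)) s1
       ((n * 16 + 6) + (1 + bcost (Less (Const 1) (Reg 0)) + ?K)) ?Q"
    proof (rule run_seq[OF s1(1) p])
      fix s2 assume s2: "bounded_state B s2"
        "(\<forall>j<n. arr s2 3 (reg s1 3 * n + j) = of_bool (j \<in> S0)) \<and> (\<forall>p<reg s1 3 * n. arr s2 3 p = arr s1 3 p)"
        and sm2: "same_except (written_regs Write_Row) (written_arrs Write_Row) s1 s2"
      have e2: "env s2 S0" by (rule env_same[OF e1 sm2]) auto
      have r2: "reg s2 3 = 0" "arr s2 5 = (\<lambda>_. 0)" using sm2 r1 by (auto simp: same_except_def)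
      have o2: "out s2 [S0]" using s2(2) r1 r2 by (simp add: out_def)
      note n2 = envD(1)[OF e2]
      show "run B (Cond (Less (Const 1) (Reg 0)) (Seq Sweep Finish) Skip) s2
         (1 + bcost (Less (Const 1) (Reg 0)) + ?K) ?Q"
      proof (rule run_cond)
        show "bfits B (Less (Const 1) (Reg 0)) s2" using s2(1) by simp
      next
        assume "\<not> bval (Less (Const 1) (Reg 0)) s2"
        then have "n = 1" using n2 n_pos by simp
        then have "S0 \<subseteq> {0}" "T \<subseteq> {0}" "card S0 = card T"
          using covers_subset[OF S0(1)] covers_subset[OF T(1)] S0(2) T(2) by auto
        then have "S0 = T" by (auto simp: subset_singleton_iff)
        then have "?Q s2" using o2 trace_init by (intro exI[of _ "[S0]"]) auto
        then have "run B Skip s2 1 ?Q" by (intro run_straight) auto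
        then show "run B Skip s2 ?K ?Q" by (rule run_le) (use n_pos in simp)
      next
        assume "bval (Less (Const 1) (Reg 0)) s2"
        then have n1: "1 < n" using n2 by simp
        have d1: "1 \<le> d"
        proof -
          obtain L where "L \<le> d" "(0, 1) \<in> {(u, v). u < n \<and> v < n \<and> adj u v} ^^ L"
            using dist[of 0 1] n1 by auto
          then show ?thesis by (cases L) auto
        qed
        have "run B (Seq Sweep Finish) s2 ((n * (n * n * 700 + 19) + 6) + n * 44) ?Q"
        proof (rule run_seq[OF s2(1) run_Sweep[OF s2(1) e2 o2 r2(2)]])
          fix s3 assume s3: "bounded_state B s3" "\<exists>S Ds. env s3 S \<and> out s3 Ds \<and> trace Ds S \<and>
            matching (arr s3 5) S T \<and> (\<forall>v\<in>S - T. arr s3 5 v \<noteq> 0) \<and> length Ds \<le> 1 + n * (min d n + 1)"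
          then obtain S Ds where I: "env s3 S" "out s3 Ds" "trace Ds S" "matching (arr s3 5) S T"
            "\<forall>v\<in>S - T. arr s3 5 v \<noteq> 0" "length Ds \<le> 1 + n * (min d n + 1)" by blast
          have mv: "move S T"
            by (rule move_of_matching[OF trace_last(1)[OF I(3)] T(1) _ I(4,5)])
              (use trace_last(2)[OF I(3)] T(2) in simp)
          have tr: "trace (Ds @ [T]) T" by (rule trace_snoc[OF I(3) mv T(1)])
          have "n * (min d n + 1) \<le> n * (n + 1)" by (intro mult_left_mono) auto
          moreover have "(n + 2) * (n + 2) = n * (n + 1) + 3 * n + 4" by (simp add: algebra_simps)
          ultimately have len: "length Ds \<le> (n + 2) * (n + 2)" using I(6) by linarith
          \<comment> \<open>The final sequence has \<open>length Ds\<close> moves, at most 1 + n + n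
            d. With \<open>d \<ge> 1\<close> each of the three summands is at most n d, which is the
            origin of the factor 3.\<close>
          have "n * (min d n + 1) \<le> n * (d + 1)" by (intro mult_left_mono) auto
          moreover have "n \<le> n * d" using d1 by simp
          moreover have "n * (d + 1) = n * d + n" by simp
          ultimately have "length Ds \<le> 3 * (n * d)" using I(6) n1 by linarith
          then have "length (Ds @ [T]) - 1 \<le> 3 * (n * d)" by simp
          then have "?Q s'" if "out s' (Ds @ [T])" for s' using that tr by blast
          then show "run B Finish s3 (n * 44) ?Q"
            by (rule run_frame[OF s3(1) run_Finish[OF s3(1) I(1,2) len]])
        qed
        moreover have "(n * (n * n * 700 + 19) + 6) + n * 44 \<le> ?K"
        proof -
          have "n * (n * n * 700 + 19) = 700 * (n * n * n) + 19 * n" by (simp add: algebra_simps)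
          then show ?thesis using cube by linarith
        qed
        ultimately show "run B (Seq Sweep Finish) s2 ?K ?Q" by (rule run_le)
      qed
    qed
  qed
  \<comment> \<open>Lower-order terms are charged to n^3 or to n^2 m, where 61 = 33 + 14 + 14; both
    coefficients stay below 1000.\<close>
  moreover have "(m * (n * (n * 33 + 14) + 14) + 6) + ((n * 16 + 6) +
      (1 + bcost (Less (Const 1) (Reg 0)) + ?K)) \<le> 1000 * (n * n * n + n * n * m)"
  proof -
    have "m * (n * (n * 33 + 14) + 14) \<le> m * (n * n * 61)"
    proof (rule mult_left_mono)
      have "n * (n * 33 + 14) = 33 * (n * n) + 14 * n" by (simp add: algebra_simps)
      then show "n * (n * 33 + 14) + 14 \<le> n * n * 61" using n_le_square by linarith
    qed simp
    also have "\<dots> = 61 * (n * n * m)" by simp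
    finally show ?thesis using cube unfolding bcost.simps acost.simps distrib_left by linarith
  qed
  ultimately show ?thesis by (rule run_le)
qed

end

section \<open>Transfer to hypergraphs\<close>

lemma hdist_le_one:
  assumes "v \<in> V" "w \<in> V" "v = w \<or> (\<exists>e\<in>F. v \<in> e \<and> w \<in> e)"
  shows "hdist V F v w \<le> 1"
proof (cases "v = w")
  case True
  then have "hpath V F v [v] w" using assms by (simp add: hpath_def)
  then have "hdist V F v w \<le> enat (length [v] - 1)"
    unfolding hdist_def by (intro INF_lower) simp
  then show ?thesis by (simp add: zero_enat_def[symmetric] order_trans[OF _ zero_le_one])
next
  case False
  then have "hpath V F v [v, w] w" using assms by (auto simp: hpath_def)
  then have "hdist V F v w \<le> enat (length [v, w] - 1)"
    unfolding hdist_def by (intro INF_lower) simp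
  then show ?thesis by (simp add: one_enat_def)
qed

lemma hpath_of_hdiam:
  assumes "hdiam V F = enat d" "u \<in> V" "v \<in> V"
  obtains p where "hpath V F u p v" "length p - 1 \<le> d"
proof -
  have "hdist V F u v \<le> hdiam V F"
    unfolding hdiam_def using assms(2,3) by (intro SUP_upper2[of "(u, v)"]) auto
  \<comment> \<open>A strict upper bound on the infimum is witnessed by a member below it, so a path
    of length at most \<open>d\<close> exists.\<close>
  also have "\<dots> < enat (Suc d)" using assms(1) by simp
  finally have "(INF p\<in>{p. hpath V F u p v}. enat (length p - 1)) < enat (Suc d)"
    by (simp add: hdist_def)
  then obtain p where "hpath V F u p v" "enat (length p - 1) < enat (Suc d)"
    by (auto simp: INF_less_iff)
  then show thesis using that by auto
qed

text \<open>Every vertex on the path is replaced by an index in \<open>xs\<close>; distinctness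
  identifies the last index with \<open>v\<close>.\<close>

lemma relpow_of_hpath:
  assumes xs: "set xs = V" and es: "set es = F" and p: "hpath V F (xs ! u) p (xs ! v)"
    and uv: "u < length xs" "v < length xs" and dist: "distinct xs"
    and R: "R = {(i, j). i < length xs \<and> j < length xs \<and>
       (\<exists>e<length es. xs ! i \<in> es ! e \<and> xs ! j \<in> es ! e)}"
  shows "(u, v) \<in> R ^^ (length p - 1)"
proof -
  have p': "p \<noteq> []" "p ! 0 = xs ! u" "p ! (length p - 1) = xs ! v" "set p \<subseteq> V"
    "\<And>i. Suc i < length p \<Longrightarrow> \<exists>e\<in>F. p ! i \<in> e \<and> p ! Suc i \<in> e"
    using p by (auto simp: hpath_def hd_conv_nth last_conv_nth)
  have "\<exists>j<length xs. xs ! j = p ! i \<and> (u, j) \<in> R ^^ i" if "i < length p" for i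
    using that
  proof (induction i)
    case 0
    then show ?case using p'(2) uv(1) by auto
  next
    case (Suc i)
    then obtain j where j: "j < length xs" "xs ! j = p ! i" "(u, j) \<in> R ^^ i" by auto
    have "p ! Suc i \<in> set xs" using p'(4) Suc.prems xs nth_mem by blast
    then obtain l where l: "l < length xs" "xs ! l = p ! Suc i" by (auto simp: in_set_conv_nth)
    obtain e where e: "e \<in> F" "p ! i \<in> e" "p ! Suc i \<in> e" using p'(5) Suc.prems by blast
    then obtain q where "q < length es" "es ! q = e" using es by (metis in_set_conv_nth)
    then have "(j, l) \<in> R" using j l e unfolding R by auto
    then show ?case using j l by auto
  qed
  from this[of "length p - 1"] p'(1) obtain j
    where "j < length xs" "xs ! j = p ! (length p - 1)" "(u, j) \<in> R ^^ (length p - 1)" by auto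
  then show ?thesis using p'(3) uv(2) dist by (auto simp: nth_eq_iff_index_eq)
qed

lemma reconfigure_correct:
  fixes V :: "'a set"
  assumes H: "hypergraph V F" and "card V = n" "card F = m" and diam: "hdiam V F = enat d"
    and Vs: "vertex_cover V F Vs" "card Vs = k" and Vt: "vertex_cover V F Vt" "card Vt = k"
    and xs: "distinct xs" "set xs = V" and es: "distinct es" "set es = F"
  shows "\<exists>t s Ds. exec ((n + m + 2) ^ 6) Reconfigure (input_state xs es k Vs Vt) t s \<and>
     t \<le> 1000 * (n * n * n + n * n * m) \<and> outputs xs Ds s \<and> reconf_seq V F k Ds \<and>
     hd Ds = Vs \<and> last Ds = Vt \<and> length Ds - 1 \<le> 3 * (n * d)"
proof -
  have lx: "length xs = n" using xs assms(2) distinct_card by fastforce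
  have le: "length es = m" using es assms(3) distinct_card by fastforce
  have n0: "0 < n" using H assms(2) by (auto simp: hypergraph_def card_gt_0_iff)
  define inc where "inc e i \<longleftrightarrow> xs ! i \<in> es ! e" for e i
  \<comment> \<open>\<open>pos\<close> turns vertex sets into index sets and \<open>img\<close>
    turns them back; on subsets of \<open>V\<close> the latter undoes the former. Both respect
    covers and cardinalities.\<close>
  define pos where "pos C = {i. i < n \<and> xs ! i \<in> C}" for C
  let ?B = "(n + m + 2) ^ 6"
  define img where "img D = (!) xs ` D" for D
  interpret incidence n m inc .
  have inj: "inj_on ((!) xs) {..<n}" using xs(1) lx by (simp add: inj_on_nth)
  have img_pos: "img (pos C) = C" if "C \<subseteq> V" for C
  proof -
    have "C \<subseteq> (!) xs ` {..<n}" using that xs(2) lx by (auto simp: set_conv_nth)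
    then show ?thesis by (auto simp: img_def pos_def)
  qed
  have card_img: "card (img D) = card D" if "D \<subseteq> {..<n}" for D
    unfolding img_def using inj that by (intro card_image) (rule inj_on_subset)
  have imgV: "img D \<subseteq> V" if "D \<subseteq> {..<n}" for D
    using that xs(2) lx by (auto simp: img_def)
  have F_iff: "(\<forall>e\<in>F. P e) \<longleftrightarrow> (\<forall>q<m. P (es ! q))" for P
    using es(2) le by (metis in_set_conv_nth)
  have cov_img: "vertex_cover V F (img D)" if cv: "covers D" for D
    unfolding vertex_cover_def F_iff
  proof (intro conjI allI impI)
    show "img D \<subseteq> V" by (rule imgV[OF covers_subset[OF cv]])
    fix q assume "q < m"
    then obtain i where "i \<in> D" "inc q i" using cv by (auto simp: covers_def)
    then show "es ! q \<inter> img D \<noteq> {}" by (auto simp: img_def inc_def)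
  qed
  have cov_pos: "covers (pos C)" if C: "vertex_cover V F C" for C
  proof -
    have CV: "C \<subseteq> V" using C by (simp add: vertex_cover_def)
    have "\<exists>i\<in>pos C. inc q i" if q: "q < m" for q
    proof -
      obtain c where c: "c \<in> es ! q" "c \<in> C" using C q by (auto simp: vertex_cover_def F_iff)
      then have "c \<in> img (pos C)" using img_pos[OF CV] by simp
      then show ?thesis using c(1) by (auto simp: img_def inc_def)
    qed
    then show ?thesis by (auto simp: covers_def pos_def)
  qed
  have VsV: "Vs \<subseteq> V" and VtV: "Vt \<subseteq> V" using Vs Vt by (auto simp: vertex_cover_def)
  have posn: "pos C \<subseteq> {..<n}" for C by (auto simp: pos_def)
  have card_pos: "card (pos C) = card C" if "C \<subseteq> V" for C
    using card_img[OF posn, of C] img_pos[OF that] by simp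
  have R: "{(u, v). u < n \<and> v < n \<and> adj u v} = {(i, j). i < length xs \<and> j < length xs \<and>
       (\<exists>e<length es. xs ! i \<in> es ! e \<and> xs ! j \<in> es ! e)}"
    by (auto simp: adj_def inc_def lx le)
  interpret instance_ram n m inc ?B "pos Vs" "pos Vt" k d
  proof
    show "0 < n" by (rule n0)
    show "covers (pos Vs)" "covers (pos Vt)" using cov_pos Vs Vt by auto
    show "card (pos Vs) = k" "card (pos Vt) = k" using card_pos VsV VtV Vs Vt by auto
    fix u v assume uv: "u < n" "v < n"
    then have "xs ! u \<in> V" "xs ! v \<in> V" using xs(2) lx by auto
    then obtain p where p: "hpath V F (xs ! u) p (xs ! v)" "length p - 1 \<le> d"
      using hpath_of_hdiam[OF diam] by blast
    have "(u, v) \<in> {(u, v). u < n \<and> v < n \<and> adj u v} ^^ (length p - 1)"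
      by (rule relpow_of_hpath[OF xs(2) es(2) p(1) _ _ xs(1) R]) (use uv lx in auto)
    then show "\<exists>L\<le>d. (u, v) \<in> {(u, v). u < n \<and> v < n \<and> adj u v} ^^ L" using p(2) by blast
  qed simp
  let ?s = "input_state xs es k Vs Vt"
  have "k \<le> n" using card_mono[of V Vs] VsV Vs(2) H assms(2) by (auto simp: hypergraph_def)
  then have "k < ?B" by (intro fits_linear) simp
  moreover have "m < ?B" by (rule fits_square) (simp add: algebra_simps)
  moreover have "n < ?B" by (rule fits_linear) simp
  ultimately have bd: "bounded_state ?B ?s"
    using n0 by (simp add: bounded_state_def input_state_def lx le)
  have "run ?B Reconfigure ?s (1000 * (n * n * n + n * n * m))
    (\<lambda>s'. \<exists>Ds. out s' Ds \<and> trace Ds (pos Vt) \<and> length Ds - 1 \<le> 3 * (n * d))"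
  proof (rule run_Reconfigure[OF bd])
    fix e u assume eu: "e < m" "u < n"
    have "Suc e * n \<le> m * n" using eu by (intro mult_right_mono) auto
    then have "e * n + u < m * n" using eu by simp
    then show "arr ?s 0 (e * n + u) = of_bool (inc e u)"
      using eu by (simp add: input_state_def lx le inc_def)
  qed (auto simp: input_state_def lx le pos_def)
  then obtain t s' Ds where r: "exec ?B Reconfigure ?s t s'" "t \<le> 1000 * (n * n * n + n * n * m)"
      "out s' Ds" "trace Ds (pos Vt)" "length Ds - 1 \<le> 3 * (n * d)"
    unfolding run_def by blast
  have sub: "D \<subseteq> {..<n}" if "D \<in> set Ds" for D
    using that r(4) covers_subset by (auto simp: trace_def)
  have tj: "tj_move V F (img D) (img D')" if mv: "move D D'" and D: "D \<subseteq> {..<n}" "D' \<subseteq> {..<n}" for D D'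
  proof -
    obtain f where f: "bij_betw f D D'" "\<forall>v\<in>D. f v = v \<or> adj v (f v)" using mv by (auto simp: move_def)
    \<comment> \<open>The bijection on indices, conjugated with \<open>(!) xs\<close>, whose
      injectivity lets \<open>inv_into\<close> recover the index of a vertex.\<close>
    define g where "g = (!) xs \<circ> f \<circ> inv_into D ((!) xs)"
    have b: "bij_betw ((!) xs) D (img D)" "bij_betw ((!) xs) D' (img D')"
      using inj D by (auto simp: bij_betw_def img_def intro: inj_on_subset)
    have "bij_betw g (img D) (img D')"
      unfolding g_def using bij_betw_inv_into[OF b(1)] f(1) b(2) by (metis bij_betw_trans comp_assoc)
    moreover have "hdist V F c (g c) \<le> 1" if c: "c \<in> img D" for c
    proof -
      obtain i where i: "i \<in> D" "c = xs ! i" using c by (auto simp: img_def)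
      have "inv_into D ((!) xs) c = i" using i bij_betw_inv_into_left[OF b(1)] by auto
      then have g: "g c = xs ! f i" by (simp add: g_def)
      have "f i \<in> D'" using f(1) i(1) by (auto simp: bij_betw_def)
      then have V: "c \<in> V" "g c \<in> V" using i D g xs(2) lx by auto
      have "\<exists>e\<in>F. xs ! i \<in> e \<and> xs ! f i \<in> e" if "adj i (f i)"
        using that es(2) le by (auto simp: adj_def inc_def)
      then have "c = g c \<or> (\<exists>e\<in>F. c \<in> e \<and> g c \<in> e)" using f(2) i g by metis
      then show ?thesis using hdist_le_one[OF V] by blast
    qed
    ultimately show ?thesis unfolding tj_move_def by blast
  qed
  let ?Ds = "map img Ds"
  have ne: "Ds \<noteq> []" using r(4) by (simp add: trace_def)
  have "outputs xs ?Ds s'"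
    unfolding outputs_def
  proof (intro conjI allI impI)
    have "Suc (reg s' 3) = length Ds" using r(3) by (simp add: out_def)
    then show "reg s' 3 = length ?Ds - 1" by simp
    fix i j assume i: "i < length ?Ds" and j: "j < length xs"
    have "Ds ! i \<subseteq> {..<n}" using sub i by simp
    then have "xs ! j \<in> img (Ds ! i) \<longleftrightarrow> j \<in> Ds ! i"
      using inj j lx by (auto simp: img_def inj_on_def)
    then show "arr s' 3 (i * length xs + j) = of_bool (xs ! j \<in> ?Ds ! i)"
      using r(3) i j by (simp add: out_def lx)
  qed
  moreover have "reconf_seq V F k ?Ds"
    unfolding reconf_seq_def
  proof (intro conjI ballI allI impI)
    show "?Ds \<noteq> []" using ne by simp
    fix D assume "D \<in> set ?Ds"
    then show "vertex_cover V F D" "card D = k"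
      using r(4) cov_img card_img sub by (auto simp: trace_def)
  next
    fix i assume i: "Suc i < length ?Ds"
    then have "move (Ds ! i) (Ds ! Suc i)" using r(4) by (simp add: trace_def)
    then show "tj_move V F (?Ds ! i) (?Ds ! Suc i)" using tj sub i by simp
  qed
  moreover have "hd ?Ds = Vs" "last ?Ds = Vt"
    using r(4) ne img_pos VsV VtV by (auto simp: trace_def hd_map last_map)
  ultimately show ?thesis using r(1,2,5) by (intro exI[of _ t] exI[of _ s'] exI[of _ ?Ds]) auto
qed

theorem theorem2:
  "\<exists>(prog :: com) (w :: nat) (C1 :: real) (C2 :: real).
     \<forall>(V :: 'a set) (F :: 'a set set) (n :: nat) (m :: nat) (d :: nat) (k :: nat)
        (Vs :: 'a set) (Vt :: 'a set) (xs :: 'a list) (es :: 'a set list).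
       hypergraph V F \<longrightarrow> hconnected V F \<longrightarrow>
       card V = n \<longrightarrow> card F = m \<longrightarrow> hdiam V F = enat d \<longrightarrow>
       vertex_cover V F Vs \<longrightarrow> card Vs = k \<longrightarrow>
       vertex_cover V F Vt \<longrightarrow> card Vt = k \<longrightarrow>
       distinct xs \<longrightarrow> set xs = V \<longrightarrow> distinct es \<longrightarrow> set es = F \<longrightarrow>
       (\<exists>t s Ds.
          exec ((n + m + 2) ^ w) prog (input_state xs es k Vs Vt) t s \<and>
          real t \<le> C1 * (real n powr (7 / 2) + real n ^ 2 * real m) \<and>
          outputs xs Ds s \<and>
          reconf_seq V F k Ds \<and> hd Ds = Vs \<and> last Ds = Vt \<and>
          real (length Ds - 1) \<le> C2 * (real n * real d))"
proof (rule exI[of _ Reconfigure], rule exI[of _ 6], rule exI[of _ 1000], rule exI[of _ 3],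
    intro allI impI)
  fix V :: "'a set" and F :: "'a set set" and n m d k :: nat and Vs Vt :: "'a set"
    and xs :: "'a list" and es :: "'a set list"
  assume H: "hypergraph V F" and "hconnected V F" and n: "card V = n" and m: "card F = m"
    and diam: "hdiam V F = enat d" and Vs: "vertex_cover V F Vs" "card Vs = k"
    and Vt: "vertex_cover V F Vt" "card Vt = k" and xs: "distinct xs" "set xs = V"
    and es: "distinct es" "set es = F"
  obtain t s Ds where r: "exec ((n + m + 2) ^ 6) Reconfigure (input_state xs es k Vs Vt) t s"
     "t \<le> 1000 * (n * n * n + n * n * m)" "outputs xs Ds s" "reconf_seq V F k Ds"
     "hd Ds = Vs" "last Ds = Vt" "length Ds - 1 \<le> 3 * (n * d)"
    using reconfigure_correct[OF H n m diam Vs Vt xs es] by blast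
  have "0 < n" using H n by (auto simp: hypergraph_def card_gt_0_iff)
  \<comment> \<open>The run is cubic in \<open>n\<close> apart from the term n^2 m, and
    \<open>n \<ge> 1\<close> puts the cube below the exponent 7/2 of the claim.\<close>
  then have "real n ^ 3 \<le> real n powr (7 / 2)"
    using powr_mono[of 3 "7 / 2" "real n"] by simp
  then have cube: "real (n * n * n) \<le> real n powr (7 / 2)" by (simp add: power3_eq_cube)
  have "real t \<le> real (1000 * (n * n * n + n * n * m))" using r(2) by (simp only: of_nat_le_iff)
  also have "\<dots> = 1000 * (real (n * n * n) + real n ^ 2 * real m)" by (simp add: power2_eq_square)
  also have "\<dots> \<le> 1000 * (real n powr (7 / 2) + real n ^ 2 * real m)" using cube by simp
  finally have time: "real t \<le> 1000 * (real n powr (7 / 2) + real n ^ 2 * real m)" .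
  have "real (length Ds - 1) \<le> real (3 * (n * d))" using r(7) by (simp only: of_nat_le_iff)
  then have "real (length Ds - 1) \<le> 3 * (real n * real d)" by simp
  with r time show "\<exists>t s Ds.
          exec ((n + m + 2) ^ 6) Reconfigure (input_state xs es k Vs Vt) t s \<and>
          real t \<le> 1000 * (real n powr (7 / 2) + real n ^ 2 * real m) \<and>
          outputs xs Ds s \<and>
          reconf_seq V F k Ds \<and> hd Ds = Vs \<and> last Ds = Vt \<and>
          real (length Ds - 1) \<le> 3 * (real n * real d)"
    by blast
qed

end
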